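(* Let $\mathcal{S}$ be a finite set, $\boldsymbol{p}$ a probability distribution on $\mathcal{S}$, $Q$ an intensity matrix on $\mathcal{S}$, and let $\mu_i\in\mathbb{R}$ and $\sigma_i>0$ for $i\in\mathcal{S}$. Then there exists a probability space $(\Omega,\mathscr{F},\mathbb{P})$ on which live a Markov-modulated Brownian motion $(\mathcal{R},\mathcal{J})=\{(R(t),J(t))\}_{t\ge 0}$ with parameters $\boldsymbol{p}$, $Q$, $\{\mu_i\}_{i\in\mathcal{S}}$, $\{\sigma_i\}_{i\in\mathcal{S}}$, and a sequence of stochastic fluid processes $\{(\mathcal{R}^n,\mathcal{J}^n)\}_{n\ge 0}$, $(\mathcal{R}^n,\mathcal{J}^n)=\{(R^n(t),J^n(t))\}_{t\ge 0}$, where $\mathcal{J}^n$ has state space $\{+,-\}\times\mathcal{S}$, such that for all $T\ge 0$ $$\lim_{n\to\infty}\ \sup_{0\le s\le T}|R(s)-R^n(s)|=0\quad\text{a.s.},$$ $$\lim_{n\to\infty}\pi_2(J^n(T))=J(T)\quad\text{a.s.},$$ where $\pi_2:\{+,-\}\times\mathcal{S}\to\mathcal{S}$ denotes the second-coordinate projection.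
   Context: An intensity matrix $Q$ on a finite set $\mathcal{S}$ is a matrix with nonnegative off-diagonal entries and zero row sums. A Markov-modulated Brownian motion (MMBM) with parameters $\boldsymbol{p},Q,\{\mu_i\},\{\sigma_i>0\}$ is a process $(\mathcal{R},\mathcal{J})$ where $\mathcal{J}=\{J(t)\}_{t\ge0}$ is a (right-continuous) Markov jump process on $\mathcal{S}$ with initial distribution $\boldsymbol{p}$ and intensity matrix $Q$, and $$R(t)=\int_0^t\mu_{J(s)}\,ds+\int_0^t\sigma_{J(s)}\,dB(s),\qquad t\ge0,$$ with $B$ a standard Brownian motion independent of $\mathcal{J}$. A stochastic fluid process (also called stochastic fluid model) is a process of the same type with all $\sigma$'s equal to zero: the phase process is a Markov jump process on a finite state space and the level is $\int_0^t r(\text{phase}(s))\,ds$ for a real-valued function $r$ on the state space. The set $\mathcal{S}$ carries the discrete topology. *)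

theory Defs
  imports "HOL-Probability.Probability"
begin

text \<open>
  Finite state spaces are finite types. All processes are functions of a time in \<open>real\<close> and an
  outcome; only the times \<open>t \<ge> 0\<close> matter.
\<close>

section \<open>Markov jump processes\<close>

definition intensity_matrix :: "real ^ 's ^ 's \<Rightarrow> bool" where
  "intensity_matrix Q \<longleftrightarrow>
     (\<forall>i j. i \<noteq> j \<longrightarrow> 0 \<le> Q $ i $ j) \<and> (\<forall>i. (\<Sum>j\<in>UNIV. Q $ i $ j) = 0)"

text \<open>The matrix exponential of \<open>t Q\<close>; the library multiplication \<open>*\<close> on \<open>real ^ 's ^ 's\<close> is
  componentwise, so powers are iterates of the matrix product \<open>**\<close>.\<close>

definition transition_matrix :: "real ^ 's ^ 's \<Rightarrow> real \<Rightarrow> real ^ 's ^ 's" where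
  "transition_matrix Q t = (\<Sum>k. (t ^ k / fact k) *\<^sub>R (((**) Q ^^ k) (mat 1)))"

text \<open>
  The last clause is the Markov property with transition function \<open>transition_matrix Q\<close>, with the
  conditional probability multiplied out so that conditioning on null events does not arise.
  Right-continuity for the discrete topology together with these finite-dimensional
  distributions implies that almost surely there are finitely many jumps in bounded intervals.
\<close>

definition markov_jump_process ::
    "'w measure \<Rightarrow> 's pmf \<Rightarrow> real ^ 's ^ 's \<Rightarrow> (real \<Rightarrow> 'w \<Rightarrow> 's::finite) \<Rightarrow> bool" where
  "markov_jump_process M p Q J \<longleftrightarrow>
     prob_space M \<and> intensity_matrix Q \<and>
     (\<forall>t\<ge>0. J t \<in> measurable M (count_space UNIV)) \<and>
     (\<forall>\<omega>\<in>space M. \<forall>t\<ge>0. limitin (discrete_topology UNIV) (\<lambda>s. J s \<omega>) (J t \<omega>) (at_right t)) \<and>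
     (\<forall>i. \<P>(\<omega> in M. J 0 \<omega> = i) = pmf p i) \<and>
     (\<forall>n (t :: nat \<Rightarrow> real) (i :: nat \<Rightarrow> 's). 0 \<le> t 0 \<and> incseq t \<longrightarrow>
        \<P>(\<omega> in M. \<forall>k\<le>Suc n. J (t k) \<omega> = i k) =
        \<P>(\<omega> in M. \<forall>k\<le>n. J (t k) \<omega> = i k) *
          transition_matrix Q (t (Suc n) - t n) $ i n $ i (Suc n))"

section \<open>Brownian motion and the stochastic integral\<close>

definition standard_brownian_motion :: "'w measure \<Rightarrow> (real \<Rightarrow> 'w \<Rightarrow> real) \<Rightarrow> bool" where
  "standard_brownian_motion M B \<longleftrightarrow>
     prob_space M \<and>
     (\<forall>t\<ge>0. B t \<in> borel_measurable M) \<and>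
     (\<forall>\<omega>\<in>space M. B 0 \<omega> = 0 \<and> continuous_on {0..} (\<lambda>t. B t \<omega>)) \<and>
     (\<forall>n (t :: nat \<Rightarrow> real). 0 \<le> t 0 \<and> incseq t \<longrightarrow>
        prob_space.indep_vars M (\<lambda>_. borel) (\<lambda>k \<omega>. B (t (Suc k)) \<omega> - B (t k) \<omega>) {..<n}) \<and>
     (\<forall>s t. 0 \<le> s \<and> s < t \<longrightarrow>
        distributed M lborel (\<lambda>\<omega>. B t \<omega> - B s \<omega>) (normal_density 0 (sqrt (t - s))))"

definition independent_processes ::
    "'w measure \<Rightarrow> (real \<Rightarrow> 'w \<Rightarrow> real) \<Rightarrow> (real \<Rightarrow> 'w \<Rightarrow> 's) \<Rightarrow> bool" where
  "independent_processes M B J \<longleftrightarrow>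
     prob_space.indep_set M
       (sets (vimage_algebra (space M) (\<lambda>\<omega>. \<lambda>t\<in>{0..}. B t \<omega>) (Pi\<^sub>M {0..} (\<lambda>_. borel))))
       (sets (vimage_algebra (space M) (\<lambda>\<omega>. \<lambda>t\<in>{0..}. J t \<omega>) (Pi\<^sub>M {0..} (\<lambda>_. count_space UNIV))))"

text \<open>The filtration generated jointly by \<open>B\<close> and \<open>J\<close>. If the two are independent and \<open>B\<close> is a
  Brownian motion, then \<open>B\<close> is a Brownian motion with respect to this filtration.\<close>

definition joint_filtration ::
    "'w measure \<Rightarrow> (real \<Rightarrow> 'w \<Rightarrow> real) \<Rightarrow> (real \<Rightarrow> 'w \<Rightarrow> 's) \<Rightarrow> real \<Rightarrow> 'w measure" where
  "joint_filtration M B J t = sigma (space M)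
     ({B s -` A \<inter> space M | s A. 0 \<le> s \<and> s \<le> t \<and> A \<in> sets borel} \<union>
      {J s -` A \<inter> space M | s A. 0 \<le> s \<and> s \<le> t})"

definition converges_in_probability ::
    "'w measure \<Rightarrow> (nat \<Rightarrow> 'w \<Rightarrow> real) \<Rightarrow> ('w \<Rightarrow> real) \<Rightarrow> bool" where
  "converges_in_probability M X Y \<longleftrightarrow>
     (\<forall>\<epsilon>>0. (\<lambda>m. \<P>(\<omega> in M. \<epsilon> < \<bar>X m \<omega> - Y \<omega>\<bar>)) \<longlonglongrightarrow> 0)"

text \<open>The data \<open>n, \<tau>, \<xi>\<close> encode the simple process equal to \<open>\<xi> k\<close> on \<open>{\<tau> k <.. \<tau> (Suc k)}\<close> for
  \<open>k < n\<close> and to \<open>0\<close> elsewhere.\<close>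

definition simple_integrand ::
    "'w measure \<Rightarrow> (real \<Rightarrow> 'w measure) \<Rightarrow> nat \<Rightarrow> (nat \<Rightarrow> real) \<Rightarrow> (nat \<Rightarrow> 'w \<Rightarrow> real) \<Rightarrow> bool" where
  "simple_integrand M F n \<tau> \<xi> \<longleftrightarrow>
     0 \<le> \<tau> 0 \<and> incseq \<tau> \<and>
     (\<forall>k<n. \<xi> k \<in> borel_measurable (F (\<tau> k))) \<and>
     (\<exists>C. \<forall>k<n. \<forall>\<omega>\<in>space M. \<bar>\<xi> k \<omega>\<bar> \<le> C)"

definition simple_process ::
    "nat \<Rightarrow> (nat \<Rightarrow> real) \<Rightarrow> (nat \<Rightarrow> 'w \<Rightarrow> real) \<Rightarrow> real \<Rightarrow> 'w \<Rightarrow> real" where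
  "simple_process n \<tau> \<xi> s \<omega> = (\<Sum>k<n. \<xi> k \<omega> * indicator {\<tau> k <.. \<tau> (Suc k)} s)"

definition simple_integral ::
    "(real \<Rightarrow> 'w \<Rightarrow> real) \<Rightarrow> nat \<Rightarrow> (nat \<Rightarrow> real) \<Rightarrow> (nat \<Rightarrow> 'w \<Rightarrow> real) \<Rightarrow> real \<Rightarrow> 'w \<Rightarrow> real" where
  "simple_integral B n \<tau> \<xi> t \<omega> =
     (\<Sum>k<n. \<xi> k \<omega> * (B (min (\<tau> (Suc k)) t) \<omega> - B (min (\<tau> k) t) \<omega>))"

text \<open>
  \<open>X\<close> is (a version of) the Ito integral of \<open>H\<close> with respect to \<open>B\<close> over \<open>[0, t]\<close>: the limit in
  probability of the integrals of simple processes \<open>H\<^sub>m\<close> with \<open>\<integral>\<^sub>0\<^sup>t (H - H\<^sub>m)\<^sup>2 ds \<rightarrow> 0\<close> in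
  probability. It is meaningful when \<open>B\<close> is a Brownian motion with respect to the filtration \<open>F\<close>,
  and then it determines \<open>X\<close> almost surely.
\<close>

definition has_ito_integral ::
    "'w measure \<Rightarrow> (real \<Rightarrow> 'w measure) \<Rightarrow> (real \<Rightarrow> 'w \<Rightarrow> real) \<Rightarrow> (real \<Rightarrow> 'w \<Rightarrow> real) \<Rightarrow>
     real \<Rightarrow> ('w \<Rightarrow> real) \<Rightarrow> bool" where
  "has_ito_integral M F B H t X \<longleftrightarrow>
     (\<lambda>(s, \<omega>). H s \<omega>) \<in> borel_measurable (restrict_space borel {0..t} \<Otimes>\<^sub>M M) \<and>
     (\<forall>s\<in>{0..t}. H s \<in> borel_measurable (F s)) \<and>
     (AE \<omega> in M. set_integrable lborel {0..t} (\<lambda>s. (H s \<omega>)\<^sup>2)) \<and>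
     X \<in> borel_measurable M \<and>
     (\<exists>n \<tau> \<xi>.
        (\<forall>m. simple_integrand M F (n m) (\<tau> m) (\<xi> m)) \<and>
        converges_in_probability M
          (\<lambda>m \<omega>. LINT s:{0..t}|lborel. (H s \<omega> - simple_process (n m) (\<tau> m) (\<xi> m) s \<omega>)\<^sup>2)
          (\<lambda>\<omega>. 0) \<and>
        converges_in_probability M (\<lambda>m. simple_integral B (n m) (\<tau> m) (\<xi> m) t) X)"

section \<open>Markov-modulated Brownian motion and stochastic fluid processes\<close>

text \<open>\<open>I\<close> is the continuous version of the stochastic integral process.\<close>

definition markov_modulated_brownian_motion ::
    "'w measure \<Rightarrow> 's pmf \<Rightarrow> real ^ 's ^ 's \<Rightarrow> ('s \<Rightarrow> real) \<Rightarrow> ('s \<Rightarrow> real) \<Rightarrow>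
     (real \<Rightarrow> 'w \<Rightarrow> real) \<Rightarrow> (real \<Rightarrow> 'w \<Rightarrow> 's::finite) \<Rightarrow> bool" where
  "markov_modulated_brownian_motion M p Q \<mu> \<sigma> R J \<longleftrightarrow>
     (\<forall>i. 0 < \<sigma> i) \<and>
     markov_jump_process M p Q J \<and>
     (\<forall>t\<ge>0. R t \<in> borel_measurable M) \<and>
     (\<exists>B I.
        standard_brownian_motion M B \<and>
        independent_processes M B J \<and>
        (\<forall>t\<ge>0. has_ito_integral M (joint_filtration M B J) B (\<lambda>s \<omega>. \<sigma> (J s \<omega>)) t (I t)) \<and>
        (\<forall>\<omega>\<in>space M. continuous_on {0..} (\<lambda>t. I t \<omega>)) \<and>
        (\<forall>\<omega>\<in>space M. \<forall>t\<ge>0. R t \<omega> = (LINT s:{0..t}|lborel. \<mu> (J s \<omega>)) + I t \<omega>))"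

definition stochastic_fluid_process ::
    "'w measure \<Rightarrow> (real \<Rightarrow> 'w \<Rightarrow> real) \<Rightarrow> (real \<Rightarrow> 'w \<Rightarrow> 's::finite) \<Rightarrow> bool" where
  "stochastic_fluid_process M R J \<longleftrightarrow>
     (\<exists>p Q (r :: 's \<Rightarrow> real).
        markov_jump_process M p Q J \<and>
        (\<forall>t\<ge>0. R t \<in> borel_measurable M) \<and>
        (\<forall>\<omega>\<in>space M. \<forall>t\<ge>0. R t \<omega> = (LINT s:{0..t}|lborel. r (J s \<omega>))))"

datatype sign = Plus | Minus

instance sign :: finite
proof
  have "(UNIV :: sign set) \<subseteq> {Plus, Minus}"
    using sign.exhaust by auto
  then show "finite (UNIV :: sign set)"
    by (rule finite_subset) simp
qed

end

theory Submission
  imports Defs "HOL-Real_Asymp.Real_Asymp"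
begin

text \<open>
  Fix \<open>n\<close> and \<open>c = 2\<^sup>n\<close>. A Brownian motion \<open>B\<close>, sampled at the arrivals of an independent Poisson
  process of rate \<open>c\<^sup>2 / 2\<close>, has iid Laplace increments \<open>L\<^sub>k\<close> of rate \<open>c\<close>. If \<open>m\<^sub>k\<close> are independent
  exponential variables of rate \<open>2 c\<close>, then \<open>max L\<^sub>k 0 + m\<^sub>k\<close> and \<open>max (- L\<^sub>k) 0 + m\<^sub>k\<close> are independent
  and exponential of rate \<open>c\<close>: they are two exponential variables recovered from their difference and
  minimum. Run a particle up for the time \<open>(max L\<^sub>k 0 + m\<^sub>k) / c\<close> and down for the time
  \<open>(max (- L\<^sub>k) 0 + m\<^sub>k) / c\<close>, at speed \<open>c\<close>. Its direction is a Markov jump process with flip rate \<open>c\<^sup>2\<close>,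
  and at the ends of the up-down cycles its position agrees with \<open>B\<close> at the sampling times. By the
  law of large numbers both time scales are asymptotically the identity, so the position converges to
  \<open>B\<close> uniformly on compact time intervals.

  Let \<open>J\<close> be a jump process independent of all this and take \<open>J\<^sup>n\<close> to be the pair of the direction and
  \<open>J\<close>, with the same \<open>J\<close> for every \<open>n\<close>. Since \<open>J\<close> has finitely many jumps on compact intervals, the
  integral of \<open>\<sigma>\<close> along \<open>J\<close> can be written by summation by parts, as a functional of the integrator that
  is continuous for uniform convergence. Applied to \<open>B\<close> this functional is the Ito integral, applied to
  the position it is the level of a fluid process.
\<close>

section \<open>Sequences of independent random variables\<close>

text \<open>The convergence is almost sure, so each approximation must be a functional of the one
  path of \<open>B\<close> and of additional randomness; a limit theorem in law would not do. The
  variables \<open>m_k\<close> supply exactly what the increments of \<open>B\<close> leave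
  undetermined: passing from two exponential variables to difference and minimum is invertible, and
  the two results are independent.

  The rates are forced. A Laplace variable of rate \<open>c\<close> has variance
  \<open>2 / c^2\<close>, hence the mean waiting time \<open>2 / c^2\<close> between samples of
  \<open>B\<close>; an up-down cycle at speed \<open>c\<close> also lasts \<open>2 / c^2\<close> on
  average. Both clocks thus make about \<open>c^2 / 2\<close> cycles per unit of time. With
  \<open>c = 2^n\<close> the Chebyshev bounds at rational times are of order \<open>4^-n\<close>, so
  Borel-Cantelli applies to them, and monotonicity of the clocks covers the times in between.

  All randomness sits in the coordinates of one sequence of reals. \<open>B\<close> is a measurable
  function of countably many normal coordinates, and independence of two objects reduces to their
  reading disjoint sets of coordinates.\<close>

abbreviation seq_measure :: "'a measure \<Rightarrow> (nat \<Rightarrow> 'a) measure" where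
  "seq_measure N \<equiv> Pi\<^sub>M UNIV (\<lambda>_. N)"

definition iid :: "'w measure \<Rightarrow> 'a measure \<Rightarrow> ('w \<Rightarrow> nat \<Rightarrow> 'a) \<Rightarrow> bool" where
  "iid M N X \<longleftrightarrow> X \<in> measurable M (seq_measure N) \<and> distr M (seq_measure N) X = seq_measure N"

lemma product_prob_space_const: "prob_space N \<Longrightarrow> product_prob_space (\<lambda>_. N)"
  by (simp add: product_prob_space_def product_prob_space_axioms_def product_sigma_finite_def
      prob_space_imp_sigma_finite)

lemma prob_space_seq_measure: "prob_space N \<Longrightarrow> prob_space (seq_measure N)"
  by (rule prob_space_PiM)

lemma emeasure_seq_measure_cylinder:
  assumes "prob_space N" "\<And>k. k < n \<Longrightarrow> A k \<in> sets N"
  shows "emeasure (seq_measure N) {x \<in> space (seq_measure N). \<forall>k<n. x k \<in> A k} = (\<Prod>k<n. emeasure N (A k))"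
  using product_prob_space.emeasure_PiM_Collect[OF product_prob_space_const[OF assms(1)], of "{..<n}" UNIV A] assms(2)
  by (simp add: Ball_def)

text \<open>Only finitely many coordinates occur, so the integral can be taken over a finite
  product, where it factorizes.\<close>

lemma nn_integral_seq_measure_prod:
  assumes N: "prob_space N" and h: "\<And>k. k < n \<Longrightarrow> h k \<in> borel_measurable N"
  shows "(\<integral>\<^sup>+ x. (\<Prod>k<n. h k (x k)) \<partial>seq_measure N) = (\<Prod>k<n. \<integral>\<^sup>+ y. h k y \<partial>N)"
proof -
  interpret product_prob_space "\<lambda>_. N" "UNIV :: nat set"
    by (rule product_prob_space_const[OF N])
  have [measurable]: "h k \<in> borel_measurable N" if "k \<in> {..<n}" for k
    using h that by auto
  have "(\<integral>\<^sup>+ x. (\<Prod>k<n. h k (x k)) \<partial>seq_measure N)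
      = (\<integral>\<^sup>+ x. (\<Prod>k<n. h k (restrict x {..<n} k)) \<partial>seq_measure N)"
    by (intro nn_integral_cong prod.cong) auto
  also have "\<dots> = (\<integral>\<^sup>+ x. (\<Prod>k<n. h k (x k)) \<partial>distr (seq_measure N) (Pi\<^sub>M {..<n} (\<lambda>_. N)) (\<lambda>x. restrict x {..<n}))"
    by (subst nn_integral_distr) auto
  also have "\<dots> = (\<integral>\<^sup>+ x. (\<Prod>k<n. h k (x k)) \<partial>(Pi\<^sub>M {..<n} (\<lambda>_. N)))"
    by (subst distr_PiM_restrict_finite) auto
  also have "\<dots> = (\<Prod>k<n. \<integral>\<^sup>+ y. h k y \<partial>N)"
    by (rule product_nn_integral_prod) (auto intro: h)
  finally show ?thesis .
qed

text \<open>Cylinders over finitely many coordinates determine a measure on sequences, and every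
  finite index set lies in an initial segment, the remaining factors being the whole space. Asking
  only for arbitrarily large lengths \<open>m\<close> lets a caller work with the even ones
  alone.\<close>

lemma iidI:
  assumes M: "prob_space M" and N: "prob_space N" and X: "X \<in> measurable M (seq_measure N)"
    and cyl: "\<And>n. \<exists>m\<ge>n. \<forall>A. (\<forall>k<m. A k \<in> sets N) \<longrightarrow>
      emeasure M {\<omega> \<in> space M. \<forall>k<m. X \<omega> k \<in> A k} = (\<Prod>k<m. emeasure N (A k))"
  shows "iid M N X"
  unfolding iid_def
proof (intro conjI X)
  interpret product_prob_space "\<lambda>_. N" "UNIV :: nat set"
    by (rule product_prob_space_const[OF N])
  show "distr M (seq_measure N) X = seq_measure N"
  proof (rule PiM_eq)
    fix J :: "nat set" and F :: "nat \<Rightarrow> 'b set"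
    assume J: "finite J" and F: "\<And>j. j \<in> J \<Longrightarrow> F j \<in> sets N"
    from J obtain n where n: "J \<subseteq> {..<n}"
      by (metis finite_nat_set_iff_bounded lessThan_iff subsetI)
    obtain m where "m \<ge> n" and m: "\<And>A. (\<forall>k<m. A k \<in> sets N) \<longrightarrow>
      emeasure M {\<omega> \<in> space M. \<forall>k<m. X \<omega> k \<in> A k} = (\<Prod>k<m. emeasure N (A k))"
      using cyl[of n] by blast
    with n have Jm: "J \<subseteq> {..<m}" by auto
    define A where "A k = (if k \<in> J then F k else space N)" for k
    have sp: "X \<omega> k \<in> space N" if "\<omega> \<in> space M" for \<omega> k
      using measurable_space[OF X that] by (auto simp: space_PiM)
    have "emeasure (distr M (seq_measure N) X) (prod_emb UNIV (\<lambda>_. N) J (\<Pi>\<^sub>E j\<in>J. F j))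
       = emeasure M (X -` prod_emb UNIV (\<lambda>_. N) J (\<Pi>\<^sub>E j\<in>J. F j) \<inter> space M)"
      using J F X by (subst emeasure_distr) auto
    also have "X -` prod_emb UNIV (\<lambda>_. N) J (\<Pi>\<^sub>E j\<in>J. F j) \<inter> space M = {\<omega> \<in> space M. \<forall>k<m. X \<omega> k \<in> A k}"
      using Jm sp by (auto simp: prod_emb_def A_def Pi_iff space_PiM split: if_splits) (meson Jm lessThan_iff subsetD)
    also have "emeasure M \<dots> = (\<Prod>k<m. emeasure N (A k))"
      using m[of A] F by (auto simp: A_def)
    also have "\<dots> = (\<Prod>k\<in>J. emeasure N (A k))"
      by (rule prod.mono_neutral_right) (use Jm in \<open>auto simp: A_def M.emeasure_space_1\<close>)
    also have "\<dots> = (\<Prod>j\<in>J. emeasure N (F j))"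
      by (intro prod.cong) (auto simp: A_def)
    finally show "emeasure (distr M (seq_measure N) X) (prod_emb UNIV (\<lambda>_. N) J (\<Pi>\<^sub>E j\<in>J. F j)) = (\<Prod>j\<in>J. emeasure N (F j))" .
  qed simp
qed

lemma iid_measurable: "iid M N X \<Longrightarrow> X \<in> measurable M (seq_measure N)"
  by (simp add: iid_def)

lemma iid_coord_measurable: "iid M N X \<Longrightarrow> (\<lambda>\<omega>. X \<omega> k) \<in> measurable M N"
  using measurable_compose[OF iid_measurable measurable_component_singleton[of k UNIV "\<lambda>_. N"]] by simp

lemma iid_emeasure:
  assumes "iid M N X" "A \<in> sets (seq_measure N)"
  shows "emeasure M {\<omega> \<in> space M. X \<omega> \<in> A} = emeasure (seq_measure N) A"
  using assms emeasure_distr[of X M "seq_measure N" A]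
  by (auto simp: iid_def vimage_def Int_def conj_commute)

lemma iid_cylinder:
  assumes X: "iid M N X" and N: "prob_space N" and A: "\<And>k. k < n \<Longrightarrow> A k \<in> sets N"
  shows "emeasure M {\<omega> \<in> space M. \<forall>k<n. X \<omega> k \<in> A k} = (\<Prod>k<n. emeasure N (A k))"
proof -
  have [measurable]: "A k \<in> sets N" if "k \<in> {..<n}" for k using A that by auto
  let ?C = "{x \<in> space (seq_measure N). \<forall>k<n. x k \<in> A k}"
  have "?C = {x \<in> space (seq_measure N). \<forall>k\<in>{..<n}. x k \<in> A k}"
    by auto
  also have "\<dots> \<in> sets (seq_measure N)" by measurable
  finally have C: "?C \<in> sets (seq_measure N)" .
  have "{\<omega> \<in> space M. \<forall>k<n. X \<omega> k \<in> A k} = {\<omega> \<in> space M. X \<omega> \<in> ?C}"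
    using measurable_space[OF iid_measurable[OF X]] by blast
  then have "emeasure M {\<omega> \<in> space M. \<forall>k<n. X \<omega> k \<in> A k} = emeasure (seq_measure N) ?C"
    using iid_emeasure[OF X C] by (simp only:)
  also have "\<dots> = (\<Prod>k<n. emeasure N (A k))"
    by (rule emeasure_seq_measure_cylinder[OF N A])
  finally show ?thesis .
qed

lemma iid_distr_coord:
  assumes X: "iid M N X" and N: "prob_space N"
  shows "distr M N (\<lambda>\<omega>. X \<omega> k) = N"
proof -
  have "distr M N (\<lambda>\<omega>. X \<omega> k) = distr (distr M (seq_measure N) X) N (\<lambda>x. x k)"
    using iid_measurable[OF X] by (subst distr_distr) (auto simp: comp_def)
  also have "\<dots> = N"
    using X distr_PiM_component[of UNIV "\<lambda>_. N" k] N by (simp add: iid_def)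
  finally show ?thesis .
qed

lemma iid_seq_measure: "iid (seq_measure N) N (\<lambda>x. x)"
  by (simp add: iid_def distr_id2)

lemma iid_compose:
  assumes "iid M N X" "iid (seq_measure N) N' Y"
  shows "iid M N' (\<lambda>\<omega>. Y (X \<omega>))"
proof -
  have m: "X \<in> measurable M (seq_measure N)" "Y \<in> measurable (seq_measure N) (seq_measure N')"
    using assms by (auto simp: iid_def)
  then have "distr M (seq_measure N') (\<lambda>\<omega>. Y (X \<omega>)) = distr (distr M (seq_measure N) X) (seq_measure N') Y"
    by (simp add: distr_distr comp_def)
  with assms m show ?thesis by (simp add: iid_def)
qed

lemma iid_map:
  assumes N: "prob_space N" and X: "iid M N X" and M: "prob_space M"
    and g: "g \<in> measurable N N'" and d: "distr N N' g = N'"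
  shows "iid M N' (\<lambda>\<omega> k. g (X \<omega> k))"
proof (rule iidI[OF M])
  show "prob_space N'" using prob_space.prob_space_distr[OF N g] d by simp
  note [measurable] = iid_coord_measurable[OF X] g
  show "(\<lambda>\<omega> k. g (X \<omega> k)) \<in> measurable M (seq_measure N')"
    by (rule measurable_PiM_single') (use measurable_space[OF g] measurable_space[OF iid_coord_measurable[OF X]] in \<open>auto\<close>)
  fix n
  show "\<exists>m\<ge>n. \<forall>A. (\<forall>k<m. A k \<in> sets N') \<longrightarrow>
      emeasure M {\<omega> \<in> space M. \<forall>k<m. g (X \<omega> k) \<in> A k} = (\<Prod>k<m. emeasure N' (A k))"
  proof (intro exI[of _ n] conjI allI impI le_refl)
    fix A assume A: "\<forall>k<n. A k \<in> sets N'"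
    have "{\<omega> \<in> space M. \<forall>k<n. g (X \<omega> k) \<in> A k} = {\<omega> \<in> space M. \<forall>k<n. X \<omega> k \<in> g -` A k \<inter> space N}"
      using measurable_space[OF iid_coord_measurable[OF X]] by auto
    also have "emeasure M \<dots> = (\<Prod>k<n. emeasure N (g -` A k \<inter> space N))"
      using A by (intro iid_cylinder[OF X N]) auto
    also have "\<dots> = (\<Prod>k<n. emeasure N' (A k))"
      using A g by (intro prod.cong refl) (subst d[symmetric], auto simp: emeasure_distr)
    finally show "emeasure M {\<omega> \<in> space M. \<forall>k<n. g (X \<omega> k) \<in> A k} = (\<Prod>k<n. emeasure N' (A k))" .
  qed
qed

text \<open>The library's \<open>indep_var\<close> forces both random variables to have the same type.\<close>

definition independent_pair ::
    "'w measure \<Rightarrow> 'a measure \<Rightarrow> ('w \<Rightarrow> 'a) \<Rightarrow> 'b measure \<Rightarrow> ('w \<Rightarrow> 'b) \<Rightarrow> bool" where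
  "independent_pair M A X B Y \<longleftrightarrow> X \<in> measurable M A \<and> Y \<in> measurable M B \<and>
     (\<forall>a\<in>sets A. \<forall>b\<in>sets B. measure M {\<omega> \<in> space M. X \<omega> \<in> a \<and> Y \<omega> \<in> b}
        = measure M {\<omega> \<in> space M. X \<omega> \<in> a} * measure M {\<omega> \<in> space M. Y \<omega> \<in> b})"

lemma independent_pairD:
  assumes "independent_pair M A X B Y" "a \<in> sets A" "b \<in> sets B"
  shows "measure M {\<omega> \<in> space M. X \<omega> \<in> a \<and> Y \<omega> \<in> b}
        = measure M {\<omega> \<in> space M. X \<omega> \<in> a} * measure M {\<omega> \<in> space M. Y \<omega> \<in> b}"
  using assms by (simp add: independent_pair_def)

lemma independent_pair_measurable:
  assumes "independent_pair M A X B Y"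
  shows "X \<in> measurable M A" "Y \<in> measurable M B"
  using assms by (simp_all add: independent_pair_def)

lemma independent_pair_compose:
  assumes XY: "independent_pair M A X B Y" and g: "g \<in> measurable A A'" and h: "h \<in> measurable B B'"
  shows "independent_pair M A' (\<lambda>\<omega>. g (X \<omega>)) B' (\<lambda>\<omega>. h (Y \<omega>))"
  unfolding independent_pair_def
proof (intro conjI ballI)
  note m = independent_pair_measurable[OF XY]
  show "(\<lambda>\<omega>. g (X \<omega>)) \<in> measurable M A'" "(\<lambda>\<omega>. h (Y \<omega>)) \<in> measurable M B'"
    using measurable_compose[OF m(1) g] measurable_compose[OF m(2) h] .
  fix a b assume ab: "a \<in> sets A'" "b \<in> sets B'"
  have "g -` a \<inter> space A \<in> sets A" "h -` b \<inter> space B \<in> sets B"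
    using measurable_sets[OF g ab(1)] measurable_sets[OF h ab(2)] .
  from independent_pairD[OF XY this]
  show "measure M {\<omega> \<in> space M. g (X \<omega>) \<in> a \<and> h (Y \<omega>) \<in> b}
        = measure M {\<omega> \<in> space M. g (X \<omega>) \<in> a} * measure M {\<omega> \<in> space M. h (Y \<omega>) \<in> b}"
    using m[THEN measurable_space] by (simp cong: conj_cong)
qed

text \<open>Rectangles form an intersection-stable generator, so the product formula on them pins
  down the joint law. This opens the way to Fubini for functions of \<open>X\<close> and
  \<open>Y\<close>.\<close>

lemma independent_pair_distr:
  assumes M: "prob_space M" and XY: "independent_pair M A X B Y"
  shows "distr M A X \<Otimes>\<^sub>M distr M B Y = distr M (A \<Otimes>\<^sub>M B) (\<lambda>\<omega>. (X \<omega>, Y \<omega>))"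
proof (rule pair_measure_eqI)
  interpret prob_space M by fact
  note m [measurable] = independent_pair_measurable[OF XY]
  show "sigma_finite_measure (distr M A X)" "sigma_finite_measure (distr M B Y)"
    by (intro prob_space_imp_sigma_finite prob_space_distr m)+
  fix a b assume "a \<in> sets (distr M A X)" "b \<in> sets (distr M B Y)"
  then have ab [measurable]: "a \<in> sets A" "b \<in> sets B" by auto
  have "emeasure M {\<omega> \<in> space M. X \<omega> \<in> a} * emeasure M {\<omega> \<in> space M. Y \<omega> \<in> b} = emeasure M {\<omega> \<in> space M. X \<omega> \<in> a \<and> Y \<omega> \<in> b}"
    using independent_pairD[OF XY ab] by (simp add: emeasure_eq_measure ennreal_mult)
  then show "emeasure (distr M A X) a * emeasure (distr M B Y) b = emeasure (distr M (A \<Otimes>\<^sub>M B) (\<lambda>\<omega>. (X \<omega>, Y \<omega>))) (a \<times> b)"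
    by (subst (1 2 3) emeasure_distr) (auto simp: vimage_def Int_def conj_ac)
qed simp

lemma (in prob_space) indep_var_independent_pair:
  assumes "indep_var A X B Y"
  shows "independent_pair M A X B Y"
  unfolding independent_pair_def
proof (intro conjI ballI)
  show "X \<in> measurable M A" "Y \<in> measurable M B"
    using indep_var_rv1[OF assms] indep_var_rv2[OF assms] .
  fix a b assume "a \<in> sets A" "b \<in> sets B"
  from indep_varD[OF assms this]
  show "prob {\<omega> \<in> space M. X \<omega> \<in> a \<and> Y \<omega> \<in> b} = prob {\<omega> \<in> space M. X \<omega> \<in> a} * prob {\<omega> \<in> space M. Y \<omega> \<in> b}"
    by (simp add: vimage_def Int_def conj_ac)
qed

text \<open>For a fixed first sequence the section of a cylinder is a cylinder of the second
  sequence, whose measure is a product over \<open>k\<close>; integrating this product over the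
  first sequence factorizes again.\<close>

lemma iid_zip:
  assumes N: "prob_space N" and N': "prob_space N'" and M: "prob_space M"
    and X: "iid M N X" and Y: "iid M N' Y"
    and ind: "independent_pair M (seq_measure N) X (seq_measure N') Y"
  shows "iid M (N \<Otimes>\<^sub>M N') (\<lambda>\<omega> k. (X \<omega> k, Y \<omega> k))"
proof (rule iidI[OF M])
  interpret M: prob_space M by fact
  interpret N: prob_space N by fact
  interpret N': prob_space N' by fact
  interpret NN: pair_prob_space N N' ..
  interpret S: prob_space "seq_measure N" by (rule prob_space_seq_measure) fact
  interpret S': prob_space "seq_measure N'" by (rule prob_space_seq_measure) fact
  interpret SS: pair_prob_space "seq_measure N" "seq_measure N'" ..
  show "prob_space (N \<Otimes>\<^sub>M N')" by (rule NN.prob_space_axioms)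
  note [measurable] = iid_coord_measurable[OF X] iid_coord_measurable[OF Y]
  show "(\<lambda>\<omega> k. (X \<omega> k, Y \<omega> k)) \<in> measurable M (seq_measure (N \<Otimes>\<^sub>M N'))"
    by (rule measurable_PiM_single') (use measurable_space[OF iid_coord_measurable[OF X]] measurable_space[OF iid_coord_measurable[OF Y]] in \<open>auto simp: space_pair_measure\<close>)
  have mX: "X \<in> measurable M (seq_measure N)" and mY: "Y \<in> measurable M (seq_measure N')"
    using X Y by (auto simp: iid_def)
  have joint: "seq_measure N \<Otimes>\<^sub>M seq_measure N' = distr M (seq_measure N \<Otimes>\<^sub>M seq_measure N') (\<lambda>\<omega>. (X \<omega>, Y \<omega>))"
    using independent_pair_distr[OF M ind] X Y by (simp add: iid_def)
  fix n
  show "\<exists>m\<ge>n. \<forall>A. (\<forall>k<m. A k \<in> sets (N \<Otimes>\<^sub>M N')) \<longrightarrow>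
      emeasure M {\<omega> \<in> space M. \<forall>k<m. (X \<omega> k, Y \<omega> k) \<in> A k} = (\<Prod>k<m. emeasure (N \<Otimes>\<^sub>M N') (A k))"
  proof (intro exI[of _ n] conjI allI impI le_refl)
    fix A assume A: "\<forall>k<n. A k \<in> sets (N \<Otimes>\<^sub>M N')"
    then have [measurable]: "A k \<in> sets (N \<Otimes>\<^sub>M N')" if "k \<in> {..<n}" for k using that by auto
    let ?P = "seq_measure N \<Otimes>\<^sub>M seq_measure N'"
    let ?C = "{z \<in> space ?P. \<forall>k\<in>{..<n}. (fst z k, snd z k) \<in> A k}"
    have C: "?C \<in> sets ?P" by measurable
    have "emeasure M {\<omega> \<in> space M. \<forall>k<n. (X \<omega> k, Y \<omega> k) \<in> A k} = emeasure M ((\<lambda>\<omega>. (X \<omega>, Y \<omega>)) -` ?C \<inter> space M)"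
      using measurable_space[OF mX] measurable_space[OF mY]
      by (intro arg_cong[where f="emeasure M"]) (auto simp: space_pair_measure)
    also have "\<dots> = emeasure ?P ?C"
      using mX mY by (subst joint, subst emeasure_distr) (auto intro: C)
    also have "\<dots> = (\<integral>\<^sup>+ x. emeasure (seq_measure N') (Pair x -` ?C) \<partial>seq_measure N)"
      by (rule S'.emeasure_pair_measure_alt[OF C])
    also have "\<dots> = (\<integral>\<^sup>+ x. (\<Prod>k<n. emeasure N' (Pair (x k) -` A k)) \<partial>seq_measure N)"
    proof (rule nn_integral_cong)
      fix x assume x: "x \<in> space (seq_measure N)"
      have "Pair x -` ?C = {y \<in> space (seq_measure N'). \<forall>k<n. y k \<in> Pair (x k) -` A k}"
        using x by (auto simp: space_pair_measure)
      then show "emeasure (seq_measure N') (Pair x -` ?C) = (\<Prod>k<n. emeasure N' (Pair (x k) -` A k))"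
        using A emeasure_seq_measure_cylinder[where A="\<lambda>k. Pair (x k) -` A k" and n=n, OF N'] by (simp add: sets_Pair1)
    qed
    also have "\<dots> = (\<Prod>k<n. \<integral>\<^sup>+ x. emeasure N' (Pair x -` A k) \<partial>N)"
      using A by (intro nn_integral_seq_measure_prod[OF N] N'.measurable_emeasure_Pair) auto
    also have "\<dots> = (\<Prod>k<n. emeasure (N \<Otimes>\<^sub>M N') (A k))"
      using A by (intro prod.cong refl N'.emeasure_pair_measure_alt[symmetric]) auto
    finally show "emeasure M {\<omega> \<in> space M. \<forall>k<n. (X \<omega> k, Y \<omega> k) \<in> A k} = (\<Prod>k<n. emeasure (N \<Otimes>\<^sub>M N') (A k))" .
  qed
qed

text \<open>Serves two purposes: it lists the left and right halves of dyadic cells in Levy's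
  construction, and the up and down phases of the zigzag path.\<close>

definition interleave :: "(nat \<Rightarrow> 'a \<times> 'a) \<Rightarrow> nat \<Rightarrow> 'a" where
  "interleave z k = (if even k then fst (z (k div 2)) else snd (z (k div 2)))"

lemma prod_lessThan_double: "(\<Prod>k<2*n. f k) = (\<Prod>k<n. f (2*k) * f (Suc (2*k)))" for f :: "nat \<Rightarrow> 'a::comm_monoid_mult"
  by (induction n) (auto simp: ac_simps)

lemma all_lessThan_double: "(\<forall>k<2*n. P k) \<longleftrightarrow> (\<forall>k<n. P (2*k) \<and> P (Suc (2*k)))" for n :: nat
proof safe
  fix k assume a: "\<forall>k<n. P (2*k) \<and> P (Suc (2*k))" and "k < 2 * n"
  then have "k div 2 < n" by auto
  with a show "P k" by (cases "even k") (auto elim!: evenE oddE)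
qed auto

text \<open>A cylinder of even length \<open>2 * n\<close> in the interleaved sequence is a cylinder
  of length \<open>n\<close> in the sequence of pairs, built from rectangles.\<close>

lemma iid_interleave:
  assumes N: "prob_space N" and M: "prob_space M" and X: "iid M (N \<Otimes>\<^sub>M N) X"
  shows "iid M N (\<lambda>\<omega>. interleave (X \<omega>))"
proof (rule iidI[OF M N])
  interpret N: prob_space N by fact
  interpret NN: pair_prob_space N N ..
  note c = iid_coord_measurable[OF X]
  note [measurable] = c
  have sp: "fst (X \<omega> k) \<in> space N" "snd (X \<omega> k) \<in> space N" if "\<omega> \<in> space M" for \<omega> k
    using measurable_space[OF c[of k] that] by (auto simp: space_pair_measure)
  show "(\<lambda>\<omega>. interleave (X \<omega>)) \<in> measurable M (seq_measure N)"
    unfolding interleave_def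
    by (rule measurable_PiM_single') (auto simp: sp)
  fix n
  show "\<exists>m\<ge>n. \<forall>A. (\<forall>k<m. A k \<in> sets N) \<longrightarrow>
      emeasure M {\<omega> \<in> space M. \<forall>k<m. interleave (X \<omega>) k \<in> A k} = (\<Prod>k<m. emeasure N (A k))"
  proof (intro exI[of _ "2*n"] conjI allI impI)
    fix A assume A: "\<forall>k<2*n. A k \<in> sets N"
    have "{\<omega> \<in> space M. \<forall>k<2*n. interleave (X \<omega>) k \<in> A k} = {\<omega> \<in> space M. \<forall>k<n. X \<omega> k \<in> A (2*k) \<times> A (Suc (2*k))}"
      by (auto simp: all_lessThan_double interleave_def mem_Times_iff)
    also have "emeasure M \<dots> = (\<Prod>k<n. emeasure (N \<Otimes>\<^sub>M N) (A (2*k) \<times> A (Suc (2*k))))"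
      using A by (intro iid_cylinder[OF X NN.prob_space_axioms]) auto
    also have "\<dots> = (\<Prod>k<2*n. emeasure N (A k))"
      unfolding prod_lessThan_double using A by (intro prod.cong refl N.emeasure_pair_measure_Times) auto
    finally show "emeasure M {\<omega> \<in> space M. \<forall>k<2*n. interleave (X \<omega>) k \<in> A k} = (\<Prod>k<2*n. emeasure N (A k))" .
  qed simp
qed

lemma iid_indep_vars:
  assumes M: "prob_space M" and N: "prob_space N" and X: "iid M N X"
  shows "prob_space.indep_vars M (\<lambda>_. N) (\<lambda>k \<omega>. X \<omega> k) (UNIV :: nat set)"
proof -
  interpret prob_space M by fact
  have "distr M (seq_measure N) (\<lambda>x. \<lambda>i\<in>UNIV. X x i) = distr M (seq_measure N) X"
    by (simp add: restrict_UNIV)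
  then show ?thesis
    using X iid_coord_measurable[OF X] iid_distr_coord[OF X N]
    by (subst indep_vars_iff_distr_eq_PiM) (auto simp: iid_def)
qed

section \<open>Matrix exponentials\<close>

definition mpow :: "real ^ 's ^ 's \<Rightarrow> nat \<Rightarrow> real ^ 's ^ 's" where
  "mpow A k = ((**) A ^^ k) (mat 1)"

lemma mpow_0: "mpow A 0 $ i $ j = (if i = j then 1 else 0)"
  by (simp add: mpow_def mat_def)

lemma mpow_Suc: "mpow A (Suc k) $ i $ j = (\<Sum>l\<in>UNIV. A $ i $ l * mpow A k $ l $ j)"
  for A :: "real ^ 's::finite ^ 's"
  by (simp add: mpow_def matrix_matrix_mult_def)

text \<open>The sum of all absolute entries dominates every row sum. It is a crude growth rate, but
  enough for absolute convergence of the exponential series in each entry.\<close>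

lemma abs_mpow_le: "\<bar>mpow A k $ i $ j\<bar> \<le> (\<Sum>i\<in>UNIV. \<Sum>l\<in>UNIV. \<bar>A $ i $ l\<bar>) ^ k"
  for A :: "real ^ 's::finite ^ 's"
proof (induction k arbitrary: i)
  case 0
  show ?case by (simp add: mpow_0)
next
  case (Suc k)
  let ?C = "\<Sum>i\<in>UNIV. \<Sum>l\<in>UNIV. \<bar>A $ i $ l\<bar>"
  have "\<bar>mpow A (Suc k) $ i $ j\<bar> \<le> (\<Sum>l\<in>UNIV. \<bar>A $ i $ l\<bar> * \<bar>mpow A k $ l $ j\<bar>)"
    unfolding mpow_Suc by (rule order_trans[OF sum_abs]) (simp add: abs_mult)
  also have "\<dots> \<le> (\<Sum>l\<in>UNIV. \<bar>A $ i $ l\<bar> * ?C ^ k)"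
    by (intro sum_mono mult_left_mono Suc) auto
  also have "\<dots> = (\<Sum>l\<in>UNIV. \<bar>A $ i $ l\<bar>) * ?C ^ k"
    by (simp add: sum_distrib_right)
  also have "\<dots> \<le> ?C * ?C ^ k"
    by (intro mult_right_mono member_le_sum[of i UNIV "\<lambda>i. \<Sum>l\<in>UNIV. \<bar>A $ i $ l\<bar>"])
      (auto intro!: sum_nonneg zero_le_power)
  finally show ?case by simp
qed

lemma summable_abs_mpow: "summable (\<lambda>k. \<bar>t ^ k / fact k * mpow A k $ i $ j\<bar>)"
  for A :: "real ^ 's::finite ^ 's"
proof (rule summable_comparison_test')
  let ?C = "\<Sum>i\<in>UNIV. \<Sum>l\<in>UNIV. \<bar>A $ i $ l\<bar>"
  show "summable (\<lambda>k. (\<bar>t\<bar> * ?C) ^ k /\<^sub>R fact k)"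
    by (rule summable_exp_generic)
  fix k :: nat assume "k \<ge> 0"
  have "\<bar>t ^ k / fact k * mpow A k $ i $ j\<bar> = \<bar>t\<bar> ^ k / fact k * \<bar>mpow A k $ i $ j\<bar>"
    by (simp add: abs_mult power_abs)
  also have "\<dots> \<le> \<bar>t\<bar> ^ k / fact k * ?C ^ k"
    by (intro mult_left_mono abs_mpow_le) auto
  also have "\<dots> = (\<bar>t\<bar> * ?C) ^ k /\<^sub>R fact k"
    by (simp add: power_mult_distrib field_simps)
  finally show "norm \<bar>t ^ k / fact k * mpow A k $ i $ j\<bar> \<le> (\<bar>t\<bar> * ?C) ^ k /\<^sub>R fact k" by simp
qed

text \<open>The defining series lives in a space of matrices; once it converges there, taking an
  entry is bounded linear and commutes with the sum. Later arguments use only these scalar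
  series.\<close>

lemma transition_matrix_sums:
  "(\<lambda>k. t ^ k / fact k * mpow A k $ i $ j) sums (transition_matrix A t $ i $ j)"
  for A :: "real ^ 's::finite ^ 's"
proof -
  have s: "summable (\<lambda>k. (t ^ k / fact k) *\<^sub>R mpow A k)"
  proof (rule summable_norm_cancel, rule summable_comparison_test')
    show "summable (\<lambda>k. \<Sum>i\<in>UNIV. \<Sum>j\<in>UNIV. \<bar>t ^ k / fact k * mpow A k $ i $ j\<bar>)"
      by (intro summable_sum summable_abs_mpow)
    fix k :: nat assume "k \<ge> 0"
    have "norm ((t ^ k / fact k) *\<^sub>R mpow A k) \<le> (\<Sum>i\<in>UNIV. norm (((t ^ k / fact k) *\<^sub>R mpow A k) $ i))"
      unfolding norm_vec_def by (rule L2_set_le_sum) simp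
    also have "\<dots> \<le> (\<Sum>i\<in>UNIV. \<Sum>j\<in>UNIV. \<bar>((t ^ k / fact k) *\<^sub>R mpow A k) $ i $ j\<bar>)"
      by (intro sum_mono norm_le_l1_cart)
    finally show "norm (norm ((t ^ k / fact k) *\<^sub>R mpow A k)) \<le> (\<Sum>i\<in>UNIV. \<Sum>j\<in>UNIV. \<bar>t ^ k / fact k * mpow A k $ i $ j\<bar>)"
      by simp
  qed
  have bl: "bounded_linear (\<lambda>x :: real ^ 's ^ 's. x $ i $ j)"
    by (rule bounded_linear_compose[OF bounded_linear_vec_nth bounded_linear_vec_nth])
  have "(\<lambda>k. (t ^ k / fact k) *\<^sub>R mpow A k) sums transition_matrix A t"
    using summable_sums[OF s] by (simp add: transition_matrix_def mpow_def)
  from bounded_linear.sums[OF bl this] show ?thesis by simp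
qed

text \<open>One Leibniz step: Pascal's rule merges the two shifted sums.\<close>

lemma binomial_convolution_Suc:
  fixes x y :: "nat \<Rightarrow> real"
  shows "(\<Sum>r\<le>k. of_nat (k choose r) * (x (Suc r) * y (k - r) + x r * y (Suc (k - r))))
    = (\<Sum>r\<le>Suc k. of_nat (Suc k choose r) * (x r * y (Suc k - r)))"
proof -
  have "(\<Sum>r\<le>Suc k. of_nat (Suc k choose r) * (x r * y (Suc k - r)))
    = x 0 * y (Suc k) + (\<Sum>r\<le>k. of_nat (Suc k choose Suc r) * (x (Suc r) * y (k - r)))"
    by (subst sum.atMost_Suc_shift) simp
  also have "(\<Sum>r\<le>k. of_nat (Suc k choose Suc r) * (x (Suc r) * y (k - r)))
    = (\<Sum>r\<le>k. of_nat (k choose r) * (x (Suc r) * y (k - r))) + (\<Sum>r\<le>k. of_nat (k choose Suc r) * (x (Suc r) * y (k - r)))"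
    by (simp add: sum.distrib[symmetric] algebra_simps)
  also have "x 0 * y (Suc k) + (\<dots>) = (\<Sum>r\<le>k. of_nat (k choose r) * (x (Suc r) * y (k - r)))
     + (\<Sum>r\<le>Suc k. of_nat (k choose r) * (x r * y (Suc k - r)))"
    by (subst sum.atMost_Suc_shift[of "\<lambda>r. of_nat (k choose r) * (x r * y (Suc k - r))"]) simp
  also have "(\<Sum>r\<le>Suc k. of_nat (k choose r) * (x r * y (Suc k - r)))
     = (\<Sum>r\<le>k. of_nat (k choose r) * (x r * y (Suc (k - r))))"
    by (simp add: Suc_diff_le)
  finally show ?thesis
    by (simp add: sum.distrib algebra_simps)
qed

text \<open>The binomial theorem for two commuting operators: \<open>A\<close> acts on the first
  index, \<open>B\<close> on the second, and the start \<open>F 0\<close> is a product. The form by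
  recursions covers Kronecker sums as well as a matrix plus a scalar.\<close>

lemma binomial_recursion:
  fixes A :: "'a::finite \<Rightarrow> 'a \<Rightarrow> real" and B :: "'b::finite \<Rightarrow> 'b \<Rightarrow> real"
  assumes \<alpha>: "\<And>r a. \<alpha> (Suc r) a = (\<Sum>c\<in>UNIV. A a c * \<alpha> r c)"
    and \<beta>: "\<And>r i. \<beta> (Suc r) i = (\<Sum>l\<in>UNIV. B i l * \<beta> r l)"
    and F0: "\<And>a i. F 0 a i = \<alpha> 0 a * \<beta> 0 i"
    and F: "\<And>k a i. F (Suc k) a i = (\<Sum>c\<in>UNIV. A a c * F k c i) + (\<Sum>l\<in>UNIV. B i l * F k a l)"
  shows "F k a i = (\<Sum>r\<le>k. of_nat (k choose r) * (\<alpha> r a * \<beta> (k - r) i))"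
proof (induction k arbitrary: a i)
  case 0
  show ?case by (simp add: F0)
next
  case (Suc k)
  have "(\<Sum>c\<in>UNIV. A a c * F k c i) = (\<Sum>r\<le>k. of_nat (k choose r) * (\<alpha> (Suc r) a * \<beta> (k - r) i))"
    unfolding Suc \<alpha> sum_distrib_left sum_distrib_right
    by (subst sum.swap) (simp add: ac_simps)
  moreover have "(\<Sum>l\<in>UNIV. B i l * F k a l) = (\<Sum>r\<le>k. of_nat (k choose r) * (\<alpha> r a * \<beta> (Suc (k - r)) i))"
    unfolding Suc \<beta> sum_distrib_left
    by (subst sum.swap) (simp add: ac_simps)
  ultimately show ?case
    using binomial_convolution_Suc[of k "\<lambda>r. \<alpha> r a" "\<lambda>r. \<beta> r i"]
    unfolding F by (simp only: sum.distrib distrib_left)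
qed

text \<open>In the Cauchy product of two exponential series the factorials recombine into a binomial
  coefficient; this is why the exponential of a sum of commuting terms is a product.\<close>

lemma exponential_Cauchy_product:
  fixes x y :: "nat \<Rightarrow> real"
  assumes "summable (\<lambda>k. \<bar>t ^ k / fact k * x k\<bar>)" "summable (\<lambda>k. \<bar>t ^ k / fact k * y k\<bar>)"
    and "(\<lambda>k. t ^ k / fact k * x k) sums a" "(\<lambda>k. t ^ k / fact k * y k) sums b"
  shows "(\<lambda>k. t ^ k / fact k * (\<Sum>r\<le>k. of_nat (k choose r) * (x r * y (k - r)))) sums (a * b)"
proof -
  have "(\<lambda>k. \<Sum>r\<le>k. (t ^ r / fact r * x r) * (t ^ (k - r) / fact (k - r) * y (k - r))) sums (a * b)"
    using Cauchy_product_sums[of "\<lambda>k. t ^ k / fact k * x k" "\<lambda>k. t ^ k / fact k * y k"] assms(1,2)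
    unfolding sums_unique[OF assms(3), symmetric] sums_unique[OF assms(4), symmetric]
    by simp
  moreover have "(\<Sum>r\<le>k. (t ^ r / fact r * x r) * (t ^ (k - r) / fact (k - r) * y (k - r)))
      = t ^ k / fact k * (\<Sum>r\<le>k. of_nat (k choose r) * (x r * y (k - r)))" for k
    unfolding sum_distrib_left
  proof (rule sum.cong[OF refl])
    fix r assume "r \<in> {..k}"
    then have "t ^ k = t ^ r * t ^ (k - r)" "real (k choose r) = fact k / (fact r * fact (k - r))"
      by (auto simp: power_add[symmetric] binomial_fact)
    then show "(t ^ r / fact r * x r) * (t ^ (k - r) / fact (k - r) * y (k - r))
      = t ^ k / fact k * (of_nat (k choose r) * (x r * y (k - r)))"
      by (simp add: field_simps)
  qed
  ultimately show ?thesis by simp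
qed

text \<open>This is \<open>A \<otimes> I + I \<otimes> B\<close>, the generator of two independent
  chains observed together: off the diagonal only one coordinate changes at a time.\<close>

definition kronecker_sum :: "real ^ 'a ^ 'a \<Rightarrow> real ^ 'b ^ 'b \<Rightarrow> real ^ ('a \<times> 'b) ^ ('a \<times> 'b)" where
  "kronecker_sum A B = (\<chi> x y. (if snd x = snd y then A $ fst x $ fst y else 0)
     + (if fst x = fst y then B $ snd x $ snd y else 0))"

lemma sum_kronecker_sum:
  fixes A :: "real ^ 'a::finite ^ 'a" and B :: "real ^ 'b::finite ^ 'b"
  shows "(\<Sum>z\<in>UNIV. kronecker_sum A B $ (a, i) $ z * g z)
    = (\<Sum>c\<in>UNIV. A $ a $ c * g (c, i)) + (\<Sum>l\<in>UNIV. B $ i $ l * g (a, l))"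
proof -
  have "(\<Sum>z\<in>UNIV. kronecker_sum A B $ (a, i) $ z * g z)
     = (\<Sum>c\<in>UNIV. \<Sum>l\<in>UNIV. (if l = i then A $ a $ c * g (c, l) else 0) + (if c = a then B $ i $ l * g (c, l) else 0))"
    unfolding sum.cartesian_product UNIV_Times_UNIV
    by (intro sum.cong refl) (auto simp: kronecker_sum_def algebra_simps)
  also have "\<dots> = (\<Sum>c\<in>UNIV. A $ a $ c * g (c, i)) + (\<Sum>c\<in>UNIV. if c = a then (\<Sum>l\<in>UNIV. B $ i $ l * g (c, l)) else 0)"
    by (simp add: sum.distrib) (subst sum.swap, simp)
  finally show ?thesis by simp
qed

lemma transition_matrix_kronecker_sum:
  fixes A :: "real ^ 'a::finite ^ 'a" and B :: "real ^ 'b::finite ^ 'b"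
  shows "transition_matrix (kronecker_sum A B) t $ (a, i) $ (b, j)
    = transition_matrix A t $ a $ b * transition_matrix B t $ i $ j"
proof -
  have "mpow (kronecker_sum A B) k $ (a, i) $ (b, j)
      = (\<Sum>r\<le>k. of_nat (k choose r) * (mpow A r $ a $ b * mpow B (k - r) $ i $ j))" for k
    by (rule binomial_recursion[where \<alpha>="\<lambda>r a. mpow A r $ a $ b" and \<beta>="\<lambda>r i. mpow B r $ i $ j"
          and F="\<lambda>k a i. mpow (kronecker_sum A B) k $ (a, i) $ (b, j)" and A="\<lambda>a c. A $ a $ c" and B="\<lambda>i l. B $ i $ l"])
      (simp_all only: mpow_Suc sum_kronecker_sum, simp_all add: mpow_0)
  with exponential_Cauchy_product[OF summable_abs_mpow summable_abs_mpow transition_matrix_sums transition_matrix_sums, of t A a b B i j]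
  have "(\<lambda>k. t ^ k / fact k * mpow (kronecker_sum A B) k $ (a, i) $ (b, j))
     sums (transition_matrix A t $ a $ b * transition_matrix B t $ i $ j)"
    by simp
  then show ?thesis
    using sums_unique2[OF transition_matrix_sums] by blast
qed

lemma intensity_matrix_kronecker_sum:
  fixes A :: "real ^ 'a::finite ^ 'a" and B :: "real ^ 'b::finite ^ 'b"
  assumes "intensity_matrix A" "intensity_matrix B"
  shows "intensity_matrix (kronecker_sum A B)"
  unfolding intensity_matrix_def
proof (intro conjI allI impI)
  fix x y :: "'a \<times> 'b" assume "x \<noteq> y"
  then show "0 \<le> kronecker_sum A B $ x $ y"
    using assms by (cases x; cases y) (auto simp: kronecker_sum_def intensity_matrix_def)
next
  fix x :: "'a \<times> 'b"
  show "(\<Sum>y\<in>UNIV. kronecker_sum A B $ x $ y) = 0"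
    using sum_kronecker_sum[of A B "fst x" "snd x" "\<lambda>_. 1"] assms by (simp add: intensity_matrix_def)
qed

text \<open>Uniformization: \<open>exp (t Q)\<close> is the Poisson mixture of the powers of \<open>I + Q / \<Lambda>\<close>.\<close>

lemma uniformization_sums:
  fixes P Q :: "real ^ 's::finite ^ 's"
  assumes Q: "\<And>i j. Q $ i $ j = \<Lambda> * (P $ i $ j - (if i = j then 1 else 0))"
  shows "(\<lambda>n. exp (- (\<Lambda> * t)) * ((\<Lambda> * t) ^ n / fact n) * mpow P n $ i $ j) sums (transition_matrix Q t $ i $ j)"
proof -
  have rec: "\<Lambda> ^ k * mpow P k $ i $ j = (\<Sum>r\<le>k. of_nat (k choose r) * (\<Lambda> ^ r * mpow Q (k - r) $ i $ j))" for k
  \<comment> \<open>\<open>\<Lambda> P\<close> equals \<open>Q\<close> plus \<open>\<Lambda>\<close>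
    times the identity. The scalar part is treated as an operator on the one-point index type
    \<open>unit\<close>.\<close>
  proof (rule binomial_recursion[where \<alpha>="\<lambda>r _::unit. \<Lambda> ^ r" and \<beta>="\<lambda>r i. mpow Q r $ i $ j"
          and F="\<lambda>k _ i. \<Lambda> ^ k * mpow P k $ i $ j" and A="\<lambda>_ _. \<Lambda>" and B="\<lambda>i l. Q $ i $ l"])
    fix k i
    have "(\<Sum>l\<in>UNIV. Q $ i $ l * (\<Lambda> ^ k * mpow P k $ l $ j))
        = (\<Sum>l\<in>UNIV. \<Lambda> ^ Suc k * (P $ i $ l * mpow P k $ l $ j) - (if l = i then \<Lambda> ^ Suc k * mpow P k $ l $ j else 0))"
      by (intro sum.cong refl) (auto simp: Q algebra_simps)
    also have "\<dots> = \<Lambda> ^ Suc k * mpow P (Suc k) $ i $ j - \<Lambda> ^ Suc k * mpow P k $ i $ j"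
      by (simp add: sum_subtractf mpow_Suc sum_distrib_left[symmetric])
    finally show "\<Lambda> ^ Suc k * mpow P (Suc k) $ i $ j
       = (\<Sum>c\<in>(UNIV::unit set). \<Lambda> * (\<Lambda> ^ k * mpow P k $ i $ j)) + (\<Sum>l\<in>UNIV. Q $ i $ l * (\<Lambda> ^ k * mpow P k $ l $ j))"
      by simp
  qed (auto simp: mpow_Suc mpow_0)
  have e: "(\<lambda>k. t ^ k / fact k * \<Lambda> ^ k) sums exp (\<Lambda> * t)"
    using exp_converges[of "\<Lambda> * t"] by (simp add: power_mult_distrib field_simps)
  have "summable (\<lambda>k. \<bar>t ^ k / fact k * \<Lambda> ^ k\<bar>)"
    using summable_exp_generic[of "\<bar>\<Lambda> * t\<bar>"] by (simp add: power_mult_distrib field_simps abs_mult power_abs)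
  from exponential_Cauchy_product[OF this summable_abs_mpow e transition_matrix_sums, of Q i j]
  have "(\<lambda>k. t ^ k / fact k * (\<Lambda> ^ k * mpow P k $ i $ j)) sums (exp (\<Lambda> * t) * transition_matrix Q t $ i $ j)"
    by (simp add: rec)
  from sums_mult[OF this, of "exp (- (\<Lambda> * t))"]
  show ?thesis by (simp add: power_mult_distrib field_simps mult_exp_exp[symmetric] exp_minus)
qed

lemma mpow_nonneg:
  fixes P :: "real ^ 's::finite ^ 's"
  assumes "\<And>i j. 0 \<le> P $ i $ j"
  shows "0 \<le> mpow P n $ i $ j"
proof (induction n arbitrary: i)
  case (Suc n)
  show ?case unfolding mpow_Suc using assms Suc by (intro sum_nonneg) auto
qed (simp add: mpow_0)

lemma sum_mpow:
  fixes P :: "real ^ 's::finite ^ 's"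
  assumes "\<And>i. (\<Sum>j\<in>UNIV. P $ i $ j) = 1"
  shows "(\<Sum>j\<in>UNIV. mpow P n $ i $ j) = 1"
proof (induction n arbitrary: i)
  case (Suc n)
  have "(\<Sum>j\<in>UNIV. mpow P (Suc n) $ i $ j) = (\<Sum>l\<in>UNIV. P $ i $ l * (\<Sum>j\<in>UNIV. mpow P n $ l $ j))"
    unfolding mpow_Suc sum_distrib_left by (rule sum.swap)
  then show ?case using assms Suc by simp
qed (simp add: mpow_0)

text \<open>Coordinates under a product measure are independent, hence so are functions that read
  disjoint sets of them. Most independence claims of the construction reduce to this.\<close>

lemma independent_pair_coordinates:
  assumes D: "\<And>i. prob_space (D i)" and AB: "A \<inter> B = {}"
    and g: "g \<in> measurable (Pi\<^sub>M A D) G" and h: "h \<in> measurable (Pi\<^sub>M B D) H"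
  shows "independent_pair (Pi\<^sub>M UNIV D) G (\<lambda>\<omega>. g (restrict \<omega> A)) H (\<lambda>\<omega>. h (restrict \<omega> B))"
proof -
  interpret prob_space "Pi\<^sub>M UNIV D" by (rule prob_space_PiM) (rule D)
  have "distr (Pi\<^sub>M UNIV D) (D i) (\<lambda>\<omega>. \<omega> i) = D i" for i
    by (rule distr_PiM_component) (auto intro: D)
  then have "indep_vars D (\<lambda>i \<omega>. \<omega> i) UNIV"
    by (subst indep_vars_iff_distr_eq_PiM) (auto simp: restrict_UNIV distr_id2)
  from indep_var_restrict[OF this AB]
  have "indep_var (Pi\<^sub>M A D) (\<lambda>\<omega>. restrict \<omega> A) (Pi\<^sub>M B D) (\<lambda>\<omega>. restrict \<omega> B)"
    by simp
  from independent_pair_compose[OF indep_var_independent_pair[OF this] g h]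
  show ?thesis .
qed

section \<open>Levy's construction of Brownian motion\<close>

abbreviation normal_measure :: "real \<Rightarrow> real measure" where
  "normal_measure s \<equiv> density lborel (normal_density 0 s)"

text \<open>With \<open>x = u + v\<close> and \<open>y = (u - v) / s\<close> the exponents agree
  since \<open>(u + v)^2 + (u - v)^2 = 2 u^2 + 2 v^2\<close>; the factor \<open>2 / s\<close> is the
  Jacobian of this substitution.\<close>

lemma normal_rotation_density:
  assumes "0 < s"
  shows "2 / s * (normal_density 0 s (u + v) * std_normal_density ((u - v) / s))
    = normal_density 0 (s / sqrt 2) u * normal_density 0 (s / sqrt 2) v"
proof -
  have "- ((u + v)\<^sup>2 / (2 * s\<^sup>2)) + - (((u - v) / s)\<^sup>2 / 2) = - (u\<^sup>2 / s\<^sup>2) + - (v\<^sup>2 / s\<^sup>2)"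
    using assms by (simp add: power_divide field_simps power2_eq_square)
  then have e: "exp (- ((u + v)\<^sup>2 / (2 * s\<^sup>2))) * exp (- (((u - v) / s)\<^sup>2 / 2)) = exp (- (u\<^sup>2 / s\<^sup>2)) * exp (- (v\<^sup>2 / s\<^sup>2))"
    by (simp only: mult_exp_exp)
  have c: "2 / s * (1 / sqrt (2 * pi * s\<^sup>2) * (1 / sqrt (2 * pi))) = 1 / sqrt (pi * s\<^sup>2) * (1 / sqrt (pi * s\<^sup>2))"
    using assms by (simp add: real_sqrt_mult field_simps)
  have "2 / s * (normal_density 0 s (u + v) * std_normal_density ((u - v) / s))
     = (2 / s * (1 / sqrt (2 * pi * s\<^sup>2) * (1 / sqrt (2 * pi)))) * (exp (- ((u + v)\<^sup>2 / (2 * s\<^sup>2))) * exp (- (((u - v) / s)\<^sup>2 / 2)))"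
    by (simp add: normal_density_def)
  also have "\<dots> = (1 / sqrt (pi * s\<^sup>2) * (1 / sqrt (pi * s\<^sup>2))) * (exp (- (u\<^sup>2 / s\<^sup>2)) * exp (- (v\<^sup>2 / s\<^sup>2)))"
    unfolding e c ..
  also have "\<dots> = normal_density 0 (s / sqrt 2) u * normal_density 0 (s / sqrt 2) v"
    by (simp add: normal_density_def power_divide)
  finally show ?thesis .
qed

text \<open>Levy's midpoint step: an increment of variance \<open>s^2\<close> is cut into two
  independent halves of variance \<open>s^2 / 2\<close> by adding and subtracting an independent
  normal variable.\<close>

lemma distr_normal_rotation:
  assumes s: "0 < s"
  shows "distr (normal_measure s \<Otimes>\<^sub>M normal_measure 1) (normal_measure (s / sqrt 2) \<Otimes>\<^sub>M normal_measure (s / sqrt 2))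
      (\<lambda>z. (fst z / 2 + s / 2 * snd z, fst z / 2 - s / 2 * snd z))
    = normal_measure (s / sqrt 2) \<Otimes>\<^sub>M normal_measure (s / sqrt 2)" (is "distr ?P ?R ?g = _")
proof (rule measure_eqI)
  have s2: "0 < s / sqrt 2" using s by simp
  interpret N: prob_space "normal_measure s" using s by (rule prob_space_normal_density)
  interpret N1: prob_space "normal_measure 1" by (rule prob_space_normal_density) simp
  interpret NN1: pair_prob_space "normal_measure s" "normal_measure 1" ..
  interpret N2: prob_space "normal_measure (s / sqrt 2)" using s2 by (rule prob_space_normal_density)
  have setsR: "sets ?R = sets (borel \<Otimes>\<^sub>M borel)" and setsP: "sets ?P = sets (borel \<Otimes>\<^sub>M borel)"
    by (auto intro!: sets_pair_measure_cong)
  have g: "?g \<in> measurable ?P ?R"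
    unfolding measurable_cong_sets[OF setsP setsR] by measurable
  fix A assume "A \<in> sets (distr ?P ?R ?g)"
  then have AR: "A \<in> sets ?R" by simp
  then have A [measurable]: "A \<in> sets (borel \<Otimes>\<^sub>M borel)" using setsR by simp
  let ?I = "\<lambda>u v. indicator A (u, v) :: ennreal"
  have mI: "(\<lambda>z. indicator A z :: ennreal) \<in> borel_measurable ?R" using AR by measurable
  have "emeasure (distr ?P ?R ?g) A = (\<integral>\<^sup>+ z. indicator A z \<partial>distr ?P ?R ?g)"
    using AR by simp
  also have "\<dots> = (\<integral>\<^sup>+ z. indicator A (?g z) \<partial>?P)"
    by (rule nn_integral_distr[OF g]) (use AR in simp)
  also have "\<dots> = (\<integral>\<^sup>+ y. \<integral>\<^sup>+ x. ?I (x / 2 + s / 2 * y) (x / 2 - s / 2 * y) \<partial>normal_measure s \<partial>normal_measure 1)"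
    using measurable_compose[OF g mI] by (subst NN1.nn_integral_snd[symmetric]) auto
  also have "\<dots> = (\<integral>\<^sup>+ y. ennreal (std_normal_density y) * (\<integral>\<^sup>+ x. ennreal (normal_density 0 s x) * ?I (x / 2 + s / 2 * y) (x / 2 - s / 2 * y) \<partial>lborel) \<partial>lborel)"
    by (simp add: nn_integral_density)
  \<comment> \<open>For fixed \<open>y\<close> the variable \<open>x\<close> becomes
    \<open>2 u - s y\<close>, which contributes the factor \<open>2\<close>. After exchanging the
    integrals, \<open>y\<close> becomes \<open>(u - v) / s\<close> for fixed \<open>u\<close>, which
    contributes \<open>1 / s\<close>.\<close>
  also have "\<dots> = (\<integral>\<^sup>+ y. ennreal (std_normal_density y) * (2 * (\<integral>\<^sup>+ u. ennreal (normal_density 0 s (2 * u - s * y)) * ?I u (u - s * y) \<partial>lborel)) \<partial>lborel)"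
  proof (intro nn_integral_cong arg_cong2[where f="(*)"] refl)
    fix y :: real
    have e: "(- (s * y) + 2 * u) / 2 + s / 2 * y = u" "(- (s * y) + 2 * u) / 2 - s / 2 * y = u - s * y"
      "- (s * y) + 2 * u = 2 * u - s * y" for u
      by (simp_all add: field_simps)
    have "(\<integral>\<^sup>+ x. ennreal (normal_density 0 s x) * ?I (x / 2 + s / 2 * y) (x / 2 - s / 2 * y) \<partial>lborel)
       = ennreal \<bar>2\<bar> * (\<integral>\<^sup>+ u. ennreal (normal_density 0 s (- (s * y) + 2 * u)) * ?I ((- (s * y) + 2 * u) / 2 + s / 2 * y) ((- (s * y) + 2 * u) / 2 - s / 2 * y) \<partial>lborel)"
      by (rule nn_integral_real_affine) auto
    then show "(\<integral>\<^sup>+ x. ennreal (normal_density 0 s x) * ?I (x / 2 + s / 2 * y) (x / 2 - s / 2 * y) \<partial>lborel)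
       = 2 * (\<integral>\<^sup>+ u. ennreal (normal_density 0 s (2 * u - s * y)) * ?I u (u - s * y) \<partial>lborel)"
      unfolding e(1) e(2) unfolding e(3) by simp
  qed
  also have "\<dots> = (\<integral>\<^sup>+ y. \<integral>\<^sup>+ u. ennreal (2 * (std_normal_density y * normal_density 0 s (2 * u - s * y))) * ?I u (u - s * y) \<partial>lborel \<partial>lborel)"
    by (simp add: nn_integral_cmult[symmetric] ennreal_mult mult.assoc mult.left_commute)
  also have "\<dots> = (\<integral>\<^sup>+ u. \<integral>\<^sup>+ y. ennreal (2 * (std_normal_density y * normal_density 0 s (2 * u - s * y))) * ?I u (u - s * y) \<partial>lborel \<partial>lborel)"
    by (rule lborel_pair.Fubini') simp
  also have "\<dots> = (\<integral>\<^sup>+ u. \<integral>\<^sup>+ v. ennreal (normal_density 0 (s / sqrt 2) u * normal_density 0 (s / sqrt 2) v) * ?I u v \<partial>lborel \<partial>lborel)"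
  proof (rule nn_integral_cong)
    fix u :: real
    have "(\<integral>\<^sup>+ y. ennreal (2 * (std_normal_density y * normal_density 0 s (2 * u - s * y))) * ?I u (u - s * y) \<partial>lborel)
      = ennreal \<bar>- (1 / s)\<bar> * (\<integral>\<^sup>+ v. ennreal (2 * (std_normal_density (u / s + - (1 / s) * v) * normal_density 0 s (2 * u - s * (u / s + - (1 / s) * v)))) * ?I u (u - s * (u / s + - (1 / s) * v)) \<partial>lborel)"
      using s by (intro nn_integral_real_affine) auto
    also have "\<dots> = (\<integral>\<^sup>+ v. ennreal (2 / s * (normal_density 0 s (u + v) * std_normal_density ((u - v) / s))) * ?I u v \<partial>lborel)"
    proof (subst nn_integral_cmult[symmetric])
      have "ennreal \<bar>- (1 / s)\<bar> * (ennreal (2 * (std_normal_density (u / s + - (1 / s) * v) * normal_density 0 s (2 * u - s * (u / s + - (1 / s) * v)))) * ?I u (u - s * (u / s + - (1 / s) * v)))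
        = ennreal (2 / s * (normal_density 0 s (u + v) * std_normal_density ((u - v) / s))) * ?I u v" for v
      proof -
        have "u / s + - (1 / s) * v = (u - v) / s" "s * ((u - v) / s) = u - v" "2 * u - (u - v) = u + v" "u - (u - v) = v"
          using s by (auto simp: field_simps)
        then show ?thesis
          using s by (simp add: mult.assoc[symmetric] ennreal_mult'[symmetric]) (simp add: ac_simps)
      qed
      then show "(\<integral>\<^sup>+ v. ennreal \<bar>- (1 / s)\<bar> * (ennreal (2 * (std_normal_density (u / s + - (1 / s) * v) * normal_density 0 s (2 * u - s * (u / s + - (1 / s) * v)))) * ?I u (u - s * (u / s + - (1 / s) * v))) \<partial>lborel)
        = (\<integral>\<^sup>+ v. ennreal (2 / s * (normal_density 0 s (u + v) * std_normal_density ((u - v) / s))) * ?I u v \<partial>lborel)"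
        by (intro nn_integral_cong)
    qed simp
    finally show "(\<integral>\<^sup>+ y. ennreal (2 * (std_normal_density y * normal_density 0 s (2 * u - s * y))) * ?I u (u - s * y) \<partial>lborel)
       = (\<integral>\<^sup>+ v. ennreal (normal_density 0 (s / sqrt 2) u * normal_density 0 (s / sqrt 2) v) * ?I u v \<partial>lborel)"
      unfolding normal_rotation_density[OF s] .
  qed
  also have "\<dots> = (\<integral>\<^sup>+ u. \<integral>\<^sup>+ v. ?I u v \<partial>normal_measure (s / sqrt 2) \<partial>normal_measure (s / sqrt 2))"
    by (simp add: nn_integral_density nn_integral_cmult[symmetric] ennreal_mult mult.assoc)
  also have "\<dots> = (\<integral>\<^sup>+ z. indicator A z \<partial>?R)"
    by (subst N2.nn_integral_fst[symmetric]) (use mI in \<open>auto simp: split_beta'\<close>)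
  also have "\<dots> = emeasure ?R A"
    using AR by simp
  finally show "emeasure (distr ?P ?R ?g) A = emeasure ?R A" .
qed simp

definition dyadic_sd :: "nat \<Rightarrow> real" where
  "dyadic_sd j = sqrt ((1 / 2) ^ j)"

lemma dyadic_sd_pos: "0 < dyadic_sd j"
  by (simp add: dyadic_sd_def)

lemma dyadic_sd_Suc: "dyadic_sd (Suc j) = dyadic_sd j / sqrt 2"
  by (simp add: dyadic_sd_def real_sqrt_mult real_sqrt_divide)

text \<open>\<open>dyadic_increment z j k\<close> is the increment over \<open>[k / 2\<^sup>j, (k + 1) / 2\<^sup>j]\<close>; the two halves
  of an increment of level \<open>j\<close> differ by an independent normal variable (Levy's construction).\<close>

fun dyadic_increment :: "(nat \<Rightarrow> real) \<Rightarrow> nat \<Rightarrow> nat \<Rightarrow> real" where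
  "dyadic_increment z 0 = (\<lambda>k. z (prod_encode (0, k)))"
| "dyadic_increment z (Suc j) = interleave (\<lambda>k.
     (dyadic_increment z j k / 2 + dyadic_sd j / 2 * z (prod_encode (Suc j, k)),
      dyadic_increment z j k / 2 - dyadic_sd j / 2 * z (prod_encode (Suc j, k))))"

text \<open>Increments of level \<open>j\<close> read only coordinates of levels up to
  \<open>j\<close>. The index set \<open>I\<close> records this, so that the normals of level
  \<open>Suc j\<close> are seen to be independent of them.\<close>

lemma measurable_dyadic_increment:
  assumes "\<And>j' k. j' \<le> j \<Longrightarrow> prod_encode (j', k) \<in> I"
  shows "(\<lambda>z. dyadic_increment z j k) \<in> borel_measurable (Pi\<^sub>M I (\<lambda>_. borel))"
  using assms
proof (induction j arbitrary: k)
  case 0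
  then show ?case by simp
next
  case (Suc j)
  have [measurable]: "(\<lambda>z. dyadic_increment z j k) \<in> borel_measurable (Pi\<^sub>M I (\<lambda>_. borel))" for k
    using Suc by simp
  have [measurable]: "(\<lambda>z. z (prod_encode (Suc j, k))) \<in> borel_measurable (Pi\<^sub>M I (\<lambda>_. borel))" for k
    using Suc.prems[of "Suc j"] by (intro measurable_component_singleton) simp
  show ?case by (simp add: interleave_def)
qed

lemma dyadic_increment_restrict:
  assumes "\<And>j' k. j' \<le> j \<Longrightarrow> prod_encode (j', k) \<in> I"
  shows "dyadic_increment (restrict z I) j = dyadic_increment z j"
  using assms by (induction j) auto

text \<open>Induction on the level: the increments of level \<open>j\<close> are paired with the
  fresh normals of level \<open>Suc j\<close>, each pair is rotated into two half increments, and
  the halves are interleaved.\<close>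

lemma iid_dyadic_increment: "iid (seq_measure (normal_measure 1)) (normal_measure (dyadic_sd j)) (\<lambda>z. dyadic_increment z j)"
proof (induction j)
  let ?N = "normal_measure 1"
  have N: "prob_space ?N" by (rule prob_space_normal_density) simp
  case 0
  have "distr (Pi\<^sub>M UNIV (\<lambda>_. ?N)) (Pi\<^sub>M UNIV (\<lambda>_. ?N)) (\<lambda>z. \<lambda>k\<in>UNIV. z (prod_encode (0, k))) = Pi\<^sub>M UNIV (\<lambda>_. ?N)"
    by (rule distr_PiM_reindex[where f="\<lambda>k. prod_encode (0, k)" and M="\<lambda>_. ?N"]) (auto simp: N inj_on_def)
  moreover have "(\<lambda>z k. z (prod_encode (0, k))) \<in> measurable (seq_measure ?N) (seq_measure ?N)"
    by (rule measurable_PiM_single') (auto simp: space_PiM)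
  ultimately show ?case
    by (simp add: iid_def dyadic_sd_def restrict_UNIV)
next
  let ?N = "normal_measure 1"
  have N: "prob_space ?N" by (rule prob_space_normal_density) simp
  case (Suc j)
  let ?s = "dyadic_sd j"
  have Ns: "prob_space (normal_measure ?s)" by (rule prob_space_normal_density) (rule dyadic_sd_pos)
  have S: "prob_space (seq_measure ?N)" using N by (rule prob_space_seq_measure)
  let ?A = "{i. fst (prod_decode i) \<le> j}" and ?B = "{i. fst (prod_decode i) = Suc j}"
  have PiM_cong: "sets (Pi\<^sub>M I (\<lambda>_. ?N)) = sets (Pi\<^sub>M I (\<lambda>_. borel))" for I :: "nat set"
    by (intro sets_PiM_cong) auto
  have PiM_cong': "sets (seq_measure (normal_measure ?s)) = sets (seq_measure borel)"
    by (intro sets_PiM_cong) auto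
  have m1: "(\<lambda>z. dyadic_increment z j) \<in> measurable (Pi\<^sub>M ?A (\<lambda>_. ?N)) (seq_measure (normal_measure ?s))"
    unfolding measurable_cong_sets[OF PiM_cong PiM_cong']
    by (rule measurable_PiM_single') (auto intro!: measurable_dyadic_increment)
  have m2: "(\<lambda>z k. z (prod_encode (Suc j, k))) \<in> measurable (Pi\<^sub>M ?B (\<lambda>_. ?N)) (seq_measure ?N)"
    unfolding measurable_cong_sets[OF PiM_cong PiM_cong]
    by (rule measurable_PiM_single') (auto intro!: measurable_component_singleton)
  have "independent_pair (seq_measure ?N) (seq_measure (normal_measure ?s)) (\<lambda>z. dyadic_increment (restrict z ?A) j)
     (seq_measure ?N) (\<lambda>z k. restrict z ?B (prod_encode (Suc j, k)))"
    by (rule independent_pair_coordinates[OF N _ m1 m2]) auto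
  then have ind: "independent_pair (seq_measure ?N) (seq_measure (normal_measure ?s)) (\<lambda>z. dyadic_increment z j)
     (seq_measure ?N) (\<lambda>z k. z (prod_encode (Suc j, k)))"
    by (simp add: dyadic_increment_restrict)
  have "distr (Pi\<^sub>M UNIV (\<lambda>_. ?N)) (Pi\<^sub>M UNIV (\<lambda>_. ?N)) (\<lambda>z. \<lambda>k\<in>UNIV. z (prod_encode (Suc j, k))) = Pi\<^sub>M UNIV (\<lambda>_. ?N)"
    by (rule distr_PiM_reindex[where f="\<lambda>k. prod_encode (Suc j, k)" and M="\<lambda>_. ?N"]) (auto simp: N inj_on_def)
  then have Z: "iid (seq_measure ?N) ?N (\<lambda>z k. z (prod_encode (Suc j, k)))"
    using independent_pair_measurable(2)[OF ind] by (simp add: iid_def restrict_UNIV)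
  interpret Ns: prob_space "normal_measure ?s" by (rule Ns)
  interpret N1: prob_space ?N by (rule N)
  interpret pair_prob_space "normal_measure ?s" ?N ..
  let ?s' = "dyadic_sd (Suc j)"
  let ?g = "\<lambda>z. (fst z / 2 + ?s / 2 * snd z, fst z / 2 - ?s / 2 * snd z)"
  have d: "distr (normal_measure ?s \<Otimes>\<^sub>M ?N) (normal_measure ?s' \<Otimes>\<^sub>M normal_measure ?s') ?g = normal_measure ?s' \<Otimes>\<^sub>M normal_measure ?s'"
    unfolding dyadic_sd_Suc by (rule distr_normal_rotation[OF dyadic_sd_pos])
  have setsP: "sets (normal_measure ?s \<Otimes>\<^sub>M ?N) = sets (borel \<Otimes>\<^sub>M borel)"
    and setsR: "sets (normal_measure ?s' \<Otimes>\<^sub>M normal_measure ?s') = sets (borel \<Otimes>\<^sub>M borel)"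
    by (auto intro!: sets_pair_measure_cong)
  have g: "?g \<in> measurable (normal_measure ?s \<Otimes>\<^sub>M ?N) (normal_measure ?s' \<Otimes>\<^sub>M normal_measure ?s')"
    unfolding measurable_cong_sets[OF setsP setsR] by measurable
  have "iid (seq_measure ?N) (normal_measure ?s') (\<lambda>z. interleave (\<lambda>k. ?g (dyadic_increment z j k, z (prod_encode (Suc j, k)))))"
    by (intro iid_interleave S iid_map[OF prob_space_axioms iid_zip[OF Ns N S Suc Z ind] S g d]
        prob_space_normal_density dyadic_sd_pos)
  then show ?case by simp
qed

section \<open>Convergence and continuity of the dyadic paths\<close>

definition dyadic_path :: "(nat \<Rightarrow> real) \<Rightarrow> nat \<Rightarrow> nat \<Rightarrow> real" where
  "dyadic_path z j m = (\<Sum>k<m. dyadic_increment z j k)"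

text \<open>The base \<open>9 / 10\<close> is one choice between \<open>2\<close> to the power
  \<open>- 1 / 4\<close> and \<open>1\<close>: below \<open>1\<close> the increments are summable
  over the levels, and above the lower value a fourth moment bound makes the exceptional events
  summable.\<close>

definition regular_dyadic :: "(nat \<Rightarrow> real) \<Rightarrow> bool" where
  "regular_dyadic z \<longleftrightarrow> (\<forall>K. \<exists>j0. \<forall>j\<ge>j0. \<forall>k<K * 2 ^ j. \<bar>dyadic_increment z j k\<bar> \<le> (9 / 10) ^ j)"

definition dyadic_step :: "(nat \<Rightarrow> real) \<Rightarrow> real \<Rightarrow> nat \<Rightarrow> real" where
  "dyadic_step z t j = dyadic_path z j (nat \<lfloor>2 ^ j * t\<rfloor>)"

definition levy_path :: "(nat \<Rightarrow> real) \<Rightarrow> real \<Rightarrow> real" where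
  "levy_path z t = lim (dyadic_step z t)"

lemma dyadic_increment_split:
  "dyadic_increment z (Suc j) (2 * k) + dyadic_increment z (Suc j) (Suc (2 * k)) = dyadic_increment z j k"
  by (simp add: interleave_def)

text \<open>The two halves of a cell add up to its increment, so refinement leaves the values at
  coarser dyadic points unchanged.\<close>

lemma dyadic_path_double: "dyadic_path z (Suc j) (2 * m) = dyadic_path z j m"
proof (induction m)
  case (Suc m)
  have "dyadic_path z (Suc j) (2 * Suc m) = dyadic_path z (Suc j) (2 * m) +
     (dyadic_increment z (Suc j) (2 * m) + dyadic_increment z (Suc j) (Suc (2 * m)))"
    by (simp add: dyadic_path_def del: dyadic_increment.simps)
  also have "\<dots> = dyadic_path z j (Suc m)"
    unfolding dyadic_increment_split Suc by (simp add: dyadic_path_def)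
  finally show ?case .
qed (simp add: dyadic_path_def)

text \<open>On passing to the next level, the last grid point before \<open>t\<close> either stays
  put or advances by one cell of the finer grid, so at most one fine increment is added.\<close>

lemma dyadic_step_Suc:
  assumes "0 \<le> t" "t < real K" and b: "\<And>k. k < K * 2 ^ Suc j \<Longrightarrow> \<bar>dyadic_increment z (Suc j) k\<bar> \<le> c"
  shows "\<bar>dyadic_step z t (Suc j) - dyadic_step z t j\<bar> \<le> c"
proof -
  define m where "m = nat \<lfloor>2 ^ j * t\<rfloor>"
  have m: "real m \<le> 2 ^ j * t" "2 ^ j * t < real m + 1"
    using assms(1) by (auto simp: m_def)
  have "0 < K" using assms by (cases K) auto
  then have c0: "0 \<le> c" using b[of 0] by (smt (verit) nat_0_less_mult_iff zero_less_numeral zero_less_power)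
  have "\<lfloor>2 ^ Suc j * t\<rfloor> = 2 * int m \<or> \<lfloor>2 ^ Suc j * t\<rfloor> = 2 * int m + 1"
    using m by (simp add: floor_eq_iff) linarith
  then consider "nat \<lfloor>2 ^ Suc j * t\<rfloor> = 2 * m" | "nat \<lfloor>2 ^ Suc j * t\<rfloor> = Suc (2 * m)" by linarith
  then show ?thesis
  proof cases
    case 1
    then show ?thesis using c0 by (simp add: dyadic_step_def dyadic_path_double m_def)
  next
    case 2
    have "real (2 * m) \<le> 2 ^ Suc j * t" using m by simp
    also have "\<dots> < 2 ^ Suc j * real K" using assms(2) by simp
    finally have "real (2 * m) < real (K * 2 ^ Suc j)" by (simp add: mult.commute)
    then have "2 * m < K * 2 ^ Suc j" by (simp only: of_nat_less_iff)
    from b[OF this] show ?thesis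
      unfolding dyadic_step_def 2 using dyadic_path_double[of z j m]
      by (simp add: dyadic_path_def m_def del: dyadic_increment.simps)
  qed
qed

text \<open>The factor \<open>9\<close> is the sum of \<open>(9 / 10) ^ i\<close> over
  \<open>i \<ge> 1\<close>.\<close>

lemma geometric_increments_limit:
  fixes a :: "nat \<Rightarrow> real"
  assumes a: "\<And>j. j \<ge> j0 \<Longrightarrow> \<bar>a (Suc j) - a j\<bar> \<le> (9 / 10) ^ Suc j"
  shows "a \<longlonglongrightarrow> lim a" and "\<And>j. j \<ge> j0 \<Longrightarrow> \<bar>lim a - a j\<bar> \<le> 9 * (9 / 10) ^ j"
proof -
  \<comment> \<open>The subtracted tail closes the induction: the drop of
    \<open>9 * (9 / 10) ^ (j + n)\<close> in one step is exactly the allowed increment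
    \<open>(9 / 10) ^ Suc (j + n)\<close>.\<close>
  have *: "\<bar>a (j + n) - a j\<bar> \<le> 9 * (9 / 10) ^ j - 9 * (9 / 10) ^ (j + n)" if "j \<ge> j0" for j n
  proof (induction n)
    case (Suc n)
    have "\<bar>a (Suc (j + n)) - a (j + n)\<bar> \<le> (9 / 10) ^ Suc (j + n)" using that by (intro a) simp
    moreover have "(9 / 10 :: real) ^ Suc (j + n) = 9 / 10 * (9 / 10) ^ (j + n)" by simp
    ultimately show ?case using Suc unfolding add_Suc_right by linarith
  qed simp
  have **: "\<bar>a (j + n) - a j\<bar> \<le> 9 * (9 / 10) ^ j" if "j \<ge> j0" for j n
  proof -
    have "0 \<le> 9 * (9 / 10 :: real) ^ (j + n)" by simp
    with *[OF that, of n] show ?thesis by linarith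
  qed
  have "Cauchy a"
  proof (rule CauchyI')
    fix e :: real assume "e > 0"
    have "(\<lambda>j. 9 * (9 / 10 :: real) ^ j) \<longlonglongrightarrow> 0" by real_asymp
    from order_tendstoD(2)[OF this \<open>e > 0\<close>] obtain N where N: "\<And>j. j \<ge> N \<Longrightarrow> 9 * (9 / 10 :: real) ^ j < e"
      by (auto simp: eventually_sequentially)
    show "\<exists>M. \<forall>m\<ge>M. \<forall>n>m. dist (a m) (a n) < e"
    proof (intro exI[of _ "max N j0"] allI impI)
      fix m n assume "m \<ge> max N j0" "n > m"
      then have "\<bar>a (m + (n - m)) - a m\<bar> \<le> 9 * (9 / 10) ^ m" "9 * (9 / 10 :: real) ^ m < e"
        using **[of m "n - m"] N[of m] by auto
      then show "dist (a m) (a n) < e" using \<open>n > m\<close> by (simp add: dist_real_def abs_minus_commute)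
    qed
  qed
  then show lim: "a \<longlonglongrightarrow> lim a"
    by (simp add: Cauchy_convergent_iff convergent_LIMSEQ_iff)
  fix j assume j: "j \<ge> j0"
  have "(\<lambda>n. \<bar>a (n + j) - a j\<bar>) \<longlonglongrightarrow> \<bar>lim a - a j\<bar>"
    by (intro tendsto_rabs tendsto_diff LIMSEQ_ignore_initial_segment[OF lim] tendsto_const)
  then show "\<bar>lim a - a j\<bar> \<le> 9 * (9 / 10) ^ j"
    by (rule Lim_bounded[of _ _ 0]) (use **[OF j] in \<open>simp add: add.commute\<close>)
qed

lemma dyadic_step_tendsto:
  assumes z: "regular_dyadic z" and t: "0 \<le> t"
  shows "dyadic_step z t \<longlonglongrightarrow> levy_path z t"
proof -
  obtain K where K: "t < real K" using reals_Archimedean2 by blast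
  obtain j0 where j0: "\<And>j k. j \<ge> j0 \<Longrightarrow> k < K * 2 ^ j \<Longrightarrow> \<bar>dyadic_increment z j k\<bar> \<le> (9 / 10) ^ j"
    using z unfolding regular_dyadic_def by blast
  show ?thesis
    unfolding levy_path_def
    by (rule geometric_increments_limit[of j0]) (intro dyadic_step_Suc[OF t K] j0, auto)
qed

text \<open>For times closer than \<open>(1 / 2) ^ j\<close> the step paths of level
  \<open>j\<close> differ by at most one increment, and each limit is within
  \<open>9 * (9 / 10) ^ j\<close> of its step path.\<close>

lemma continuous_on_levy_path:
  assumes z: "regular_dyadic z"
  shows "continuous_on {0..} (levy_path z)"
  unfolding continuous_on_iff
proof (intro ballI allI impI)
  fix t e :: real assume t: "t \<in> {0..}" and e: "0 < e"
  \<comment> \<open>The margin \<open>1\<close> covers all times closer to \<open>t\<close> than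
    \<open>(1 / 2) ^ j\<close>.\<close>
  obtain K where K: "t + 1 < real K" using reals_Archimedean2 by blast
  obtain j0 where j0: "\<And>j k. j \<ge> j0 \<Longrightarrow> k < K * 2 ^ j \<Longrightarrow> \<bar>dyadic_increment z j k\<bar> \<le> (9 / 10) ^ j"
    using z unfolding regular_dyadic_def by blast
  \<comment> \<open>\<open>19 = 9 + 1 + 9\<close>: limit against step path at both times, and one
    increment between the two step values.\<close>
  have "(\<lambda>j. 19 * (9 / 10 :: real) ^ j) \<longlonglongrightarrow> 0" by real_asymp
  from order_tendstoD(2)[OF this e] obtain N where N: "\<And>j. j \<ge> N \<Longrightarrow> 19 * (9 / 10 :: real) ^ j < e"
    by (auto simp: eventually_sequentially)
  define j where "j = max N j0"
  have near: "\<bar>levy_path z s - dyadic_step z s j\<bar> \<le> 9 * (9 / 10) ^ j" if "0 \<le> s" "s < real K" for s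
    unfolding levy_path_def
    by (rule geometric_increments_limit(2)[of j0]) (auto intro!: dyadic_step_Suc[OF that] j0 simp: j_def simp del: dyadic_increment.simps power_Suc)
  have step: "\<bar>dyadic_step z s j - dyadic_step z r j\<bar> \<le> (9 / 10) ^ j"
    if "0 \<le> r" "r \<le> s" "s < real K" "s - r < (1 / 2) ^ j" for r s
  proof -
    define m where "m = nat \<lfloor>2 ^ j * r\<rfloor>"
    have m: "real m \<le> 2 ^ j * r" "2 ^ j * r < real m + 1"
      using that(1) by (auto simp: m_def)
    have "2 ^ j * (s - r) < 2 ^ j * (1 / 2) ^ j" using that by (intro mult_strict_left_mono) auto
    then have "2 ^ j * s < 2 ^ j * r + 1" by (simp add: power_mult_distrib[symmetric] algebra_simps)
    moreover have "2 ^ j * r \<le> 2 ^ j * s" using that by simp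
    ultimately have "real m \<le> 2 ^ j * s" "2 ^ j * s < real m + 2" using m by linarith+
    then have "\<lfloor>2 ^ j * s\<rfloor> = int m \<or> \<lfloor>2 ^ j * s\<rfloor> = int m + 1"
      by (simp add: floor_eq_iff) linarith
    then consider "nat \<lfloor>2 ^ j * s\<rfloor> = m" | "nat \<lfloor>2 ^ j * s\<rfloor> = Suc m" by linarith
    then show ?thesis
    proof cases
      case 1
      then show ?thesis by (simp add: dyadic_step_def m_def)
    next
      case 2
      have "real m \<le> 2 ^ j * s" by fact
      also have "\<dots> < 2 ^ j * real K" using that by simp
      finally have "real m < real (K * 2 ^ j)" by (simp add: mult.commute)
      then have "m < K * 2 ^ j" by (simp only: of_nat_less_iff)
      then have "\<bar>dyadic_increment z j m\<bar> \<le> (9 / 10) ^ j" by (intro j0) (auto simp: j_def)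
      then show ?thesis
        unfolding dyadic_step_def 2 by (simp add: dyadic_path_def m_def)
    qed
  qed
  show "\<exists>d>0. \<forall>s\<in>{0..}. dist s t < d \<longrightarrow> dist (levy_path z s) (levy_path z t) < e"
  proof (intro exI[of _ "(1 / 2) ^ j"] conjI ballI impI)
    fix s :: real assume s: "s \<in> {0..}" "dist s t < (1 / 2) ^ j"
    have "(1 / 2 :: real) ^ j \<le> 1" by (simp add: power_le_one)
    with s K t have sK: "s < real K" "t < real K" by (auto simp: dist_real_def)
    have "\<bar>dyadic_step z s j - dyadic_step z t j\<bar> \<le> (9 / 10) ^ j"
    proof (cases "t \<le> s")
      case True
      then show ?thesis using step[of t s] s t sK by (auto simp: dist_real_def)
    next
      case False
      then show ?thesis using step[of s t] s t sK by (auto simp: dist_real_def abs_minus_commute)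
    qed
    with near[of s] near[of t] s t sK have "\<bar>levy_path z s - levy_path z t\<bar> \<le> 19 * (9 / 10) ^ j" by auto
    with N[of j] show "dist (levy_path z s) (levy_path z t) < e" by (auto simp: dist_real_def j_def)
  qed simp
qed

lemma levy_path_0: "levy_path z 0 = 0"
proof -
  have "dyadic_step z 0 = (\<lambda>_. 0)" by (auto simp: dyadic_step_def dyadic_path_def)
  then show ?thesis by (simp add: levy_path_def)
qed

text \<open>An increment of level \<open>j\<close> has fourth moment \<open>3 * (1 / 4) ^ j\<close>,
  so Markov's inequality for the fourth power beats the number \<open>K * 2 ^ j\<close> of
  increments in Borel-Cantelli. The second moment decays only like \<open>(1 / 2) ^ j\<close>, which
  is too slow.\<close>

lemma AE_regular_dyadic: "AE z in seq_measure (normal_measure 1). regular_dyadic z"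
proof -
  let ?S = "seq_measure (normal_measure 1)"
  interpret S: prob_space ?S
    by (intro prob_space_seq_measure prob_space_normal_density) simp
  have setsS: "sets ?S = sets (seq_measure borel)"
    by (intro sets_PiM_cong) auto
  have m [measurable]: "(\<lambda>z. dyadic_increment z j k) \<in> borel_measurable ?S" for j k
    unfolding measurable_cong_sets[OF setsS refl] by (rule measurable_dyadic_increment) simp
  have tail: "measure ?S {z \<in> space ?S. (9 / 10) ^ j < \<bar>dyadic_increment z j k\<bar>} \<le> 3 * (1 / 4 * (10 / 9) ^ 4) ^ j" for j k
  proof -
    let ?s = "dyadic_sd j"
    have D: "distr ?S (normal_measure ?s) (\<lambda>z. dyadic_increment z j k) = normal_measure ?s"
      by (rule iid_distr_coord[OF iid_dyadic_increment]) (rule prob_space_normal_density[OF dyadic_sd_pos])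
    have mom: "has_bochner_integral lborel (\<lambda>x. normal_density 0 ?s x * (x - 0) ^ (2 * 2)) (fact (2 * 2) / ((2 / ?s\<^sup>2) ^ 2 * fact 2))"
      by (rule normal_moment_even[OF dyadic_sd_pos])
    have s4: "fact (2 * 2) / ((2 / ?s\<^sup>2) ^ 2 * fact 2) = 3 * ((1 / 4) ^ j)"
    proof -
      have "?s\<^sup>2 = (1 / 2) ^ j" by (simp add: dyadic_sd_def)
      moreover have "((1 / 2 :: real) ^ j)\<^sup>2 = (1 / 4) ^ j" by (simp add: power_mult_distrib[symmetric] power2_eq_square)
      moreover have "fact 4 = (24 :: real)" by (simp add: fact_numeral)
      ultimately show ?thesis by (simp add: power_divide)
    qed
    have int: "integrable lborel (\<lambda>x. normal_density 0 ?s x * x ^ 4)" and val: "(\<integral>x. normal_density 0 ?s x * x ^ 4 \<partial>lborel) = 3 * (1 / 4) ^ j"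
      using mom unfolding s4 by (auto simp: has_bochner_integral_iff)
    have intN: "integrable (normal_measure ?s) (\<lambda>x. x ^ 4)" and valN: "(\<integral>x. x ^ 4 \<partial>normal_measure ?s) = 3 * (1 / 4) ^ j"
      using int val by (auto simp: integrable_density integral_density)
    have "measure ?S {z \<in> space ?S. (9 / 10) ^ j < \<bar>dyadic_increment z j k\<bar>} = measure (distr ?S (normal_measure ?s) (\<lambda>z. dyadic_increment z j k)) {x. (9 / 10) ^ j < \<bar>x\<bar>}"
      by (subst measure_distr) (auto intro!: arg_cong[where f="measure ?S"])
    also have "\<dots> = measure (normal_measure ?s) {x. (9 / 10) ^ j < \<bar>x\<bar>}"
      unfolding D ..
    also have "\<dots> \<le> measure (normal_measure ?s) {x \<in> space (normal_measure ?s). ((9 / 10) ^ j) ^ 4 \<le> x ^ 4}"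
    proof (rule finite_measure.finite_measure_mono)
      show "finite_measure (normal_measure ?s)"
        by (intro prob_space.finite_measure prob_space_normal_density dyadic_sd_pos)
      show "{x. (9 / 10) ^ j < \<bar>x\<bar>} \<subseteq> {x \<in> space (normal_measure ?s). ((9 / 10) ^ j) ^ 4 \<le> x ^ 4}"
      proof safe
        fix x :: real assume "(9 / 10) ^ j < \<bar>x\<bar>"
        then have "((9 / 10) ^ j) ^ 4 \<le> \<bar>x\<bar> ^ 4" by (intro power_mono) auto
        then show "((9 / 10) ^ j) ^ 4 \<le> x ^ 4" by (simp add: power_even_abs_numeral)
      qed simp
    qed simp
    also have "\<dots> \<le> (\<integral>x. x ^ 4 \<partial>normal_measure ?s) / ((9 / 10) ^ j) ^ 4"
      by (rule integral_Markov_inequality_measure[where A="{}"]) (use intN in auto)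
    also have "\<dots> = 3 * (1 / 4 * (10 / 9) ^ 4) ^ j"
    proof -
      have "((9 / 10 :: real) ^ j) ^ 4 = ((9 / 10) ^ 4) ^ j" by (metis power_mult mult.commute)
      moreover have "1 / 4 * (10 / 9) ^ 4 = (1 / 4) / (9 / 10 :: real) ^ 4" by (simp add: power_divide)
      ultimately show ?thesis unfolding valN by (simp only: power_divide times_divide_eq_right)
    qed
    finally show ?thesis .
  qed
  have "AE z in ?S. eventually (\<lambda>j. z \<in> space ?S - (\<Union>k<K * 2 ^ j. {z \<in> space ?S. (9 / 10) ^ j < \<bar>dyadic_increment z j k\<bar>})) sequentially" for K :: nat
  proof (rule borel_cantelli_AE1)
    show "summable (\<lambda>j. measure ?S (\<Union>k<K * 2 ^ j. {z \<in> space ?S. (9 / 10) ^ j < \<bar>dyadic_increment z j k\<bar>}))"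
    proof (rule summable_comparison_test')
      \<comment> \<open>The ratio \<open>2 * (1 / 4) * (10 / 9) ^ 4\<close> is about
        \<open>0.76\<close>.\<close>
      show "summable (\<lambda>j. 3 * real K * (2 * (1 / 4 * (10 / 9) ^ 4)) ^ j :: real)"
        by (intro summable_mult summable_geometric) (simp add: power_divide)
      fix j :: nat assume "j \<ge> 0"
      have "measure ?S (\<Union>k<K * 2 ^ j. {z \<in> space ?S. (9 / 10) ^ j < \<bar>dyadic_increment z j k\<bar>})
        \<le> (\<Sum>k<K * 2 ^ j. measure ?S {z \<in> space ?S. (9 / 10) ^ j < \<bar>dyadic_increment z j k\<bar>})"
        by (rule measure_UNION_le) auto
      also have "\<dots> \<le> (\<Sum>k<K * 2 ^ j. 3 * (1 / 4 * (10 / 9) ^ 4) ^ j)"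
        by (intro sum_mono tail)
      also have "\<dots> = 3 * real K * (2 * (1 / 4 * (10 / 9) ^ 4)) ^ j"
      proof -
        show ?thesis
          unfolding power_mult_distrib[of 2 "1 / 4 * (10 / 9) ^ 4"]
          by (simp only: sum_constant card_lessThan of_nat_mult of_nat_power of_nat_numeral ac_simps)
      qed
      finally show "norm (measure ?S (\<Union>k<K * 2 ^ j. {z \<in> space ?S. (9 / 10) ^ j < \<bar>dyadic_increment z j k\<bar>})) \<le> 3 * real K * (2 * (1 / 4 * (10 / 9) ^ 4)) ^ j"
        by simp
    qed
  qed (auto simp: S.emeasure_finite less_top[symmetric])
  then have "AE z in ?S. \<forall>K. eventually (\<lambda>j. z \<in> space ?S - (\<Union>k<K * 2 ^ j. {z \<in> space ?S. (9 / 10) ^ j < \<bar>dyadic_increment z j k\<bar>})) sequentially"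
    by (simp add: AE_all_countable)
  then show ?thesis
  proof eventually_elim
    case (elim z)
    show ?case
      unfolding regular_dyadic_def
    proof
      fix K
      from elim obtain j0 where "\<forall>j\<ge>j0. z \<in> space ?S - (\<Union>k<K * 2 ^ j. {z \<in> space ?S. (9 / 10) ^ j < \<bar>dyadic_increment z j k\<bar>})"
        unfolding eventually_sequentially by blast
      then show "\<exists>j0. \<forall>j\<ge>j0. \<forall>k<K * 2 ^ j. \<bar>dyadic_increment z j k\<bar> \<le> (9 / 10) ^ j"
        by (intro exI[of _ j0]) (auto simp: not_less)
    qed
  qed
qed

lemma sets_regular_dyadic: "{z \<in> space (seq_measure borel). regular_dyadic z} \<in> sets (seq_measure borel)"
proof -
  have [measurable]: "(\<lambda>z. dyadic_increment z j k) \<in> borel_measurable (seq_measure borel)" for j k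
    by (rule measurable_dyadic_increment) simp
  show ?thesis unfolding regular_dyadic_def by measurable
qed

text \<open>The zero sequence will replace the irregular ones, so that path continuity holds for
  every outcome.\<close>

lemma regular_dyadic_0: "regular_dyadic (\<lambda>_. 0)"
proof -
  have "dyadic_increment (\<lambda>_. 0) j = (\<lambda>_. 0)" for j
    by (induction j) (auto simp: interleave_def)
  then show ?thesis by (simp add: regular_dyadic_def)
qed

lemma measurable_dyadic_step [measurable]: "(\<lambda>z. dyadic_step z t j) \<in> borel_measurable (seq_measure borel)"
proof -
  have [measurable]: "(\<lambda>z. dyadic_increment z j k) \<in> borel_measurable (seq_measure borel)" for j k
    by (rule measurable_dyadic_increment) simp
  show ?thesis unfolding dyadic_step_def dyadic_path_def by measurable
qed

lemma measurable_levy_path [measurable]: "(\<lambda>z. levy_path z t) \<in> borel_measurable (seq_measure borel)"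
  unfolding levy_path_def by (intro borel_measurable_lim_metric) simp

section \<open>Independence and law of the limit increments\<close>

lemma char_normal:
  assumes s: "0 < s"
  shows "char (normal_measure s) u = exp (- (s * u)\<^sup>2 / 2)"
proof -
  interpret std: prob_space std_normal_distribution by (rule prob_space_normal_density) simp
  have "distributed std_normal_distribution lborel (\<lambda>x. x) std_normal_density"
    by (simp add: distributed_def distr_id2)
  from std.normal_density_affine[OF this, of s 0] s
  have "distributed std_normal_distribution lborel (\<lambda>x. s * x) (normal_density 0 s)" by simp
  then have d: "normal_measure s = distr std_normal_distribution lborel (\<lambda>x. s * x)"
    by (simp add: distributed_def)
  have "char (normal_measure s) u = char std_normal_distribution (s * u)"
    unfolding d char_def by (subst integral_distr) (auto simp: ac_simps)
  then show ?thesis by (simp add: char_std_normal_distribution)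
qed

text \<open>Continuous functions that decrease to the indicator of a closed \<open>A\<close>. The
  empty set is separate because \<open>infdist x {}\<close> is \<open>0\<close>, for which the
  formula would give the constant \<open>1\<close>.\<close>

definition closed_cutoff :: "real set \<Rightarrow> nat \<Rightarrow> real \<Rightarrow> real" where
  "closed_cutoff A m x = (if A = {} then 0 else max 0 (1 - real m * infdist x A))"

lemma isCont_closed_cutoff: "isCont (closed_cutoff A m) x"
  unfolding closed_cutoff_def by (cases "A = {}") (auto intro!: continuous_intros)

lemma closed_cutoff_bounds: "0 \<le> closed_cutoff A m x" "closed_cutoff A m x \<le> 1"
  by (auto simp: closed_cutoff_def infdist_nonneg)

lemma measurable_closed_cutoff [measurable]: "closed_cutoff A m \<in> borel_measurable borel"
  by (intro borel_measurable_continuous_onI) (simp add: continuous_on_eq_continuous_at isCont_closed_cutoff)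

lemma closed_cutoff_tendsto:
  assumes "closed A"
  shows "(\<lambda>m. closed_cutoff A m x) \<longlonglongrightarrow> indicator A x"
proof (cases "A = {} \<or> x \<in> A")
  case True
  then have "closed_cutoff A m x = indicator A x" for m by (auto simp: closed_cutoff_def)
  then show ?thesis by simp
next
  case False
  then have d: "0 < infdist x A"
    using in_closed_iff_infdist_zero[OF assms] infdist_nonneg[of x A] by (metis less_eq_real_def)
  obtain N where N: "1 < real N * infdist x A" using reals_Archimedean3[OF d] by blast
  have "closed_cutoff A m x = 0" if "m \<ge> N" for m
  proof -
    have "real N * infdist x A \<le> real m * infdist x A" using that d by (intro mult_right_mono) auto
    then show ?thesis using N by (simp add: closed_cutoff_def)
  qed
  then have "eventually (\<lambda>m. closed_cutoff A m x = indicator A x) sequentially"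
    using False by (auto simp: eventually_sequentially)
  then show ?thesis by (rule tendsto_eventually)
qed

text \<open>Expectations of products of continuous cutoffs converge by dominated convergence, and so
  do the single expectations. Sharpening the cutoffs then reaches closed sets, an
  intersection-stable generator of the Borel sets.\<close>

lemma (in prob_space) indep_vars_limit:
  fixes X :: "nat \<Rightarrow> nat \<Rightarrow> 'a \<Rightarrow> real"
  assumes ind: "\<And>j. indep_vars (\<lambda>_. borel) (X j) {..<n}"
    and lim: "\<And>k \<omega>. k < n \<Longrightarrow> \<omega> \<in> space M \<Longrightarrow> (\<lambda>j. X j k \<omega>) \<longlonglongrightarrow> Y k \<omega>"
    and Y: "\<And>k. k < n \<Longrightarrow> Y k \<in> borel_measurable M"
  shows "indep_vars (\<lambda>_. borel) Y {..<n}"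
proof (cases "n = 0")
  case True
  then show ?thesis by (simp add: indep_vars_def2 indep_sets_def)
next
  case False
  note [measurable] = Y
  have X [measurable]: "X j k \<in> borel_measurable M" if "k < n" for j k
    using ind[of j] that by (auto simp: indep_vars_def)
  have cut: "expectation (\<lambda>\<omega>. \<Prod>k<n. closed_cutoff (A k) m (Y k \<omega>)) = (\<Prod>k<n. expectation (\<lambda>\<omega>. closed_cutoff (A k) m (Y k \<omega>)))"
    for A m
  proof (rule LIMSEQ_unique)
    show "(\<lambda>j. expectation (\<lambda>\<omega>. \<Prod>k<n. closed_cutoff (A k) m (X j k \<omega>))) \<longlonglongrightarrow> expectation (\<lambda>\<omega>. \<Prod>k<n. closed_cutoff (A k) m (Y k \<omega>))"
    proof (rule integral_dominated_convergence[where w="\<lambda>_. 1"])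
      show "AE \<omega> in M. (\<lambda>j. \<Prod>k<n. closed_cutoff (A k) m (X j k \<omega>)) \<longlonglongrightarrow> (\<Prod>k<n. closed_cutoff (A k) m (Y k \<omega>))"
        by (intro AE_I2 tendsto_prod isCont_tendsto_compose[OF isCont_closed_cutoff] lim) auto
      show "AE \<omega> in M. norm (\<Prod>k<n. closed_cutoff (A k) m (X j k \<omega>)) \<le> 1" for j
        by (intro AE_I2) (auto simp: abs_prod closed_cutoff_bounds intro!: prod_le_1)
    qed (auto intro!: borel_measurable_prod measurable_compose[OF _ measurable_closed_cutoff])
    have "expectation (\<lambda>\<omega>. \<Prod>k<n. closed_cutoff (A k) m (X j k \<omega>)) = (\<Prod>k<n. expectation (\<lambda>\<omega>. closed_cutoff (A k) m (X j k \<omega>)))" for j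
    proof (rule indep_vars_lebesgue_integral)
      show "indep_vars (\<lambda>_. borel) (\<lambda>k \<omega>. closed_cutoff (A k) m (X j k \<omega>)) {..<n}"
        by (rule indep_vars_compose2[OF ind]) simp
      show "integrable M (\<lambda>\<omega>. closed_cutoff (A k) m (X j k \<omega>))" if "k \<in> {..<n}" for k
        using that by (intro integrable_const_bound[where B=1]) (auto simp: closed_cutoff_bounds intro!: measurable_compose[OF _ measurable_closed_cutoff])
    qed simp
    moreover have "(\<lambda>j. \<Prod>k<n. expectation (\<lambda>\<omega>. closed_cutoff (A k) m (X j k \<omega>))) \<longlonglongrightarrow> (\<Prod>k<n. expectation (\<lambda>\<omega>. closed_cutoff (A k) m (Y k \<omega>)))"
    proof (intro tendsto_prod integral_dominated_convergence[where w="\<lambda>_. 1"])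
      fix k assume "k \<in> {..<n}"
      then show "AE \<omega> in M. (\<lambda>j. closed_cutoff (A k) m (X j k \<omega>)) \<longlonglongrightarrow> closed_cutoff (A k) m (Y k \<omega>)"
        by (intro AE_I2 isCont_tendsto_compose[OF isCont_closed_cutoff] lim) auto
    qed (auto simp: closed_cutoff_bounds intro!: measurable_compose[OF _ measurable_closed_cutoff])
    ultimately show "(\<lambda>j. expectation (\<lambda>\<omega>. \<Prod>k<n. closed_cutoff (A k) m (X j k \<omega>))) \<longlonglongrightarrow> (\<Prod>k<n. expectation (\<lambda>\<omega>. closed_cutoff (A k) m (Y k \<omega>)))"
      by simp
  qed
  have prod: "prob (\<Inter>k\<in>{..<n}. Y k -` A k \<inter> space M) = (\<Prod>k\<in>{..<n}. prob (Y k -` A k \<inter> space M))"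
    if A: "\<And>k. k < n \<Longrightarrow> closed (A k)" for A
  proof -
    have Ab [measurable]: "A k \<in> sets borel" if "k < n" for k using A[OF that] by simp
    have "expectation (\<lambda>\<omega>. \<Prod>k<n. indicator (A k) (Y k \<omega>) :: real) = (\<Prod>k<n. expectation (\<lambda>\<omega>. indicator (A k) (Y k \<omega>)))"
    proof (rule LIMSEQ_unique)
      show "(\<lambda>m. expectation (\<lambda>\<omega>. \<Prod>k<n. closed_cutoff (A k) m (Y k \<omega>))) \<longlonglongrightarrow> expectation (\<lambda>\<omega>. \<Prod>k<n. indicator (A k) (Y k \<omega>))"
      proof (rule integral_dominated_convergence[where w="\<lambda>_. 1"])
        show "AE \<omega> in M. (\<lambda>m. \<Prod>k<n. closed_cutoff (A k) m (Y k \<omega>)) \<longlonglongrightarrow> (\<Prod>k<n. indicator (A k) (Y k \<omega>))"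
          by (intro AE_I2 tendsto_prod closed_cutoff_tendsto A) auto
        show "AE \<omega> in M. norm (\<Prod>k<n. closed_cutoff (A k) m (Y k \<omega>)) \<le> 1" for m
          by (intro AE_I2) (auto simp: abs_prod closed_cutoff_bounds intro!: prod_le_1)
      qed (auto intro!: borel_measurable_prod measurable_compose[OF _ measurable_closed_cutoff] measurable_compose[OF Y borel_measurable_indicator])
      show "(\<lambda>m. expectation (\<lambda>\<omega>. \<Prod>k<n. closed_cutoff (A k) m (Y k \<omega>))) \<longlonglongrightarrow> (\<Prod>k<n. expectation (\<lambda>\<omega>. indicator (A k) (Y k \<omega>)))"
        unfolding cut
      proof (intro tendsto_prod integral_dominated_convergence[where w="\<lambda>_. 1"])
        fix k assume "k \<in> {..<n}"
        then show "AE \<omega> in M. (\<lambda>m. closed_cutoff (A k) m (Y k \<omega>)) \<longlonglongrightarrow> indicator (A k) (Y k \<omega>)"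
          by (intro AE_I2 closed_cutoff_tendsto A) auto
      qed (auto simp: closed_cutoff_bounds intro!: measurable_compose[OF _ measurable_closed_cutoff] measurable_compose[OF Y borel_measurable_indicator])
    qed
    moreover have "expectation (\<lambda>\<omega>. indicator (A k) (Y k \<omega>) :: real) = prob (Y k -` A k \<inter> space M)" if "k < n" for k
    proof -
      have "expectation (\<lambda>\<omega>. indicator (A k) (Y k \<omega>) :: real) = expectation (indicator (Y k -` A k \<inter> space M))"
        by (intro Bochner_Integration.integral_cong) (auto simp: indicator_def)
      also have "\<dots> = prob (Y k -` A k \<inter> space M)"
        using that measurable_sets[OF Y Ab] by simp
      finally show ?thesis .
    qed
    moreover have "expectation (\<lambda>\<omega>. \<Prod>k<n. indicator (A k) (Y k \<omega>) :: real) = prob (\<Inter>k\<in>{..<n}. Y k -` A k \<inter> space M)"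
    proof -
      have "(\<Inter>k\<in>{..<n}. Y k -` A k \<inter> space M) \<in> events"
        using False by (intro sets.finite_INT) auto
      moreover have "expectation (\<lambda>\<omega>. \<Prod>k<n. indicator (A k) (Y k \<omega>) :: real) = expectation (indicator (\<Inter>k\<in>{..<n}. Y k -` A k \<inter> space M))"
      proof (intro Bochner_Integration.integral_cong refl)
        fix \<omega> assume "\<omega> \<in> space M"
        then show "(\<Prod>k<n. indicator (A k) (Y k \<omega>)) = (indicator (\<Inter>k\<in>{..<n}. Y k -` A k \<inter> space M) \<omega> :: real)"
          by (cases "\<forall>k<n. Y k \<omega> \<in> A k") (auto simp: indicator_def intro!: prod_zero)
      qed
      ultimately show ?thesis by simp
    qed
    ultimately show ?thesis by simp
  qed
  show ?thesis
  proof (subst indep_vars_finite[where E="\<lambda>_. Collect closed"])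
    show "sets borel = sigma_sets (space borel) (Collect closed :: real set set)"
      by (simp add: borel_eq_closed)
    show "Int_stable (Collect closed :: real set set)"
      by (auto simp: Int_stable_def)
    show "\<forall>A\<in>{..<n} \<rightarrow> Collect closed. prob (\<Inter>j\<in>{..<n}. Y j -` A j \<inter> space M) = (\<Prod>j\<in>{..<n}. prob (Y j -` A j \<inter> space M))"
    proof
      fix A assume "A \<in> {..<n} \<rightarrow> Collect (closed :: real set \<Rightarrow> bool)"
      then show "prob (\<Inter>j\<in>{..<n}. Y j -` A j \<inter> space M) = (\<Prod>j\<in>{..<n}. prob (Y j -` A j \<inter> space M))"
        by (intro prod) auto
    qed
  qed (use False Y in auto)
qed

text \<open>Increments of a step path over \<open>[s, t]\<close> are sums over blocks of independent
  normals. Their characteristic functions converge because the variances do, and disjoint time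
  intervals use disjoint blocks; both facts are carried to the limit.\<close>

theorem standard_brownian_motion_levy_path:
  assumes M: "prob_space M" and Z: "iid M (normal_measure 1) Z"
    and reg: "\<And>\<omega>. \<omega> \<in> space M \<Longrightarrow> regular_dyadic (Z \<omega>)"
  shows "standard_brownian_motion M (\<lambda>t \<omega>. levy_path (Z \<omega>) t)"
proof -
  interpret prob_space M by fact
  have setsS: "sets (seq_measure (normal_measure 1)) = sets (seq_measure borel)"
    by (intro sets_PiM_cong) auto
  have mZ: "Z \<in> measurable M (seq_measure borel)"
    using iid_measurable[OF Z] by (simp add: measurable_cong_sets[OF refl setsS])
  have mB [measurable]: "(\<lambda>\<omega>. levy_path (Z \<omega>) t) \<in> borel_measurable M" for t
    by (rule measurable_compose[OF mZ measurable_levy_path])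
  have mS [measurable]: "(\<lambda>\<omega>. dyadic_step (Z \<omega>) t j) \<in> borel_measurable M" for t j
    by (rule measurable_compose[OF mZ measurable_dyadic_step])
  define D where "D j k \<omega> = dyadic_increment (Z \<omega>) j k" for j k \<omega>
  have iidD: "iid M (normal_measure (dyadic_sd j)) (\<lambda>\<omega> k. D j k \<omega>)" for j
    using iid_compose[OF Z iid_dyadic_increment] by (simp add: D_def)
  have Ns: "prob_space (normal_measure (dyadic_sd j))" for j
    by (rule prob_space_normal_density[OF dyadic_sd_pos])
  have mD [measurable]: "D j k \<in> borel_measurable M" for j k
    using iid_coord_measurable[OF iidD, of j k] by simp
  have indD: "indep_vars (\<lambda>_. borel) (D j) UNIV" for j
    using iid_indep_vars[OF M Ns iidD, of j] unfolding indep_vars_def2 by simp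
  have disD: "distributed M lborel (D j k) (normal_density 0 (dyadic_sd j))" for j k
  proof -
    have "distr M lborel (D j k) = distr M (normal_measure (dyadic_sd j)) (D j k)"
      by (intro distr_cong) auto
    then show ?thesis
      using iid_distr_coord[OF iidD Ns, of j k] mD[of j k] by (simp add: distributed_def)
  qed
  define m where "m j t = nat \<lfloor>2 ^ j * t\<rfloor>" for j :: nat and t :: real
  have m_mono: "m j s \<le> m j t" if "s \<le> t" for s t j
    using that by (auto simp: m_def intro!: nat_mono floor_mono)
  have inc: "dyadic_step (Z \<omega>) t j - dyadic_step (Z \<omega>) s j = (\<Sum>k\<in>{m j s..<m j t}. D j k \<omega>)" if "s \<le> t" for s t j \<omega>
    using m_mono[OF that, of j]
    unfolding dyadic_step_def dyadic_path_def m_def[symmetric] D_def lessThan_atLeast0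
    by (intro sum_diff_nat_ivl) auto
  have m_lim: "(\<lambda>j. real (m j t) * (1 / 2) ^ j) \<longlonglongrightarrow> t" if "0 \<le> t" for t
  proof (rule tendsto_sandwich)
    have b: "2 ^ j * t - 1 \<le> real (m j t)" "real (m j t) \<le> 2 ^ j * t" for j
      using that by (auto simp: m_def)
    have e: "2 ^ j * t * (1 / 2) ^ j = t" for j by (simp add: power_divide)
    show "eventually (\<lambda>j. t - (1 / 2) ^ j \<le> real (m j t) * (1 / 2) ^ j) sequentially"
    proof (intro always_eventually allI)
      show "t - (1 / 2) ^ j \<le> real (m j t) * (1 / 2) ^ j" for j
        using mult_right_mono[OF b(1)[of j], of "(1 / 2) ^ j"] by (simp add: left_diff_distrib e)
    qed
    show "eventually (\<lambda>j. real (m j t) * (1 / 2) ^ j \<le> t) sequentially"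
    proof (intro always_eventually allI)
      show "real (m j t) * (1 / 2) ^ j \<le> t" for j
        using mult_right_mono[OF b(2)[of j], of "(1 / 2) ^ j"] by (simp add: e)
    qed
    show "(\<lambda>j. t - (1 / 2) ^ j) \<longlonglongrightarrow> t" by real_asymp
  qed simp
  have lim: "(\<lambda>j. dyadic_step (Z \<omega>) t j) \<longlonglongrightarrow> levy_path (Z \<omega>) t" if "\<omega> \<in> space M" "0 \<le> t" for \<omega> t
    using dyadic_step_tendsto[OF reg[OF that(1)] that(2)] by simp
  have normal: "distributed M lborel (\<lambda>\<omega>. levy_path (Z \<omega>) t - levy_path (Z \<omega>) s) (normal_density 0 (sqrt (t - s)))"
    if st: "0 \<le> s" "s < t" for s t
  proof -
    let ?W = "\<lambda>j \<omega>. dyadic_step (Z \<omega>) t j - dyadic_step (Z \<omega>) s j"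
    let ?Y = "\<lambda>\<omega>. levy_path (Z \<omega>) t - levy_path (Z \<omega>) s"
    \<comment> \<open>The variance of the step increment: the number of cells times the variance of
      one cell.\<close>
    define v where "v j = (real (m j t) - real (m j s)) * (1 / 2) ^ j" for j
    have v: "v \<longlonglongrightarrow> t - s"
      unfolding v_def left_diff_distrib using st by (intro tendsto_diff m_lim) auto
    have ch: "char (distr M borel (?W j)) u = exp (- (v j * u\<^sup>2) / 2)" for j u
    proof -
      have "char (distr M borel (?W j)) u = char (distr M borel (\<lambda>\<omega>. \<Sum>k\<in>{m j s..<m j t}. D j k \<omega>)) u"
        using st by (simp add: inc)
      also have "\<dots> = (\<Prod>k\<in>{m j s..<m j t}. char (distr M borel (D j k)) u)"
        by (rule char_distr_sum) (rule indep_vars_subset[OF indD], simp)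
      also have "\<dots> = (\<Prod>k\<in>{m j s..<m j t}. exp (- (dyadic_sd j * u)\<^sup>2 / 2))"
      proof (subst of_real_prod, intro prod.cong refl)
        fix k
        have "distr M borel (D j k) = distr M lborel (D j k)" by (intro distr_cong) auto
        also have "\<dots> = normal_measure (dyadic_sd j)" using disD by (simp add: distributed_def)
        finally show "char (distr M borel (D j k)) u = exp (- (dyadic_sd j * u)\<^sup>2 / 2)"
          by (simp add: char_normal[OF dyadic_sd_pos])
      qed
      also have "\<dots> = exp (of_nat (m j t - m j s) * (- (dyadic_sd j * u)\<^sup>2 / 2))"
        by (simp add: exp_of_nat_mult[symmetric])
      also have "of_nat (m j t - m j s) * (- (dyadic_sd j * u)\<^sup>2 / 2) = - (v j * u\<^sup>2) / 2"
        using st m_mono[of s t j] by (simp add: v_def of_nat_diff power_mult_distrib dyadic_sd_def)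
      finally show ?thesis by simp
    qed
    have "char (distr M borel ?Y) u = char (normal_measure (sqrt (t - s))) u" for u
    proof (rule LIMSEQ_unique)
      have "(\<lambda>j. char (distr M borel (?W j)) u) \<longlonglongrightarrow> complex_of_real (exp (- ((t - s) * u\<^sup>2) / 2))"
        unfolding ch by (intro tendsto_intros v) simp
      then show "(\<lambda>j. char (distr M borel (?W j)) u) \<longlonglongrightarrow> char (normal_measure (sqrt (t - s))) u"
        using st by (simp add: char_normal power_mult_distrib)
      have "(\<lambda>j. CLINT \<omega>|M. iexp (u * ?W j \<omega>)) \<longlonglongrightarrow> (CLINT \<omega>|M. iexp (u * ?Y \<omega>))"
      proof (rule integral_dominated_convergence[where w="\<lambda>_. 1"])
        show "AE \<omega> in M. (\<lambda>j. iexp (u * ?W j \<omega>)) \<longlonglongrightarrow> iexp (u * ?Y \<omega>)"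
          using st by (intro AE_I2 tendsto_intros lim) auto
      qed auto
      then show "(\<lambda>j. char (distr M borel (?W j)) u) \<longlonglongrightarrow> char (distr M borel ?Y) u"
        unfolding char_def by (simp add: integral_distr)
    qed
    then have "distr M borel ?Y = distr (normal_measure (sqrt (t - s))) borel (\<lambda>x. x)"
    proof (intro Levy_uniqueness)
      show "real_distribution (distr M borel ?Y)" by (rule real_distribution_distr) simp
      show "real_distribution (distr (normal_measure (sqrt (t - s))) borel (\<lambda>x. x))"
        using st by (intro prob_space.real_distribution_distr prob_space_normal_density) auto
      assume "\<And>u. char (distr M borel ?Y) u = char (normal_measure (sqrt (t - s))) u"
      then show "char (distr M borel ?Y) = char (distr (normal_measure (sqrt (t - s))) borel (\<lambda>x. x))"
        by (simp add: fun_eq_iff) (simp add: char_def integral_distr)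
    qed
    moreover have "distr M lborel ?Y = distr M borel ?Y" by (intro distr_cong) auto
    moreover have "distr (normal_measure (sqrt (t - s))) borel (\<lambda>x. x) = normal_measure (sqrt (t - s))"
      by (rule distr_id2) simp
    ultimately show ?thesis by (simp add: distributed_def)
  qed
  have indep: "indep_vars (\<lambda>_. borel) (\<lambda>k \<omega>. levy_path (Z \<omega>) (t (Suc k)) - levy_path (Z \<omega>) (t k)) {..<n}"
    if t: "0 \<le> t 0" "incseq t" for n t
  proof (rule indep_vars_limit)
    have t0: "0 \<le> t k" for k using t incseqD[of t 0 k] by simp
    have tS: "t k \<le> t (Suc k)" for k using t by (auto simp: incseq_Suc_iff)
    show "(\<lambda>j. dyadic_step (Z \<omega>) (t (Suc k)) j - dyadic_step (Z \<omega>) (t k) j) \<longlonglongrightarrow> levy_path (Z \<omega>) (t (Suc k)) - levy_path (Z \<omega>) (t k)"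
      if "\<omega> \<in> space M" for k \<omega>
      using that t0 by (intro tendsto_diff lim)
    show "indep_vars (\<lambda>_. borel) (\<lambda>k \<omega>. dyadic_step (Z \<omega>) (t (Suc k)) j - dyadic_step (Z \<omega>) (t k) j) {..<n}" for j
    proof -
      have "m j (t k) \<le> m j (t l)" if "k \<le> l" for k l
        using t that by (intro m_mono) (auto dest: incseqD)
      \<comment> \<open>The blocks are half open between consecutive grid indices, so a cell at a
        common end point belongs to one of them only.\<close>
      then have "disjoint_family_on (\<lambda>k. {m j (t k)..<m j (t (Suc k))}) {..<n}"
        unfolding disjoint_family_on_def
        by (intro ballI impI) (rule ccontr, auto, metis Suc_leI leD le_trans less_le_trans linorder_neqE_nat)
      from indep_vars_restrict[OF indD _ this]
      have "indep_vars (\<lambda>k. Pi\<^sub>M {m j (t k)..<m j (t (Suc k))} (\<lambda>_. borel)) (\<lambda>k \<omega>. restrict (\<lambda>i. D j i \<omega>) {m j (t k)..<m j (t (Suc k))}) {..<n}"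
        by simp
      from indep_vars_compose2[OF this, of "\<lambda>k x. \<Sum>i\<in>{m j (t k)..<m j (t (Suc k))}. x i" "\<lambda>_. borel"]
      show ?thesis by (simp add: inc[OF tS])
    qed
  qed simp
  show ?thesis
    unfolding standard_brownian_motion_def
    using continuous_on_levy_path[OF reg] normal indep M by (auto simp: levy_path_0)
qed

section \<open>Jump processes driven by a marked Poisson process\<close>

fun embedded_state :: "('s \<Rightarrow> 'u \<Rightarrow> 's) \<Rightarrow> 's \<Rightarrow> (nat \<Rightarrow> real \<times> 'u) \<Rightarrow> nat \<Rightarrow> 's" where
  "embedded_state f i x 0 = i"
| "embedded_state f i x (Suc k) = f (embedded_state f i x k) (snd (x k))"

definition arrival :: "(nat \<Rightarrow> real \<times> 'u) \<Rightarrow> nat \<Rightarrow> real" where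
  "arrival x n = (\<Sum>k<n. fst (x k))"

text \<open>The input as seen from a time \<open>s\<close> inside gap number \<open>n\<close>: the
  residual gap keeps the mark of the interrupted one. The index \<open>n\<close> is an argument, not
  computed from \<open>s\<close>, which allows induction on it.\<close>

definition regenerate :: "nat \<Rightarrow> real \<Rightarrow> (nat \<Rightarrow> real \<times> 'u) \<Rightarrow> nat \<Rightarrow> real \<times> 'u" where
  "regenerate n s x = case_nat (arrival x (Suc n) - s, snd (x n)) (\<lambda>k. x (Suc (n + k)))"

definition proper_arrivals :: "(nat \<Rightarrow> real \<times> 'u) \<Rightarrow> bool" where
  "proper_arrivals x \<longleftrightarrow> (\<forall>k. 0 < fst (x k)) \<and> (\<forall>t. \<exists>n. t < arrival x n)"

definition count_arrivals :: "(nat \<Rightarrow> real \<times> 'u) \<Rightarrow> real \<Rightarrow> nat" where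
  "count_arrivals x t = (LEAST n. t < arrival x (Suc n))"

definition jump_path :: "('s \<Rightarrow> 'u \<Rightarrow> 's) \<Rightarrow> 's \<Rightarrow> (nat \<Rightarrow> real \<times> 'u) \<Rightarrow> real \<Rightarrow> 's" where
  "jump_path f i x t = embedded_state f i x (count_arrivals x t)"

text \<open>A relational form of the jump path without the least index: it is plainly measurable and
  suits induction, and it agrees with \<open>jump_path\<close> for proper inputs at nonnegative
  times.\<close>

definition visits :: "('s \<Rightarrow> 'u \<Rightarrow> 's) \<Rightarrow> 's \<Rightarrow> (nat \<Rightarrow> real \<times> 'u) \<Rightarrow> real \<Rightarrow> 's \<Rightarrow> bool" where
  "visits f i x t a \<longleftrightarrow> (\<exists>m. arrival x m \<le> t \<and> t < arrival x (Suc m) \<and> embedded_state f i x m = a)"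

lemma embedded_state_case_nat:
  "embedded_state f i (case_nat z y) (Suc n) = embedded_state f (f i (snd z)) y n"
  by (induction n) auto

lemma arrival_0 [simp]: "arrival x 0 = 0"
  by (simp add: arrival_def)

lemma arrival_Suc: "arrival x (Suc n) = arrival x n + fst (x n)"
  by (simp add: arrival_def)

lemma arrival_case_nat: "arrival (case_nat z y) (Suc n) = fst z + arrival y n"
  by (induction n) (auto simp: arrival_Suc)

text \<open>Removing the first gap lowers the gap index and the time together; this drives the
  induction over the number of arrivals.\<close>

lemma regenerate_case_nat: "regenerate (Suc n) s (case_nat z y) = regenerate n (s - fst z) y"
  by (auto simp: regenerate_def arrival_case_nat fun_eq_iff split: nat.split)

lemma arrival_regenerate: "arrival (regenerate m s x) (Suc k) = arrival x (Suc (m + k)) - s"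
  unfolding regenerate_def arrival_case_nat
  by (induction k) (auto simp: arrival_Suc)

lemma embedded_state_regenerate:
  "embedded_state f (embedded_state f i x m) (regenerate m s x) k = embedded_state f i x (m + k)"
proof (induction k)
  case (Suc k)
  have "snd (regenerate m s x k) = snd (x (m + k))"
    by (cases k) (auto simp: regenerate_def)
  with Suc show ?case by simp
qed simp

lemma strict_mono_arrival:
  assumes "\<And>k. 0 < fst (x k)"
  shows "strict_mono (arrival x)"
  by (rule strict_monoI_Suc) (use assms in \<open>simp add: arrival_Suc\<close>)

lemma arrival_interval_unique:
  assumes "\<And>k. 0 < fst (x k)"
    and "arrival x m \<le> t" "t < arrival x (Suc m)" "arrival x n \<le> t" "t < arrival x (Suc n)"
  shows "m = n"
proof -
  have "arrival x m < arrival x (Suc n)" "arrival x n < arrival x (Suc m)" using assms by auto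
  then have "m < Suc n" "n < Suc m"
    using strict_mono_less[OF strict_mono_arrival[of x]] assms(1) by blast+
  then show ?thesis by simp
qed

lemma count_arrivals_bounds:
  assumes "proper_arrivals x" "0 \<le> t"
  shows "arrival x (count_arrivals x t) \<le> t" "t < arrival x (Suc (count_arrivals x t))"
proof -
  obtain n where n: "t < arrival x n" using assms by (auto simp: proper_arrivals_def)
  then have "n \<noteq> 0" using assms(2) by (intro notI) simp
  then obtain k where "t < arrival x (Suc k)" using n by (cases n) auto
  then show "t < arrival x (Suc (count_arrivals x t))"
    unfolding count_arrivals_def by (rule LeastI)
  show "arrival x (count_arrivals x t) \<le> t"
  proof (cases "count_arrivals x t")
    case (Suc k)
    then have "k < count_arrivals x t" by simp
    then have "\<not> t < arrival x (Suc k)"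
      unfolding count_arrivals_def by (rule not_less_Least)
    with Suc show ?thesis by simp
  qed (use assms in simp)
qed

lemma count_arrivals_eq:
  assumes "proper_arrivals x" "arrival x m \<le> t" "t < arrival x (Suc m)"
  shows "count_arrivals x t = m"
proof -
  have "mono (arrival x)"
    using assms(1) strict_mono_arrival[of x] strict_mono_mono by (auto simp: proper_arrivals_def)
  then have "arrival x 0 \<le> arrival x m" by (auto dest: monoD)
  with assms have "0 \<le> t" by simp
  from arrival_interval_unique[OF _ count_arrivals_bounds[OF assms(1) this] assms(2,3)] assms(1)
  show ?thesis by (auto simp: proper_arrivals_def)
qed

lemma visits_iff:
  assumes "proper_arrivals x" "0 \<le> t"
  shows "visits f i x t a \<longleftrightarrow> jump_path f i x t = a"
proof
  assume "visits f i x t a"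
  then show "jump_path f i x t = a"
    unfolding visits_def jump_path_def using count_arrivals_eq[OF assms(1)] by metis
next
  assume "jump_path f i x t = a"
  then show "visits f i x t a"
    unfolding visits_def jump_path_def using count_arrivals_bounds[OF assms] by blast
qed

text \<open>From time \<open>s\<close> on, the past matters only through the current state and the
  residual input. Positive gaps ensure that the interval containing \<open>t\<close> has index at
  least \<open>m\<close>, so the index can be written \<open>m + k\<close>.\<close>

lemma visits_regenerate:
  assumes "\<And>k. 0 < fst (x k)" and m: "arrival x m \<le> s" "s < arrival x (Suc m)" and "s \<le> t"
  shows "visits f i x t a \<longleftrightarrow> visits f (embedded_state f i x m) (regenerate m s x) (t - s) a"
proof -
  have arr: "arrival (regenerate m s x) k \<le> t - s \<longleftrightarrow> arrival x (m + k) \<le> t" for k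
    using m \<open>s \<le> t\<close> by (cases k) (auto simp: arrival_regenerate)
  have "m \<le> m'" if "t < arrival x (Suc m')" for m'
  proof -
    have "arrival x m < arrival x (Suc m')" using m \<open>s \<le> t\<close> that by linarith
    then show ?thesis using strict_mono_less[OF strict_mono_arrival[of x]] assms(1) by auto
  qed
  then have "visits f i x t a \<longleftrightarrow> (\<exists>k. arrival x (m + k) \<le> t \<and> t < arrival x (Suc (m + k)) \<and> embedded_state f i x (m + k) = a)"
    unfolding visits_def by (metis le_Suc_ex)
  also have "\<dots> \<longleftrightarrow> visits f (embedded_state f i x m) (regenerate m s x) (t - s) a"
    unfolding visits_def embedded_state_regenerate arr arrival_regenerate by simp
  finally show ?thesis .
qed

text \<open>A chain that jumps at the arrivals of a Poisson process of rate \<open>\<Lambda>\<close>, each time applying the random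
  map \<open>\<lambda>i. f i u\<close> whose mark \<open>u\<close> has law \<open>U\<close>.\<close>

locale uniformized_chain =
  fixes \<Lambda> :: real and U :: "'u measure" and f :: "'s::finite \<Rightarrow> 'u \<Rightarrow> 's" and P Q :: "real ^ 's ^ 's"
  assumes rate_pos: "0 < \<Lambda>" and prob_space_marks: "prob_space U"
    and f_measurable [measurable]: "\<And>i. f i \<in> measurable U (count_space UNIV)"
    and P_eq: "\<And>i j. P $ i $ j = measure U {u \<in> space U. f i u = j}"
    and Q_eq: "\<And>i j. Q $ i $ j = \<Lambda> * (P $ i $ j - (if i = j then 1 else 0))"
begin

abbreviation "E \<equiv> density lborel (exponential_density \<Lambda>)"
abbreviation "N \<equiv> E \<Otimes>\<^sub>M U"
abbreviation "S \<equiv> seq_measure N"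

sublocale U: prob_space U by (rule prob_space_marks)
sublocale E: prob_space E by (rule prob_space_exponential_density[OF rate_pos])
sublocale EU: pair_prob_space E U ..
sublocale S: prob_space S by (rule prob_space_seq_measure) (rule EU.prob_space_axioms)
sublocale NS: pair_prob_space N S ..

lemma measurable_arrival [measurable]: "(\<lambda>x. arrival x n) \<in> borel_measurable S"
  unfolding arrival_def by measurable

lemma measurable_embedded_state [measurable]: "(\<lambda>x. embedded_state f i x n) \<in> measurable S (count_space UNIV)"
proof (induction n)
  case (Suc n)
  note [measurable] = Suc
  have [measurable]: "(\<lambda>x. f j (snd (x n))) \<in> measurable S (count_space UNIV)" for j
    by (rule measurable_compose[OF _ f_measurable]) measurable
  show ?case unfolding embedded_state.simps
    by (rule measurable_compose_countable) auto
qed simp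

lemma measurable_regenerate [measurable]: "regenerate n s \<in> measurable S S"
proof -
  have "(\<lambda>x. case_nat (arrival x (Suc n) - s, snd (x n)) (\<lambda>k. x (Suc (n + k)))) \<in> measurable S S"
  proof (rule measurable_case_nat')
    show "(\<lambda>x k. x (Suc (n + k))) \<in> measurable S S"
      by (rule measurable_PiM_single') (auto simp: space_PiM)
  qed measurable
  then show ?thesis by (simp add: regenerate_def[abs_def])
qed

lemma pred_visits [measurable]: "Measurable.pred S (\<lambda>x. visits f i x t a)"
  unfolding visits_def by measurable

section \<open>Regeneration of the driving Poisson process at a fixed time\<close>

text \<open>The sequence measure is the law of a first entry put in front of an independent fresh
  sequence. This first-step decomposition takes the place of conditioning.\<close>

lemma nn_integral_S_iter:
  assumes [measurable]: "F \<in> borel_measurable S"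
  shows "(\<integral>\<^sup>+ x. F x \<partial>S) = (\<integral>\<^sup>+ e. exponential_density \<Lambda> e * (\<integral>\<^sup>+ u. \<integral>\<^sup>+ y. F (case_nat (e, u) y) \<partial>S \<partial>U) \<partial>lborel)"
proof -
  have sequence_space: "sequence_space N"
    by (simp add: sequence_space_def product_prob_space_const EU.prob_space_axioms)
  have [measurable]: "(\<lambda>z. case_nat (fst z) (snd z)) \<in> measurable (N \<Otimes>\<^sub>M S) S"
    by (rule measurable_case_nat') measurable
  have "(\<integral>\<^sup>+ x. F x \<partial>S) = (\<integral>\<^sup>+ x. F x \<partial>distr (N \<Otimes>\<^sub>M S) S (\<lambda>(s, \<omega>). case_nat s \<omega>))"
    by (subst sequence_space.PiM_iter[OF sequence_space]) simp
  also have "\<dots> = (\<integral>\<^sup>+ z. F (case_nat (fst z) (snd z)) \<partial>(N \<Otimes>\<^sub>M S))"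
    by (subst nn_integral_distr) (auto simp: split_beta')
  also have "\<dots> = (\<integral>\<^sup>+ z. \<integral>\<^sup>+ y. F (case_nat z y) \<partial>S \<partial>N)"
    by (subst S.nn_integral_fst[symmetric]) auto
  also have "\<dots> = (\<integral>\<^sup>+ e. \<integral>\<^sup>+ u. \<integral>\<^sup>+ y. F (case_nat (e, u) y) \<partial>S \<partial>U \<partial>E)"
    by (subst U.nn_integral_fst[symmetric]) auto
  also have "\<dots> = (\<integral>\<^sup>+ e. exponential_density \<Lambda> e * (\<integral>\<^sup>+ u. \<integral>\<^sup>+ y. F (case_nat (e, u) y) \<partial>S \<partial>U) \<partial>lborel)"
    by (subst nn_integral_density) auto
  finally show ?thesis .
qed

text \<open>Vanishing at negative \<open>s\<close> encodes that a first gap longer than the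
  available time leaves no room, so the convolution with the gap density can run over the whole
  line.\<close>

definition poisson :: "nat \<Rightarrow> real \<Rightarrow> real" where
  "poisson n s = (if s < 0 then 0 else exp (- (\<Lambda> * s)) * ((\<Lambda> * s) ^ n / fact n))"

lemma poisson_nonneg: "0 \<le> poisson n s"
  using rate_pos by (auto simp: poisson_def)

lemma measurable_poisson [measurable]: "poisson n \<in> borel_measurable borel"
  unfolding poisson_def by measurable

text \<open>On \<open>[0, s]\<close> the exponential factors of the gap and of the remaining time
  combine to the constant \<open>exp (- (\<Lambda> * s))\<close>, which leaves a polynomial with an
  explicit antiderivative.\<close>

lemma nn_integral_poisson_Suc:
  "(\<integral>\<^sup>+ e. ennreal (exponential_density \<Lambda> e) * ennreal (poisson n (s - e)) \<partial>lborel) = ennreal (poisson (Suc n) s)"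
proof (cases "s < 0")
  case True
  have "(\<integral>\<^sup>+ e. ennreal (exponential_density \<Lambda> e) * ennreal (poisson n (s - e)) \<partial>lborel) = (\<integral>\<^sup>+ e. 0 \<partial>(lborel :: real measure))"
    using True by (intro nn_integral_cong) (auto simp: poisson_def exponential_density_def)
  then show ?thesis using True by (simp add: poisson_def)
next
  case False
  let ?f = "\<lambda>e. \<Lambda> * exp (- (\<Lambda> * s)) * ((\<Lambda> * (s - e)) ^ n / fact n)"
  let ?F = "\<lambda>e. - exp (- (\<Lambda> * s)) * ((\<Lambda> * (s - e)) ^ Suc n / fact (Suc n))"
  have "(\<integral>\<^sup>+ e. ennreal (exponential_density \<Lambda> e) * ennreal (poisson n (s - e)) \<partial>lborel)
     = (\<integral>\<^sup>+ e. ennreal (?f e) * indicator {0..s} e \<partial>lborel)"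
  proof (rule nn_integral_cong)
    fix e :: real
    have "exp (- e * \<Lambda>) * exp (- (\<Lambda> * (s - e))) = exp (- (\<Lambda> * s))"
      by (simp add: mult_exp_exp algebra_simps)
    then show "ennreal (exponential_density \<Lambda> e) * ennreal (poisson n (s - e)) = ennreal (?f e) * indicator {0..s} e"
      using rate_pos by (auto simp: poisson_def exponential_density_def ennreal_mult'[symmetric] indicator_def mult.assoc[symmetric]
          simp del: exp_minus)
  qed
  also have "\<dots> = ennreal (?F s - ?F 0)"
  proof (rule nn_integral_FTC_Icc)
    fix e assume "e \<in> {0..s}"
    have "((\<lambda>e. (\<Lambda> * (s - e)) ^ Suc n / fact (Suc n)) has_real_derivative (- \<Lambda> * ((\<Lambda> * (s - e)) ^ n / fact n))) (at e)"
      by (auto intro!: derivative_eq_intros simp del: power_Suc)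
    from DERIV_cmult[OF this, of "- exp (- (\<Lambda> * s))"]
    show "(?F has_real_derivative ?f e) (at e)" by (simp add: algebra_simps)
    show "0 \<le> ?f e" using rate_pos \<open>e \<in> {0..s}\<close> by auto
  qed (use False in auto)
  also have "?F s - ?F 0 = poisson (Suc n) s"
    using False by (simp add: poisson_def)
  finally show ?thesis .
qed

lemma nn_integral_marks:
  "(\<integral>\<^sup>+ u. ennreal (g (f i u)) \<partial>U) = ennreal (\<Sum>l\<in>UNIV. P $ i $ l * g l)" if g: "\<And>l. 0 \<le> g l"
proof -
  have "(\<integral>\<^sup>+ u. ennreal (g (f i u)) \<partial>U) = (\<integral>\<^sup>+ u. (\<Sum>l\<in>UNIV. ennreal (g l) * indicator {u \<in> space U. f i u = l} u) \<partial>U)"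
    by (intro nn_integral_cong) (auto simp: indicator_def if_distrib cong: if_cong)
  also have "\<dots> = (\<Sum>l\<in>UNIV. ennreal (g l) * emeasure U {u \<in> space U. f i u = l})"
    by (subst nn_integral_sum) (auto simp: nn_integral_cmult)
  also have "\<dots> = (\<Sum>l\<in>UNIV. ennreal (P $ i $ l * g l))"
    by (intro sum.cong refl) (auto simp: P_eq U.emeasure_eq_measure ennreal_mult[symmetric] g mult.commute)
  also have "\<dots> = ennreal (\<Sum>l\<in>UNIV. P $ i $ l * g l)"
    by (rule sum_ennreal) (auto simp: P_eq g)
  finally show ?thesis .
qed

lemma P_nonneg: "0 \<le> P $ i $ j"
  by (simp add: P_eq)

lemma sum_P: "(\<Sum>j\<in>UNIV. P $ i $ j) = 1"
  using nn_integral_marks[of "\<lambda>_. 1" i] by (simp add: U.emeasure_space_1 ennreal_eq_1)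

text \<open>The event behind the Markov property: its measure factorizes into a part about the past,
  given by gap index and state, and the law of the future input.\<close>

definition regen_event :: "'s \<Rightarrow> nat \<Rightarrow> real \<Rightarrow> 's \<Rightarrow> (nat \<Rightarrow> real \<times> 'u) set \<Rightarrow> (nat \<Rightarrow> real \<times> 'u) set" where
  "regen_event i n s j A = {x \<in> space S. arrival x n \<le> s \<and> s < arrival x (Suc n) \<and>
     embedded_state f i x n = j \<and> regenerate n s x \<in> A}"

lemma sets_regen_event [measurable]:
  assumes "A \<in> sets S"
  shows "regen_event i n s j A \<in> sets S"
proof -
  have "regen_event i n s j A = {x \<in> space S. arrival x n \<le> s \<and> s < arrival x (Suc n) \<and> embedded_state f i x n = j}
      \<inter> (regenerate n s -` A \<inter> space S)"
    by (auto simp: regen_event_def)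
  moreover have "{x \<in> space S. arrival x n \<le> s \<and> s < arrival x (Suc n) \<and> embedded_state f i x n = j} \<in> sets S"
    by measurable
  ultimately show ?thesis
    using measurable_sets[OF measurable_regenerate assms] by auto
qed

lemma space_S_case_nat: "z \<in> space N \<Longrightarrow> y \<in> space S \<Longrightarrow> case_nat z y \<in> space S"
  by (auto simp: space_PiM PiE_iff split: nat.split)

text \<open>At a fixed time \<open>s\<close> the sequence of residual gap and later gaps is distributed as the
  original one and independent of the past, by memorylessness of the first gap and induction on the
  number of arrivals.\<close>

lemma emeasure_regen_event:
  assumes A [measurable]: "A \<in> sets S"
  shows "emeasure S (regen_event i n s j A) = ennreal (poisson n s * mpow P n $ i $ j) * emeasure S A"
proof (induction n arbitrary: i s)
  case 0
  show ?case
  proof (cases "0 \<le> s \<and> i = j")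
    case False
    then have "regen_event i 0 s j A = {}" by (auto simp: regen_event_def)
    with False show ?thesis by (auto simp: poisson_def mpow_0)
  next
    case True
    define G where "G e = (\<integral>\<^sup>+ u. \<integral>\<^sup>+ y. indicator A (case_nat (e, u) y) \<partial>S \<partial>U)" for e
    have cm [measurable]: "(\<lambda>z. case_nat (fst (fst z), snd (fst z)) (snd z)) \<in> measurable ((borel \<Otimes>\<^sub>M U) \<Otimes>\<^sub>M S) S"
      by (rule measurable_case_nat') measurable
    have [measurable]: "(\<lambda>z. indicator A (case_nat (fst (fst z), snd (fst z)) (snd z)) :: ennreal) \<in> borel_measurable ((borel \<Otimes>\<^sub>M U) \<Otimes>\<^sub>M S)"
      by (rule measurable_compose[OF cm]) measurable
    have "(\<lambda>z. \<integral>\<^sup>+ y. indicator A (case_nat (fst z, snd z) y) \<partial>S) \<in> borel_measurable (borel \<Otimes>\<^sub>M U)"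
      by (rule S.borel_measurable_nn_integral) (simp add: split_beta')
    then have [measurable]: "G \<in> borel_measurable borel"
      unfolding G_def by (intro U.borel_measurable_nn_integral) (simp add: split_beta')
    have ind: "indicator (regen_event i 0 s j A) (case_nat (e, u) y) = (indicator {s<..} e * indicator A (case_nat (e - s, u) y) :: ennreal)"
      if "u \<in> space U" "y \<in> space S" for e u y
      using True that space_S_case_nat[of "(e, u)" y]
      by (auto simp: regen_event_def regenerate_def arrival_Suc indicator_def space_pair_measure)
    have "emeasure S (regen_event i 0 s j A) = (\<integral>\<^sup>+ x. indicator (regen_event i 0 s j A) x \<partial>S)"
      by simp
    also have "\<dots> = (\<integral>\<^sup>+ e. exponential_density \<Lambda> e * (\<integral>\<^sup>+ u. \<integral>\<^sup>+ y. indicator (regen_event i 0 s j A) (case_nat (e, u) y) \<partial>S \<partial>U) \<partial>lborel)"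
      by (rule nn_integral_S_iter) measurable
    also have "\<dots> = (\<integral>\<^sup>+ e. exponential_density \<Lambda> e * (indicator {s<..} e * G (e - s)) \<partial>lborel)"
    proof (intro nn_integral_cong arg_cong2[where f="(*)"] refl)
      fix e
      have "(\<integral>\<^sup>+ u. \<integral>\<^sup>+ y. indicator (regen_event i 0 s j A) (case_nat (e, u) y) \<partial>S \<partial>U)
         = (\<integral>\<^sup>+ u. \<integral>\<^sup>+ y. indicator {s<..} e * indicator A (case_nat (e - s, u) y) \<partial>S \<partial>U)"
        by (intro nn_integral_cong ind)
      also have "\<dots> = indicator {s<..} e * G (e - s)"
        by (cases "s < e") (auto simp: G_def)
      finally show "(\<integral>\<^sup>+ u. \<integral>\<^sup>+ y. indicator (regen_event i 0 s j A) (case_nat (e, u) y) \<partial>S \<partial>U) = indicator {s<..} e * G (e - s)" .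
    qed
    also have "\<dots> = (\<integral>\<^sup>+ e. ennreal (exponential_density \<Lambda> (s + e)) * (indicator {s<..} (s + e) * G e) \<partial>lborel)"
      by (subst nn_integral_real_affine[where c=1 and t=s]) auto
    also have "\<dots> = (\<integral>\<^sup>+ e. ennreal (exp (- (\<Lambda> * s))) * (ennreal (exponential_density \<Lambda> e) * G e) \<partial>lborel)"
    proof (rule nn_integral_cong_AE)
      \<comment> \<open>At \<open>e = 0\<close> the two sides may differ, since the indicator is
        strict while the density is positive there; a single point is null.\<close>
      have "AE e in lborel. e \<noteq> (0::real)" by (rule AE_lborel_singleton)
      then show "AE e in lborel. ennreal (exponential_density \<Lambda> (s + e)) * (indicator {s<..} (s + e) * G e)
          = ennreal (exp (- (\<Lambda> * s))) * (ennreal (exponential_density \<Lambda> e) * G e)"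
      proof eventually_elim
        case (elim e)
        have "\<Lambda> * exp (- (s + e) * \<Lambda>) = exp (- (\<Lambda> * s)) * (\<Lambda> * exp (- e * \<Lambda>))"
          by (simp add: mult_exp_exp algebra_simps)
        then have "ennreal (\<Lambda> * exp (- (s + e) * \<Lambda>)) = ennreal (exp (- (\<Lambda> * s))) * ennreal (\<Lambda> * exp (- e * \<Lambda>))"
          using rate_pos by (simp add: ennreal_mult'[symmetric] del: exp_minus)
        then show ?case
          using elim True by (auto simp: exponential_density_def indicator_def mult.assoc[symmetric] simp del: exp_minus)
      qed
    qed
    also have "\<dots> = ennreal (exp (- (\<Lambda> * s))) * (\<integral>\<^sup>+ e. ennreal (exponential_density \<Lambda> e) * G e \<partial>lborel)"
      by (rule nn_integral_cmult) measurable
    also have "(\<integral>\<^sup>+ e. ennreal (exponential_density \<Lambda> e) * G e \<partial>lborel) = (\<integral>\<^sup>+ x. indicator A x \<partial>S)"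
      unfolding G_def by (rule nn_integral_S_iter[symmetric]) measurable
    finally show ?thesis using True by (simp add: poisson_def mpow_0)
  qed
next
  case (Suc n)
  have ind: "indicator (regen_event i (Suc n) s j A) (case_nat (e, u) y) = (indicator (regen_event (f i u) n (s - e) j A) y :: ennreal)"
    if "u \<in> space U" "y \<in> space S" for e u y
    using that space_S_case_nat[of "(e, u)" y]
    by (auto simp: regen_event_def indicator_def arrival_case_nat embedded_state_case_nat regenerate_case_nat space_pair_measure
        simp del: embedded_state.simps)
  have "emeasure S (regen_event i (Suc n) s j A) = (\<integral>\<^sup>+ x. indicator (regen_event i (Suc n) s j A) x \<partial>S)"
    by simp
  also have "\<dots> = (\<integral>\<^sup>+ e. exponential_density \<Lambda> e * (\<integral>\<^sup>+ u. \<integral>\<^sup>+ y. indicator (regen_event i (Suc n) s j A) (case_nat (e, u) y) \<partial>S \<partial>U) \<partial>lborel)"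
    by (rule nn_integral_S_iter) measurable
  also have "\<dots> = (\<integral>\<^sup>+ e. ennreal (exponential_density \<Lambda> e) * ennreal (poisson n (s - e)) * (ennreal (mpow P (Suc n) $ i $ j) * emeasure S A) \<partial>lborel)"
  proof (intro nn_integral_cong)
    fix e
    have "(\<integral>\<^sup>+ u. \<integral>\<^sup>+ y. indicator (regen_event i (Suc n) s j A) (case_nat (e, u) y) \<partial>S \<partial>U)
       = (\<integral>\<^sup>+ u. \<integral>\<^sup>+ y. indicator (regen_event (f i u) n (s - e) j A) y \<partial>S \<partial>U)"
      by (intro nn_integral_cong ind)
    also have "\<dots> = (\<integral>\<^sup>+ u. ennreal (mpow P n $ f i u $ j) * (ennreal (poisson n (s - e)) * emeasure S A) \<partial>U)"
      by (simp add: Suc ennreal_mult' poisson_nonneg mult.assoc mult.left_commute)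
    also have "\<dots> = (\<integral>\<^sup>+ u. ennreal (mpow P n $ f i u $ j) \<partial>U) * (ennreal (poisson n (s - e)) * emeasure S A)"
      by (rule nn_integral_multc) measurable
    also have "(\<integral>\<^sup>+ u. ennreal (mpow P n $ f i u $ j) \<partial>U) = ennreal (mpow P (Suc n) $ i $ j)"
      unfolding mpow_Suc by (rule nn_integral_marks) (simp add: mpow_nonneg P_nonneg)
    finally show "ennreal (exponential_density \<Lambda> e) * (\<integral>\<^sup>+ u. \<integral>\<^sup>+ y. indicator (regen_event i (Suc n) s j A) (case_nat (e, u) y) \<partial>S \<partial>U)
      = ennreal (exponential_density \<Lambda> e) * ennreal (poisson n (s - e)) * (ennreal (mpow P (Suc n) $ i $ j) * emeasure S A)"
      by (simp add: ac_simps)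
  qed
  also have "\<dots> = ennreal (poisson (Suc n) s) * (ennreal (mpow P (Suc n) $ i $ j) * emeasure S A)"
    by (subst nn_integral_multc) (auto simp: nn_integral_poisson_Suc)
  finally show ?case
    by (simp add: ennreal_mult' poisson_nonneg mult.assoc)
qed

lemma AE_gaps_pos: "AE x in S. \<forall>k. 0 < fst (x k)"
proof -
  have "AE e in E. 0 < e"
    using AE_lborel_singleton[of 0]
    by (subst AE_density) (auto simp: exponential_density_def split: if_splits)
  then have "AE e in distr N E fst. 0 < e"
    unfolding U.distr_pair_fst .
  then have "AE z in N. 0 < fst z"
    by (rule AE_distrD[rotated]) simp
  then have "AE x in S. 0 < fst (x k)" for k
    by (intro AE_PiM_component EU.prob_space_axioms) auto
  then show ?thesis by (simp add: AE_all_countable)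
qed

text \<open>The arrival intervals are disjoint when all gaps are positive, so countable additivity
  is applied after intersecting with that almost sure event.\<close>

lemma emeasure_UN_arrival_intervals:
  assumes D: "\<And>n. D n \<in> sets S" and sub: "\<And>n x. x \<in> D n \<Longrightarrow> arrival x n \<le> s \<and> s < arrival x (Suc n)"
  shows "emeasure S (\<Union>n. D n) = (\<Sum>n. emeasure S (D n))"
proof -
  let ?G = "{x \<in> space S. \<forall>k. 0 < fst (x k)}"
  have G [measurable]: "?G \<in> sets S" by measurable
  have [measurable]: "D n \<in> sets S" for n by (rule D)
  have "emeasure S (\<Union>n. D n) = emeasure S (\<Union>n. D n \<inter> ?G)"
    using AE_gaps_pos AE_space by (intro emeasure_eq_AE) (auto elim: eventually_elim2)
  also have "\<dots> = (\<Sum>n. emeasure S (D n \<inter> ?G))"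
  proof (rule suminf_emeasure[symmetric])
    show "disjoint_family (\<lambda>n. D n \<inter> ?G)"
      unfolding disjoint_family_on_def using arrival_interval_unique sub by blast
  qed auto
  also have "\<dots> = (\<Sum>n. emeasure S (D n))"
    using AE_gaps_pos AE_space by (intro suminf_cong emeasure_eq_AE) (auto elim: eventually_elim2)
  finally show ?thesis .
qed

lemma transition_matrix_nonneg: "0 \<le> t \<Longrightarrow> 0 \<le> transition_matrix Q t $ i $ j"
  using sums_le[OF _ sums_zero uniformization_sums[OF Q_eq, of t i j]] rate_pos mpow_nonneg[OF P_nonneg] by auto

text \<open>Summing over the number of arrivals turns the Poisson weights and the matrix powers into
  the uniformization series.\<close>

lemma emeasure_UN_regen_event:
  assumes A [measurable]: "A \<in> sets S" and s: "0 \<le> s"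
  shows "emeasure S (\<Union>n. regen_event i n s j A) = ennreal (transition_matrix Q s $ i $ j) * emeasure S A"
proof -
  have "emeasure S (\<Union>n. regen_event i n s j A) = (\<Sum>n. emeasure S (regen_event i n s j A))"
    by (rule emeasure_UN_arrival_intervals[where s=s]) (auto simp: regen_event_def[of i _ s j A, abs_def] intro!: sets_regen_event[unfolded regen_event_def])
  also have "\<dots> = (\<Sum>n. ennreal (poisson n s * mpow P n $ i $ j)) * emeasure S A"
    by (simp add: emeasure_regen_event ennreal_suminf_multc)
  also have "(\<Sum>n. ennreal (poisson n s * mpow P n $ i $ j)) = ennreal (transition_matrix Q s $ i $ j)"
    using uniformization_sums[OF Q_eq, of s i j] s
    by (intro suminf_ennreal_eq) (auto simp: poisson_def mpow_nonneg P_nonneg rate_pos less_imp_le)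
  finally show ?thesis .
qed

text \<open>The Poisson weights over all \<open>n\<close> sum to \<open>1\<close>, so a fixed time
  almost surely lies in some gap; countably many integer times then rule out explosion.\<close>

lemma AE_proper_arrivals: "AE x in S. proper_arrivals x"
proof -
  \<comment> \<open>An arbitrary starting state, present because the measured events also record a
    state; summing over \<open>j\<close> removes that information.\<close>
  define i :: 's where "i = undefined"
  define C where "C n s = {x \<in> space S. arrival x n \<le> s \<and> s < arrival x (Suc n)}" for n s
  have C [measurable]: "C n s \<in> sets S" for n s unfolding C_def by measurable
  have "AE x in S. \<exists>n. real t < arrival x n" for t :: nat
  proof -
    have "emeasure S (C n t) = ennreal (poisson n t)" for n
    proof -
      have "C n t = (\<Union>j. regen_event i n t j (space S))"
        using measurable_space[OF measurable_regenerate] by (auto simp: C_def regen_event_def)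
      also have "emeasure S \<dots> = (\<Sum>j\<in>UNIV. emeasure S (regen_event i n t j (space S)))"
        by (intro sum_emeasure[symmetric]) (auto simp: disjoint_family_on_def regen_event_def intro!: sets_regen_event[unfolded regen_event_def])
      also have "\<dots> = (\<Sum>j\<in>UNIV. ennreal (poisson n t * mpow P n $ i $ j))"
        by (simp add: emeasure_regen_event S.emeasure_space_1)
      also have "\<dots> = ennreal (\<Sum>j\<in>UNIV. poisson n t * mpow P n $ i $ j)"
        by (rule sum_ennreal) (auto simp: poisson_nonneg mpow_nonneg P_nonneg)
      also have "(\<Sum>j\<in>UNIV. poisson n t * mpow P n $ i $ j) = poisson n t"
        by (simp add: sum_distrib_left[symmetric] sum_mpow sum_P)
      finally show ?thesis .
    qed
    moreover have "emeasure S (\<Union>n. C n t) = (\<Sum>n. emeasure S (C n t))"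
      by (rule emeasure_UN_arrival_intervals[OF C, where s=t]) (auto simp: C_def)
    ultimately have "emeasure S (\<Union>n. C n t) = (\<Sum>n. ennreal (poisson n t))"
      by simp
    also have "\<dots> = ennreal (exp (- (\<Lambda> * t)) * exp (\<Lambda> * t))"
    proof (rule suminf_ennreal_eq)
      have "(\<lambda>n. (\<Lambda> * real t) ^ n / fact n) sums exp (\<Lambda> * real t)"
        using exp_converges[of "\<Lambda> * real t"] by (simp add: field_simps)
      from sums_mult[OF this, of "exp (- (\<Lambda> * t))"]
      show "(\<lambda>n. poisson n t) sums (exp (- (\<Lambda> * t)) * exp (\<Lambda> * t))"
        by (simp add: poisson_def)
    qed (rule poisson_nonneg)
    also have "\<dots> = 1" by (simp add: exp_minus)
    finally have "AE x in S. x \<in> (\<Union>n. C n t)"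
      by (intro S.AE_prob_1) (simp add: S.emeasure_eq_measure ennreal_eq_1)
    then show ?thesis by eventually_elim (auto simp: C_def)
  qed
  then have "AE x in S. \<forall>t::nat. \<exists>n. real t < arrival x n"
    by (simp add: AE_all_countable)
  with AE_gaps_pos show ?thesis
  proof eventually_elim
    case (elim x)
    have "\<exists>n. t < arrival x n" for t
      using elim(2) reals_Archimedean2[of t] by (meson less_trans)
    with elim show ?case by (simp add: proper_arrivals_def)
  qed
qed

text \<open>Induction on the number of times: after regeneration at \<open>t 0\<close> the remaining
  times pose the same problem, started from \<open>a 0\<close> and shifted by
  \<open>t 0\<close>.\<close>

lemma emeasure_visits:
  assumes "0 \<le> t 0" "incseq t"
  shows "emeasure S {x \<in> space S. \<forall>k\<le>n. visits f i x (t k) (a k)}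
    = ennreal (transition_matrix Q (t 0) $ i $ a 0 * (\<Prod>k<n. transition_matrix Q (t (Suc k) - t k) $ a k $ a (Suc k)))"
  using assms
proof (induction n arbitrary: i t a)
  case 0
  have "{x \<in> space S. \<forall>k\<le>0. visits f i x (t k) (a k)} = (\<Union>n. regen_event i n (t 0) (a 0) (space S))"
    using measurable_space[OF measurable_regenerate] by (auto simp: visits_def regen_event_def)
  with 0 show ?case by (simp add: emeasure_UN_regen_event S.emeasure_space_1)
next
  case (Suc n)
  define A where "A = {y \<in> space S. \<forall>k\<le>n. visits f (a 0) y (t (Suc k) - t 0) (a (Suc k))}"
  have A [measurable]: "A \<in> sets S" unfolding A_def by measurable
  have t0: "t 0 \<le> t (Suc k)" for k using Suc.prems by (auto dest: incseqD)
  have "emeasure S {x \<in> space S. \<forall>k\<le>Suc n. visits f i x (t k) (a k)} = emeasure S (\<Union>m. regen_event i m (t 0) (a 0) A)"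
  proof (rule emeasure_eq_AE)
    show "AE x in S. (x \<in> {x \<in> space S. \<forall>k\<le>Suc n. visits f i x (t k) (a k)}) = (x \<in> (\<Union>m. regen_event i m (t 0) (a 0) A))"
      using AE_gaps_pos AE_space
    proof eventually_elim
      case (elim x)
      have all: "(\<forall>k\<le>Suc n. visits f i x (t k) (a k)) \<longleftrightarrow> visits f i x (t 0) (a 0) \<and> (\<forall>k\<le>n. visits f i x (t (Suc k)) (a (Suc k)))"
        by (metis Suc_le_mono le0 not0_implies_Suc)
      have "visits f i x (t (Suc k)) b \<longleftrightarrow> visits f (embedded_state f i x m) (regenerate m (t 0) x) (t (Suc k) - t 0) b"
        if "arrival x m \<le> t 0" "t 0 < arrival x (Suc m)" for m k b
        using elim that t0 by (intro visits_regenerate) auto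
      moreover have "regenerate m (t 0) x \<in> space S" for m
        using measurable_space[OF measurable_regenerate elim(2)] .
      ultimately have "x \<in> regen_event i m (t 0) (a 0) A \<longleftrightarrow> arrival x m \<le> t 0 \<and> t 0 < arrival x (Suc m) \<and>
          embedded_state f i x m = a 0 \<and> (\<forall>k\<le>n. visits f i x (t (Suc k)) (a (Suc k)))" for m
        using elim(2) by (auto simp: regen_event_def A_def)
      then show ?case
        using elim(2) unfolding mem_Collect_eq all UN_iff visits_def[of f i x "t 0" "a 0"] by blast
    qed
  qed measurable
  also have "\<dots> = ennreal (transition_matrix Q (t 0) $ i $ a 0) * emeasure S A"
    using Suc.prems by (intro emeasure_UN_regen_event A) auto
  also have "emeasure S A = ennreal (transition_matrix Q (t 1 - t 0) $ a 0 $ a 1 *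
      (\<Prod>k<n. transition_matrix Q (t (Suc (Suc k)) - t (Suc k)) $ a (Suc k) $ a (Suc (Suc k))))"
    using Suc.IH[of "\<lambda>k. t (Suc k) - t 0" "a 0" "\<lambda>k. a (Suc k)"] Suc.prems
    by (simp add: A_def t0 incseq_def)
  also have "transition_matrix Q (t 1 - t 0) $ a 0 $ a 1 *
      (\<Prod>k<n. transition_matrix Q (t (Suc (Suc k)) - t (Suc k)) $ a (Suc k) $ a (Suc (Suc k)))
     = (\<Prod>k<Suc n. transition_matrix Q (t (Suc k) - t k) $ a k $ a (Suc k))"
    by (subst prod.lessThan_Suc_shift) simp
  finally show ?case
    using Suc.prems by (simp add: ennreal_mult' transition_matrix_nonneg)
qed

lemma intensity_matrix: "intensity_matrix Q"
  unfolding intensity_matrix_def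
proof (intro conjI allI impI)
  fix i j :: 's assume "i \<noteq> j"
  then show "0 \<le> Q $ i $ j" using rate_pos P_nonneg by (simp add: Q_eq)
next
  fix i
  have "(\<Sum>j\<in>UNIV. Q $ i $ j) = \<Lambda> * ((\<Sum>j\<in>UNIV. P $ i $ j) - (\<Sum>j\<in>UNIV. if i = j then 1 else 0))"
    unfolding Q_eq sum_distrib_left[symmetric] sum_subtractf by simp
  then show "(\<Sum>j\<in>UNIV. Q $ i $ j) = 0" by (simp add: sum_P)
qed

lemma eventually_at_right_jump_path:
  assumes x: "proper_arrivals x" and t: "0 \<le> t"
  shows "eventually (\<lambda>s. jump_path f i x s = jump_path f i x t) (at_right t)"
  unfolding eventually_at_right_field
proof (intro exI[of _ "arrival x (Suc (count_arrivals x t))"] conjI allI impI)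
  show "t < arrival x (Suc (count_arrivals x t))" using count_arrivals_bounds[OF x t] by simp
  fix s assume "t < s" "s < arrival x (Suc (count_arrivals x t))"
  then have "count_arrivals x s = count_arrivals x t"
    using count_arrivals_bounds[OF x t] by (intro count_arrivals_eq x) auto
  then show "jump_path f i x s = jump_path f i x t" by (simp add: jump_path_def)
qed

text \<open>The finite-dimensional distributions are products over consecutive times, summed over
  the initial state. One more time contributes one more transition factor, which is the
  multiplied-out Markov property.\<close>

theorem markov_jump_process_jump_path:
  assumes M: "prob_space M" and X: "iid M N X" and proper: "\<And>\<omega>. \<omega> \<in> space M \<Longrightarrow> proper_arrivals (X \<omega>)"
    and I: "I \<in> measurable M (count_space UNIV)" and p: "\<And>i. measure M {\<omega> \<in> space M. I \<omega> = i} = pmf p i"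
    and ind: "independent_pair M (count_space UNIV) I S X"
  shows "markov_jump_process M p Q (\<lambda>t \<omega>. jump_path f (I \<omega>) (X \<omega>) t)"
proof -
  interpret M: prob_space M by fact
  note [measurable] = I iid_measurable[OF X]
  have vis: "{\<omega> \<in> space M. jump_path f (I \<omega>) (X \<omega>) t = a} = (\<Union>i. {\<omega> \<in> space M. I \<omega> = i} \<inter> (X -` {x \<in> space S. visits f i x t a} \<inter> space M))"
    if "0 \<le> t" for t a
    using measurable_space[OF iid_measurable[OF X]] by (auto simp: visits_iff[OF proper that])
  have meas: "(\<lambda>\<omega>. jump_path f (I \<omega>) (X \<omega>) t) \<in> measurable M (count_space UNIV)" if "0 \<le> t" for t
  proof (rule measurable_count_space_eq2_countable[THEN iffD2])
    have "(\<lambda>\<omega>. jump_path f (I \<omega>) (X \<omega>) t) -` {a} \<inter> space M \<in> sets M" for a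
    proof -
      have "(\<lambda>\<omega>. jump_path f (I \<omega>) (X \<omega>) t) -` {a} \<inter> space M = {\<omega> \<in> space M. jump_path f (I \<omega>) (X \<omega>) t = a}"
        by auto
      also have "\<dots> \<in> sets M"
        unfolding vis[OF that] by (intro sets.finite_UN sets.Int measurable_sets[OF iid_measurable[OF X]]; measurable)
      finally show ?thesis .
    qed
    then show "(\<lambda>\<omega>. jump_path f (I \<omega>) (X \<omega>) t) \<in> space M \<rightarrow> UNIV \<and>
      (\<forall>a\<in>UNIV. (\<lambda>\<omega>. jump_path f (I \<omega>) (X \<omega>) t) -` {a} \<inter> space M \<in> sets M)" by simp
  qed
  have fdd: "measure M {\<omega> \<in> space M. \<forall>k\<le>n. jump_path f (I \<omega>) (X \<omega>) (t k) = a k}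
     = (\<Sum>i\<in>UNIV. pmf p i * transition_matrix Q (t 0) $ i $ a 0) * (\<Prod>k<n. transition_matrix Q (t (Suc k) - t k) $ a k $ a (Suc k))"
    (is "_ = _ * ?pr") if t: "0 \<le> t 0" "incseq t" for n and t :: "nat \<Rightarrow> real" and a
  proof -
    have tk: "0 \<le> t k" for k using t incseqD[of t 0 k] by simp
    have pr: "0 \<le> ?pr"
      using t by (intro prod_nonneg transition_matrix_nonneg) (auto simp: incseq_Suc_iff)
    define V where "V i = {x \<in> space S. \<forall>k\<le>n. visits f i x (t k) (a k)}" for i
    have V: "V i \<in> sets S" for i unfolding V_def by measurable
    have mV: "measure M (X -` V i \<inter> space M) = transition_matrix Q (t 0) $ i $ a 0 * ?pr" for i
    proof -
      have "emeasure M (X -` V i \<inter> space M) = emeasure S (V i)"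
        using iid_emeasure[OF X V[of i]] by (simp add: vimage_def Int_def conj_commute)
      also have "\<dots> = ennreal (transition_matrix Q (t 0) $ i $ a 0 * ?pr)"
        unfolding V_def by (rule emeasure_visits[OF t])
      finally show ?thesis
        using pr t transition_matrix_nonneg by (simp add: measure_def)
    qed
    have "{\<omega> \<in> space M. \<forall>k\<le>n. jump_path f (I \<omega>) (X \<omega>) (t k) = a k}
       = (\<Union>i. {\<omega> \<in> space M. I \<omega> \<in> {i} \<and> X \<omega> \<in> V i})"
      using measurable_space[OF iid_measurable[OF X]]
      by (auto simp: V_def visits_iff[OF proper tk])
    also have "measure M \<dots> = (\<Sum>i\<in>UNIV. measure M {\<omega> \<in> space M. I \<omega> \<in> {i} \<and> X \<omega> \<in> V i})"
    proof (rule M.finite_measure_finite_Union)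
      have "{\<omega> \<in> space M. I \<omega> \<in> {i} \<and> X \<omega> \<in> V i} = {\<omega> \<in> space M. I \<omega> = i} \<inter> (X -` V i \<inter> space M)" for i
        by auto
      then show "(\<lambda>i. {\<omega> \<in> space M. I \<omega> \<in> {i} \<and> X \<omega> \<in> V i}) ` UNIV \<subseteq> sets M"
        using measurable_sets[OF iid_measurable[OF X] V] by auto
    qed (auto simp: disjoint_family_on_def)
    also have "\<dots> = (\<Sum>i\<in>UNIV. measure M {\<omega> \<in> space M. I \<omega> \<in> {i}} * measure M {\<omega> \<in> space M. X \<omega> \<in> V i})"
      by (intro sum.cong refl independent_pairD[OF ind]) (auto simp: V)
    also have "\<dots> = (\<Sum>i\<in>UNIV. pmf p i * (transition_matrix Q (t 0) $ i $ a 0 * ?pr))"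
      using p using mV by (intro sum.cong refl) (simp add: vimage_def Int_def conj_commute)
    finally show ?thesis by (simp add: sum_distrib_right mult.assoc)
  qed
  show ?thesis
    unfolding markov_jump_process_def
  proof (intro conjI allI impI ballI M intensity_matrix meas)
    fix \<omega> t assume "\<omega> \<in> space M" "0 \<le> (t::real)"
    then show "limitin (discrete_topology UNIV) (\<lambda>s. jump_path f (I \<omega>) (X \<omega>) s) (jump_path f (I \<omega>) (X \<omega>) t) (at_right t)"
      using eventually_at_right_jump_path[OF proper, of \<omega> t "I \<omega>"]
      by (auto simp: limitin_def elim: eventually_mono)
  next
    fix i
    have "jump_path f (I \<omega>) (X \<omega>) 0 = I \<omega>" if "\<omega> \<in> space M" for \<omega>
    proof -
      have "count_arrivals (X \<omega>) 0 = 0"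
        using proper[OF that] by (intro count_arrivals_eq) (auto simp: arrival_Suc proper_arrivals_def)
      then show ?thesis by (simp add: jump_path_def)
    qed
    then have "{\<omega> \<in> space M. jump_path f (I \<omega>) (X \<omega>) 0 = i} = {\<omega> \<in> space M. I \<omega> = i}" by auto
    then show "measure M {\<omega> \<in> space M. jump_path f (I \<omega>) (X \<omega>) 0 = i} = pmf p i" using p by simp
  next
    fix n and t :: "nat \<Rightarrow> real" and a :: "nat \<Rightarrow> 's" assume t: "0 \<le> t 0 \<and> incseq t"
    then show "measure M {\<omega> \<in> space M. \<forall>k\<le>Suc n. jump_path f (I \<omega>) (X \<omega>) (t k) = a k}
      = measure M {\<omega> \<in> space M. \<forall>k\<le>n. jump_path f (I \<omega>) (X \<omega>) (t k) = a k} * transition_matrix Q (t (Suc n) - t n) $ a n $ a (Suc n)"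
      by (simp add: fdd mult.assoc)
  qed
qed

end

text \<open>The marks code the random map \<open>'s \<Rightarrow> 's\<close> applied at an arrival.\<close>

lemma exists_uniformized_chain:
  fixes Q :: "real ^ 's::finite ^ 's"
  assumes Q: "intensity_matrix Q"
  obtains \<Lambda> :: real and U :: "real measure" and f P where "uniformized_chain \<Lambda> U f P Q" "sets U = sets borel"
proof -
  \<comment> \<open>The sum dominates every exit rate, which makes the diagonal of \<open>P\<close>
    nonnegative; the summand \<open>1\<close> keeps the rate positive even for
    \<open>Q = 0\<close>.\<close>
  define \<Lambda> where "\<Lambda> = 1 + (\<Sum>i\<in>UNIV. \<bar>Q $ i $ i\<bar>)"
  have \<Lambda>: "0 < \<Lambda>" by (auto simp: \<Lambda>_def intro!: add_pos_nonneg sum_nonneg)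
  define P :: "real ^ 's ^ 's" where "P = (\<chi> i j. (if i = j then 1 else 0) + Q $ i $ j / \<Lambda>)"
  have Pn: "0 \<le> P $ i $ j" for i j
  proof (cases "i = j")
    case True
    have "\<bar>Q $ i $ i\<bar> \<le> (\<Sum>i\<in>UNIV. \<bar>Q $ i $ i\<bar>)" by (rule member_le_sum) auto
    then have "- \<Lambda> \<le> Q $ i $ i" by (simp add: \<Lambda>_def)
    then show ?thesis using True \<Lambda> by (simp add: P_def field_simps)
  next
    case False
    then show ?thesis using Q \<Lambda> by (simp add: P_def intensity_matrix_def)
  qed
  have P1: "(\<Sum>j\<in>UNIV. P $ i $ j) = 1" for i
    using Q by (simp add: P_def sum.distrib sum_divide_distrib[symmetric] intensity_matrix_def)
  define pm where "pm i = embed_pmf (\<lambda>j. P $ i $ j)" for i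
  have pm: "pmf (pm i) j = P $ i $ j" for i j
    unfolding pm_def by (rule pmf_embed_pmf) (auto simp: Pn nn_integral_count_space_finite sum_ennreal P1)
  \<comment> \<open>A random map with independent values drawn from the rows of \<open>P\<close>;
    only its one-point marginals matter. It is then coded as a real number, so that all coordinates
    of the sample space are real.\<close>
  define F where "F = Pi_pmf UNIV undefined pm"
  define U where "U = distr (measure_pmf F) borel (\<lambda>g. real (to_nat g))"
  define f :: "'s \<Rightarrow> real \<Rightarrow> 's" where "f i u = from_nat (nat \<lfloor>u\<rfloor>) i" for i u
  have fm: "f i \<in> measurable borel (count_space UNIV)" for i
  proof -
    have "(\<lambda>u::real. nat \<lfloor>u\<rfloor>) \<in> measurable borel (count_space UNIV)" by measurable
    from measurable_compose[OF this, of "\<lambda>n. (from_nat n :: 's \<Rightarrow> 's) i"] show ?thesis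
      by (simp add: f_def[abs_def])
  qed
  have f: "f i \<in> measurable U (count_space UNIV)" for i using fm by (simp add: U_def)
  have P: "P $ i $ j = measure U {u \<in> space U. f i u = j}" for i j
  proof -
    have "f i -` {j} \<inter> space borel \<in> sets borel" using measurable_sets[OF fm, of "{j}"] by simp
    then have "measure U {u \<in> space U. f i u = j} = measure_pmf.prob F {g. g i = j}"
      unfolding U_def by (subst measure_distr) (auto simp: f_def vimage_def)
    also have "\<dots> = pmf (map_pmf (\<lambda>g. g i) F) j"
      by (simp add: pmf_map vimage_def)
    also have "\<dots> = P $ i $ j" by (simp add: F_def Pi_pmf_component pm)
    finally show ?thesis by simp
  qed
  have Q_eq: "Q $ i $ j = \<Lambda> * (P $ i $ j - (if i = j then 1 else 0))" for i j
    using \<Lambda> by (simp add: P_def)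
  have "prob_space U"
    unfolding U_def by (rule prob_space.prob_space_distr) (auto intro: prob_space_measure_pmf)
  then have "uniformized_chain \<Lambda> U f P Q"
    using \<Lambda> f P by (intro uniformized_chain.intro Q_eq)
  moreover have "sets U = sets borel" by (simp add: U_def)
  ultimately show ?thesis using that by blast
qed

section \<open>Brownian motion at Poisson times\<close>

abbreviation exponential_measure :: "real \<Rightarrow> real measure" where
  "exponential_measure c \<equiv> density lborel (exponential_density c)"

definition laplace_density :: "real \<Rightarrow> real \<Rightarrow> real" where
  "laplace_density c x = c / 2 * exp (- (c * \<bar>x\<bar>))"

abbreviation laplace_measure :: "real \<Rightarrow> real measure" where
  "laplace_measure c \<equiv> density lborel (laplace_density c)"

lemma measurable_laplace_density [measurable]: "laplace_density c \<in> borel_measurable borel"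
  unfolding laplace_density_def by measurable

lemma laplace_density_nonneg: "0 < c \<Longrightarrow> 0 \<le> laplace_density c x"
  by (simp add: laplace_density_def)

text \<open>With \<open>l = x - y\<close> and \<open>m = min x y\<close> one has
  \<open>x + y = \<bar>l\<bar> + 2 * m\<close>, and \<open>c * c = c / 2 * (2 * c)\<close>. Hence
  the joint density is a product, and the substitution preserves area.\<close>

lemma nn_integral_difference_min:
  fixes F :: "real \<Rightarrow> real \<Rightarrow> ennreal"
  assumes c: "0 < c" and F [measurable]: "case_prod F \<in> borel_measurable (borel \<Otimes>\<^sub>M borel)"
  shows "(\<integral>\<^sup>+ y. \<integral>\<^sup>+ x. ennreal (exponential_density c x * exponential_density c y) * F (x - y) (min x y) \<partial>lborel \<partial>lborel)
    = (\<integral>\<^sup>+ l. \<integral>\<^sup>+ m. ennreal (laplace_density c l * exponential_density (2 * c) m) * F l m \<partial>lborel \<partial>lborel)"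
proof -
  let ?e = "exponential_density c"
  have "(\<integral>\<^sup>+ y. \<integral>\<^sup>+ x. ennreal (?e x * ?e y) * F (x - y) (min x y) \<partial>lborel \<partial>lborel)
     = (\<integral>\<^sup>+ y. \<integral>\<^sup>+ l. ennreal (?e (y + l) * ?e y) * F l (min (y + l) y) \<partial>lborel \<partial>lborel)"
  proof (rule nn_integral_cong)
    fix y :: real
    have "(\<integral>\<^sup>+ x. ennreal (?e x * ?e y) * F (x - y) (min x y) \<partial>lborel)
       = ennreal \<bar>1\<bar> * (\<integral>\<^sup>+ l. ennreal (?e (y + 1 * l) * ?e y) * F (y + 1 * l - y) (min (y + 1 * l) y) \<partial>lborel)"
      by (rule nn_integral_real_affine) auto
    then show "(\<integral>\<^sup>+ x. ennreal (?e x * ?e y) * F (x - y) (min x y) \<partial>lborel)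
       = (\<integral>\<^sup>+ l. ennreal (?e (y + l) * ?e y) * F l (min (y + l) y) \<partial>lborel)" by simp
  qed
  also have "\<dots> = (\<integral>\<^sup>+ l. \<integral>\<^sup>+ y. ennreal (?e (y + l) * ?e y) * F l (min (y + l) y) \<partial>lborel \<partial>lborel)"
    by (rule lborel_pair.Fubini') simp
  also have "\<dots> = (\<integral>\<^sup>+ l. \<integral>\<^sup>+ m. ennreal (laplace_density c l * exponential_density (2 * c) m) * F l m \<partial>lborel \<partial>lborel)"
  proof (rule nn_integral_cong)
    fix l :: real
    have *: "ennreal (?e (y + l) * ?e y) = ennreal (laplace_density c l * exponential_density (2 * c) (min (y + l) y))" for y
    proof -
      have "\<bar>l\<bar> + 2 * min (y + l) y = (y + l) + y" by (simp add: min_def)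
      then have "c * \<bar>l\<bar> + min (y + l) y * (2 * c) = (y + l) * c + y * c" by (simp add: algebra_simps) (smt (verit) distrib_left)
      then have "exp (- (c * \<bar>l\<bar>)) * exp (- min (y + l) y * (2 * c)) = exp (- (y + l) * c) * exp (- y * c)"
        by (simp only: mult_exp_exp) (simp add: algebra_simps)
      then show ?thesis
        by (auto simp: exponential_density_def laplace_density_def min_def mult_ac split: if_splits)
    qed
    have "(\<integral>\<^sup>+ y. ennreal (?e (y + l) * ?e y) * F l (min (y + l) y) \<partial>lborel)
       = (\<integral>\<^sup>+ y. ennreal (laplace_density c l * exponential_density (2 * c) (min (y + l) y)) * F l (min (y + l) y) \<partial>lborel)"
      unfolding * ..
    also have "\<dots> = (\<integral>\<^sup>+ m. ennreal (laplace_density c l * exponential_density (2 * c) m) * F l m \<partial>lborel)"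
    \<comment> \<open>For \<open>l \<ge> 0\<close> the minimum is \<open>y\<close> itself, otherwise
      it is the translate \<open>y + l\<close>.\<close>
    proof (cases "0 \<le> l")
      case True
      then have "min (y + l) y = y" for y by (simp add: min_def)
      then show ?thesis by simp
    next
      case False
      then have e: "min (y + l) y = l + 1 * y" for y by (simp add: min_def)
      show ?thesis
        unfolding e by (subst (2) nn_integral_real_affine[where c=1 and t=l]) auto
    qed
    finally show "(\<integral>\<^sup>+ y. ennreal (?e (y + l) * ?e y) * F l (min (y + l) y) \<partial>lborel)
      = (\<integral>\<^sup>+ m. ennreal (laplace_density c l * exponential_density (2 * c) m) * F l m \<partial>lborel)" .
  qed
  finally show ?thesis .
qed

lemma nn_integral_exponential_density: "0 < c \<Longrightarrow> (\<integral>\<^sup>+ x. ennreal (exponential_density c x) \<partial>lborel) = 1"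
  using prob_space.emeasure_space_1[OF prob_space_exponential_density[of c]] by (simp add: emeasure_density)

text \<open>The total mass comes from the constant function \<open>1\<close> in the preceding change
  of variables.\<close>

lemma prob_space_laplace:
  assumes c: "0 < c"
  shows "prob_space (laplace_measure c)"
proof
  have "1 = (\<integral>\<^sup>+ y. \<integral>\<^sup>+ x. ennreal (exponential_density c x * exponential_density c y) * 1 \<partial>lborel \<partial>lborel)"
    using c by (simp add: ennreal_mult'' exponential_density_nonneg nn_integral_multc nn_integral_exponential_density)
  also have "\<dots> = (\<integral>\<^sup>+ l. \<integral>\<^sup>+ m. ennreal (laplace_density c l * exponential_density (2 * c) m) * 1 \<partial>lborel \<partial>lborel)"
    by (rule nn_integral_difference_min[OF c]) simp
  also have "\<dots> = (\<integral>\<^sup>+ l. ennreal (laplace_density c l) \<partial>lborel)"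
    using c by (simp add: ennreal_mult'' exponential_density_nonneg nn_integral_cmult nn_integral_exponential_density)
  finally show "emeasure (laplace_measure c) (space (laplace_measure c)) = 1"
    by (simp add: emeasure_density)
qed

lemma distr_difference_min:
  assumes c: "0 < c"
  shows "distr (exponential_measure c \<Otimes>\<^sub>M exponential_measure c) (laplace_measure c \<Otimes>\<^sub>M exponential_measure (2 * c))
      (\<lambda>z. (fst z - snd z, min (fst z) (snd z))) = laplace_measure c \<Otimes>\<^sub>M exponential_measure (2 * c)" (is "distr ?P ?R ?g = _")
proof (rule measure_eqI)
  interpret E: prob_space "exponential_measure c" using c by (rule prob_space_exponential_density)
  interpret E2: prob_space "exponential_measure (2 * c)" using c by (intro prob_space_exponential_density) simp
  interpret L: prob_space "laplace_measure c" using c by (rule prob_space_laplace)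
  interpret EE: pair_prob_space "exponential_measure c" "exponential_measure c" ..
  have setsR: "sets ?R = sets (borel \<Otimes>\<^sub>M borel)" and setsP: "sets ?P = sets (borel \<Otimes>\<^sub>M borel)"
    by (auto intro!: sets_pair_measure_cong)
  have g: "?g \<in> measurable ?P ?R"
    unfolding measurable_cong_sets[OF setsP setsR] by measurable
  fix A assume "A \<in> sets (distr ?P ?R ?g)"
  then have AR: "A \<in> sets ?R" by simp
  then have A [measurable]: "A \<in> sets (borel \<Otimes>\<^sub>M borel)" using setsR by simp
  let ?I = "\<lambda>u v. indicator A (u, v) :: ennreal"
  have mI: "(\<lambda>z. indicator A z :: ennreal) \<in> borel_measurable ?R" using AR by measurable
  have "emeasure (distr ?P ?R ?g) A = (\<integral>\<^sup>+ z. indicator A z \<partial>distr ?P ?R ?g)"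
    using AR by simp
  also have "\<dots> = (\<integral>\<^sup>+ z. indicator A (?g z) \<partial>?P)"
    by (rule nn_integral_distr[OF g]) (use AR in simp)
  also have "\<dots> = (\<integral>\<^sup>+ y. \<integral>\<^sup>+ x. ?I (x - y) (min x y) \<partial>exponential_measure c \<partial>exponential_measure c)"
    using measurable_compose[OF g mI] by (subst EE.nn_integral_snd[symmetric]) auto
  also have "\<dots> = (\<integral>\<^sup>+ y. \<integral>\<^sup>+ x. ennreal (exponential_density c x * exponential_density c y) * ?I (x - y) (min x y) \<partial>lborel \<partial>lborel)"
    using c by (simp add: nn_integral_density nn_integral_cmult[symmetric] ennreal_mult exponential_density_nonneg ac_simps)
  also have "\<dots> = (\<integral>\<^sup>+ l. \<integral>\<^sup>+ m. ennreal (laplace_density c l * exponential_density (2 * c) m) * ?I l m \<partial>lborel \<partial>lborel)"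
    by (rule nn_integral_difference_min[OF c]) simp
  also have "\<dots> = (\<integral>\<^sup>+ l. \<integral>\<^sup>+ m. ?I l m \<partial>exponential_measure (2 * c) \<partial>laplace_measure c)"
    using c by (simp add: nn_integral_density nn_integral_cmult[symmetric] ennreal_mult exponential_density_nonneg laplace_density_nonneg ac_simps)
  also have "\<dots> = (\<integral>\<^sup>+ z. indicator A z \<partial>?R)"
    by (subst E2.nn_integral_fst[symmetric]) (use mI in \<open>auto simp: split_beta'\<close>)
  also have "\<dots> = emeasure ?R A"
    using AR by simp
  finally show "emeasure (distr ?P ?R ?g) A = emeasure ?R A" .
qed simp

text \<open>The map undoes the passage to difference and minimum, because
  \<open>max (x - y) 0 + min x y = x\<close>. Pushing the previous identity forward gives the result
  without another integral.\<close>

lemma distr_laplace_split: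
  assumes c: "0 < c"
  shows "distr (laplace_measure c \<Otimes>\<^sub>M exponential_measure (2 * c)) (exponential_measure c \<Otimes>\<^sub>M exponential_measure c)
      (\<lambda>z. (max (fst z) 0 + snd z, max (- fst z) 0 + snd z)) = exponential_measure c \<Otimes>\<^sub>M exponential_measure c" (is "distr ?R ?P ?f = _")
proof -
  let ?g = "\<lambda>z. (fst z - snd z, min (fst z) (snd z)) :: real \<times> real"
  have setsR: "sets ?R = sets (borel \<Otimes>\<^sub>M borel)" and setsP: "sets ?P = sets (borel \<Otimes>\<^sub>M borel)"
    by (auto intro!: sets_pair_measure_cong)
  have g: "?g \<in> measurable ?P ?R"
    unfolding measurable_cong_sets[OF setsP setsR] by measurable
  have f: "?f \<in> measurable ?R ?P"
    unfolding measurable_cong_sets[OF setsR setsP] by measurable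
  have "distr ?R ?P ?f = distr (distr ?P ?R ?g) ?P ?f"
    by (simp add: distr_difference_min[OF c])
  also have "\<dots> = distr ?P ?P (?f \<circ> ?g)"
    by (rule distr_distr[OF f g])
  also have "?f \<circ> ?g = (\<lambda>z. z)"
    by (auto simp: fun_eq_iff min_def max_def)
  finally show ?thesis by (simp add: distr_id2)
qed

lemma distr_difference_exponential:
  assumes c: "0 < c"
  shows "distr (exponential_measure c \<Otimes>\<^sub>M exponential_measure c) borel (\<lambda>z. fst z - snd z) = laplace_measure c"
proof -
  let ?P = "exponential_measure c \<Otimes>\<^sub>M exponential_measure c" and ?R = "laplace_measure c \<Otimes>\<^sub>M exponential_measure (2 * c)"
  let ?g = "\<lambda>z. (fst z - snd z, min (fst z) (snd z)) :: real \<times> real"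
  interpret E2: prob_space "exponential_measure (2 * c)" using c by (intro prob_space_exponential_density) simp
  have setsR: "sets ?R = sets (borel \<Otimes>\<^sub>M borel)" and setsP: "sets ?P = sets (borel \<Otimes>\<^sub>M borel)"
    by (auto intro!: sets_pair_measure_cong)
  have g: "?g \<in> measurable ?P ?R"
    unfolding measurable_cong_sets[OF setsP setsR] by measurable
  have "laplace_measure c = distr ?R (laplace_measure c) fst"
    by (rule E2.distr_pair_fst[symmetric])
  also have "\<dots> = distr (distr ?P ?R ?g) (laplace_measure c) fst"
    by (simp only: distr_difference_min[OF c])
  also have "\<dots> = distr ?P (laplace_measure c) (fst \<circ> ?g)"
    by (rule distr_distr[OF measurable_fst g])
  also have "\<dots> = distr ?P borel (\<lambda>z. fst z - snd z)"
    by (intro distr_cong) auto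
  finally show ?thesis ..
qed

section \<open>The Laplace law as an exponential mixture of normal laws\<close>

lemma char_exponential:
  assumes c: "0 < c"
  shows "char (exponential_measure c) u = c / (c - \<i> * u)"
proof -
  \<comment> \<open>The exponent of the integrand; its real part \<open>- c\<close> makes the
    antiderivative \<open>?F\<close> vanish at infinity.\<close>
  let ?a = "\<i> * complex_of_real u - complex_of_real c"
  have a: "?a \<noteq> 0" using c by (simp add: complex_eq_iff)
  let ?f = "\<lambda>x. complex_of_real c * exp (?a * complex_of_real x)"
  let ?F = "\<lambda>x. complex_of_real c / ?a * exp (?a * complex_of_real x)"
  have f: "exponential_density c x *\<^sub>R iexp (u * x) = ?f x" if "0 < x" for x
  proof -
    have "exp (- (x * c)) *\<^sub>R iexp (u * x) = exp (?a * complex_of_real x)"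
      by (simp add: scaleR_conv_of_real exp_of_real[symmetric] mult_exp_exp algebra_simps)
    then show ?thesis using that
      by (simp add: exponential_density_def scaleR_conv_of_real mult.assoc)
  qed
  interpret E: prob_space "exponential_measure c" using c by (rule prob_space_exponential_density)
  have "integrable (exponential_measure c) (\<lambda>x. iexp (u * x))"
    by (rule E.integrable_const_bound[where B=1]) auto
  then have int: "integrable lborel (\<lambda>x. exponential_density c x *\<^sub>R iexp (u * x))"
    using c by (subst (asm) integrable_density) (auto simp: exponential_density_nonneg)
  have int2: "set_integrable lborel {0<..} ?f"
  proof -
    have "set_integrable lborel {0<..} (\<lambda>x. exponential_density c x *\<^sub>R iexp (u * x))"
      unfolding set_integrable_def by (rule integrable_mult_indicator[OF _ int]) simp
    moreover have "set_integrable lborel {0<..} (\<lambda>x. exponential_density c x *\<^sub>R iexp (u * x)) \<longleftrightarrow> set_integrable lborel {0<..} ?f"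
      by (rule set_integrable_cong[OF refl refl f]) simp
    ultimately show ?thesis by simp
  qed
  have "char (exponential_measure c) u = (CLINT x|lborel. exponential_density c x *\<^sub>R iexp (u * x))"
    using c unfolding char_def by (subst integral_density) (auto simp: exponential_density_nonneg)
  also have "\<dots> = (CLINT x:{0<..}|lborel. ?f x)"
    unfolding set_lebesgue_integral_def
  proof (rule integral_cong_AE)
    have "AE x in lborel. x \<noteq> (0::real)" by (rule AE_lborel_singleton)
    then show "AE x in lborel. exponential_density c x *\<^sub>R iexp (u * x) = indicat_real {0<..} x *\<^sub>R ?f x"
    proof eventually_elim
      case (elim x)
      then show ?case using f[of x] by (cases "0 < x") (auto simp: exponential_density_def)
    qed
  qed auto
  also have "\<dots> = (CLBINT x=0..\<infinity>. ?f x)"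
    by (simp add: interval_lebesgue_integral_def einterval_def zero_ereal_def greaterThan_def)
  also have "\<dots> = 0 - ?F 0"
  proof (rule interval_integral_FTC_integrable)
    show "(?F has_vector_derivative ?f x) (at x)" if "0 < ereal x" "ereal x < \<infinity>" for x
    proof -
      have "((\<lambda>z. complex_of_real c / ?a * exp (?a * z)) has_field_derivative complex_of_real c / ?a * (?a * exp (?a * complex_of_real x))) (at (complex_of_real x))"
        by (auto intro!: derivative_eq_intros)
      from has_vector_derivative_real_field[OF this] show ?thesis using a c by simp
    qed
    show "isCont ?f x" for x by (intro continuous_intros)
    show "set_integrable lborel (einterval 0 \<infinity>) ?f"
      using int2 by (simp add: einterval_def zero_ereal_def greaterThan_def)
    have "isCont ?F 0" by (intro continuous_intros)
    then have "(?F \<longlongrightarrow> ?F 0) (at_right 0)" by (auto simp: isCont_def intro: filterlim_mono at_le)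
    then show "((?F \<circ> real_of_ereal) \<longlongrightarrow> ?F 0) (at_right 0)"
      by (simp add: ereal_tendsto_simps zero_ereal_def)
    have "((\<lambda>x. cmod (complex_of_real c / ?a) * exp (- c * x)) \<longlongrightarrow> 0) at_top"
      using c by real_asymp
    moreover have "norm (?F x) = cmod (complex_of_real c / ?a) * exp (- c * x)" for x
      by (simp add: norm_mult norm_divide norm_exp_eq_Re)
    ultimately have "(?F \<longlongrightarrow> 0) at_top"
      by (intro tendsto_norm_zero_cancel[of ?F]) simp
    then show "((?F \<circ> real_of_ereal) \<longlongrightarrow> 0) (at_left \<infinity>)"
      by (simp add: ereal_tendsto_simps)
  qed (auto)
  also have "0 - ?F 0 = c / (c - \<i> * u)"
    using a by (simp add: field_simps)
  finally show ?thesis .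
qed

text \<open>A Laplace variable is a difference of two independent exponential ones, so the
  exponential characteristic functions at \<open>u\<close> and \<open>- u\<close> are
  multiplied.\<close>

lemma char_laplace:
  assumes c: "0 < c"
  shows "char (laplace_measure c) u = c\<^sup>2 / (c\<^sup>2 + u\<^sup>2)"
proof -
  let ?E = "exponential_measure c"
  interpret E: prob_space ?E using c by (rule prob_space_exponential_density)
  interpret EE: pair_prob_space ?E ?E ..
  have setsP: "sets (?E \<Otimes>\<^sub>M ?E) = sets (borel \<Otimes>\<^sub>M borel)"
    by (auto intro!: sets_pair_measure_cong)
  have m [measurable]: "(\<lambda>z. fst z - snd z) \<in> borel_measurable (?E \<Otimes>\<^sub>M ?E)"
    unfolding measurable_cong_sets[OF setsP refl] by measurable
  have int: "integrable (?E \<Otimes>\<^sub>M ?E) (\<lambda>(x, y). iexp (u * (x - y)))"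
    using m by (intro EE.integrable_const_bound[where B=1]) (auto simp: split_beta')
  have "char (laplace_measure c) u = (CLINT z|?E \<Otimes>\<^sub>M ?E. iexp (u * (fst z - snd z)))"
    unfolding distr_difference_exponential[OF c, symmetric] char_def
    by (subst integral_distr) auto
  also have "\<dots> = (CLINT x|?E. CLINT y|?E. iexp (u * (x - y)))"
    using EE.integral_fst'[OF int] by (simp add: split_beta')
  also have "\<dots> = (CLINT x|?E. CLINT y|?E. iexp (u * x) * iexp (- u * y))"
    by (simp add: mult_exp_exp algebra_simps)
  also have "\<dots> = char ?E u * char ?E (- u)"
    unfolding char_def by simp
  also have "\<dots> = c / (c - \<i> * u) * (c / (c + \<i> * u))"
    by (simp add: char_exponential[OF c])
  also have "\<dots> = complex_of_real (c\<^sup>2) / ((c - \<i> * u) * (c + \<i> * u))"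
    by (simp add: power2_eq_square)
  also have "(c - \<i> * u) * (c + \<i> * u) = complex_of_real (c\<^sup>2 + u\<^sup>2)"
    by (simp add: algebra_simps power2_eq_square)
  finally show ?thesis by simp
qed

lemma distr_normal_scale:
  assumes s: "0 < s"
  shows "distr (normal_measure 1) borel (\<lambda>x. s * x) = normal_measure s"
proof -
  interpret std: prob_space "normal_measure 1" by (rule prob_space_normal_density) simp
  have "distributed (normal_measure 1) lborel (\<lambda>x. x) std_normal_density"
    by (simp add: distributed_def distr_id2)
  from std.normal_density_affine[OF this, of s 0] s
  have "distributed (normal_measure 1) lborel (\<lambda>x. s * x) (normal_density 0 s)" by simp
  then have "distr (normal_measure 1) lborel (\<lambda>x. s * x) = normal_measure s"
    by (simp add: distributed_def)
  moreover have "distr (normal_measure 1) lborel (\<lambda>x. s * x) = distr (normal_measure 1) borel (\<lambda>x. s * x)"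
    by (intro distr_cong) auto
  ultimately show ?thesis by simp
qed

text \<open>Averaging the normal characteristic function \<open>exp (- u^2 s / 2)\<close> over an
  exponential time \<open>s\<close> of rate \<open>c^2 / 2\<close> gives
  \<open>c^2 / (c^2 + u^2)\<close>, the Laplace one. This fixes the rate of the sampling
  times.\<close>

lemma normal_mixture_laplace:
  assumes c: "0 < c" and A [measurable]: "A \<in> sets borel"
  shows "(\<integral>\<^sup>+ s. emeasure (normal_measure 1) {z. sqrt s * z \<in> A} \<partial>exponential_measure (c\<^sup>2 / 2)) = emeasure (laplace_measure c) A"
proof -
  let ?l = "c\<^sup>2 / 2"
  have l: "0 < ?l" using c by simp
  let ?E = "exponential_measure ?l" and ?N = "normal_measure 1"
  interpret E: prob_space ?E using l by (rule prob_space_exponential_density)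
  interpret N: prob_space ?N by (rule prob_space_normal_density) simp
  interpret EN: pair_prob_space ?E ?N ..
  have setsP: "sets (?E \<Otimes>\<^sub>M ?N) = sets (borel \<Otimes>\<^sub>M borel)"
    by (auto intro!: sets_pair_measure_cong)
  let ?h = "\<lambda>z. sqrt (fst z) * snd z"
  have m [measurable]: "?h \<in> borel_measurable (?E \<Otimes>\<^sub>M ?N)"
    unfolding measurable_cong_sets[OF setsP refl] by measurable
  let ?W = "distr (?E \<Otimes>\<^sub>M ?N) borel ?h"
  have "?W = distr (laplace_measure c) borel (\<lambda>x. x)"
  proof (rule Levy_uniqueness)
    show "real_distribution ?W" by (rule EN.real_distribution_distr) (rule m)
    show "real_distribution (distr (laplace_measure c) borel (\<lambda>x. x))"
      by (intro prob_space.real_distribution_distr prob_space_laplace c) simp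
    show "char ?W = char (distr (laplace_measure c) borel (\<lambda>x. x))"
    proof
      fix u
      have int: "integrable (?E \<Otimes>\<^sub>M ?N) (\<lambda>(x, y). iexp (u * (sqrt x * y)))"
        using m by (intro EN.integrable_const_bound[where B=1]) (auto simp: split_beta')
      have "char ?W u = (CLINT z|?E \<Otimes>\<^sub>M ?N. iexp (u * ?h z))"
        unfolding char_def by (subst integral_distr) auto
      also have "\<dots> = (CLINT x|?E. CLINT y|?N. iexp (u * (sqrt x * y)))"
        using EN.integral_fst'[OF int] by (simp add: split_beta')
      also have "\<dots> = (CLINT x|?E. char ?N (u * sqrt x))"
        unfolding char_def by (simp add: mult.assoc)
      also have "\<dots> = (CLINT x|?E. complex_of_real (exp (- (u * sqrt x)\<^sup>2 / 2)))"
        by (simp add: char_normal)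
      also have "\<dots> = complex_of_real (LINT x|?E. exp (- (u * sqrt x)\<^sup>2 / 2))"
        by (rule integral_complex_of_real)
      also have "(LINT x|?E. exp (- (u * sqrt x)\<^sup>2 / 2)) = (LINT x|lborel. exponential_density ?l x * exp (- (u * sqrt x)\<^sup>2 / 2))"
        using l by (subst integral_density) (auto simp: exponential_density_nonneg)
      \<comment> \<open>Damping an exponential density by an exponential factor gives, up to
        normalization, an exponential density of larger rate; what remains integrates to
        \<open>1\<close>.\<close>
      also have "\<dots> = (LINT x|lborel. c\<^sup>2 / (c\<^sup>2 + u\<^sup>2) * exponential_density ((c\<^sup>2 + u\<^sup>2) / 2) x)"
      proof (intro Bochner_Integration.integral_cong refl)
        fix x :: real
        show "exponential_density ?l x * exp (- (u * sqrt x)\<^sup>2 / 2) = c\<^sup>2 / (c\<^sup>2 + u\<^sup>2) * exponential_density ((c\<^sup>2 + u\<^sup>2) / 2) x"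
        proof (cases "x < 0")
          case False
          have "exp (- x * ?l) * exp (- (u * sqrt x)\<^sup>2 / 2) = exp (- x * ((c\<^sup>2 + u\<^sup>2) / 2))"
            using False by (simp add: mult_exp_exp power_mult_distrib algebra_simps add_divide_distrib diff_divide_distrib)
          moreover have "?l = c\<^sup>2 / (c\<^sup>2 + u\<^sup>2) * ((c\<^sup>2 + u\<^sup>2) / 2)"
            using c by (simp add: add_pos_nonneg pos_add_strict less_imp_neq[symmetric] sum_power2_eq_zero_iff)
          ultimately show ?thesis using False
            by (simp add: exponential_density_def)
        qed (simp add: exponential_density_def)
      qed
      also have "\<dots> = c\<^sup>2 / (c\<^sup>2 + u\<^sup>2) * (LINT x|lborel. exponential_density ((c\<^sup>2 + u\<^sup>2) / 2) x)"
        by simp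
      also have "(LINT x|lborel. exponential_density ((c\<^sup>2 + u\<^sup>2) / 2) x) = 1"
      proof -
        have "0 < (c\<^sup>2 + u\<^sup>2) / 2" using c by (simp add: add_pos_nonneg)
        then show ?thesis
          using integral_eq_nn_integral[of "exponential_density ((c\<^sup>2 + u\<^sup>2) / 2)" lborel]
          by (simp add: nn_integral_exponential_density exponential_density_nonneg)
      qed
      finally have "char ?W u = char (laplace_measure c) u"
        unfolding char_laplace[OF c] by simp
      moreover have "distr (laplace_measure c) borel (\<lambda>x. x) = laplace_measure c" by (rule distr_id2) simp
      ultimately show "char ?W u = char (distr (laplace_measure c) borel (\<lambda>x. x)) u"
        by simp
    qed
  qed
  then have W: "?W = laplace_measure c" by (simp add: distr_id2)
  have "emeasure (laplace_measure c) A = emeasure (?E \<Otimes>\<^sub>M ?N) (?h -` A \<inter> space (?E \<Otimes>\<^sub>M ?N))"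
    unfolding W[symmetric] by (rule emeasure_distr) auto
  also have "\<dots> = (\<integral>\<^sup>+ s. emeasure ?N (Pair s -` (?h -` A \<inter> space (?E \<Otimes>\<^sub>M ?N))) \<partial>?E)"
    by (rule N.emeasure_pair_measure_alt) (rule measurable_sets[OF m A])
  also have "\<dots> = (\<integral>\<^sup>+ s. emeasure ?N {z. sqrt s * z \<in> A} \<partial>?E)"
    by (intro nn_integral_cong arg_cong2[where f=emeasure] refl) (auto simp: space_pair_measure)
  finally show ?thesis ..
qed

section \<open>Increments of Brownian motion at Poisson times\<close>

definition arrival_time :: "(nat \<Rightarrow> real) \<Rightarrow> nat \<Rightarrow> real" where
  "arrival_time x n = (\<Sum>k<n. x k)"

definition sampled_increment :: "(nat \<Rightarrow> real) \<Rightarrow> (nat \<Rightarrow> real) \<Rightarrow> nat \<Rightarrow> real" where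
  "sampled_increment x z k = levy_path z (arrival_time x (Suc k)) - levy_path z (arrival_time x k)"

text \<open>The path is evaluated at a random time. At each level the step path depends on that time
  through a natural number only, which gives joint measurability, and the limit over the levels
  preserves it.\<close>

lemma measurable_sampled_increment [measurable]:
  "(\<lambda>w. sampled_increment (fst w) (snd w) k) \<in> borel_measurable (seq_measure borel \<Otimes>\<^sub>M seq_measure borel)"
proof -
  have m: "(\<lambda>w. levy_path (snd w) (arrival_time (fst w) n)) \<in> borel_measurable (seq_measure borel \<Otimes>\<^sub>M seq_measure borel)"
    for n :: nat
    unfolding levy_path_def
  proof (rule borel_measurable_lim_metric)
    fix j
    have [measurable]: "(\<lambda>z. dyadic_increment z j k) \<in> borel_measurable (seq_measure borel)" for k
      by (rule measurable_dyadic_increment) simp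
    have "(\<lambda>w. dyadic_path (snd w) j i) \<in> borel_measurable (seq_measure borel \<Otimes>\<^sub>M seq_measure borel)" for i :: nat
      unfolding dyadic_path_def by measurable
    moreover have "(\<lambda>w. nat \<lfloor>2 ^ j * arrival_time (fst w) n\<rfloor>) \<in> measurable (seq_measure borel \<Otimes>\<^sub>M seq_measure borel) (count_space UNIV)"
      unfolding arrival_time_def by measurable
    ultimately show "(\<lambda>w. dyadic_step (snd w) (arrival_time (fst w) n) j) \<in> borel_measurable (seq_measure borel \<Otimes>\<^sub>M seq_measure borel)"
      unfolding dyadic_step_def by (rule measurable_compose_countable)
  qed
  show ?thesis unfolding sampled_increment_def by (intro borel_measurable_diff m)
qed

lemma AE_exponential_pos: "0 < l \<Longrightarrow> AE x in seq_measure (exponential_measure l). \<forall>k. 0 < x k"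
proof -
  assume l: "0 < l"
  then have E: "prob_space (exponential_measure l)" by (rule prob_space_exponential_density)
  have "AE e in exponential_measure l. 0 < e"
    using AE_lborel_singleton[of 0]
    by (subst AE_density) (auto simp: exponential_density_def split: if_splits)
  then have "AE x in seq_measure (exponential_measure l). 0 < x k" for k :: nat
    by (intro AE_PiM_component E) auto
  then show ?thesis by (simp add: AE_all_countable)
qed

text \<open>The path properties in the definitions are required for every outcome, not almost surely;
  hence the modification on a null event.\<close>

lemma iid_sanitize:
  assumes N: "prob_space N" and good: "AE x in seq_measure N. good x" and m: "{x \<in> space (seq_measure N). good x} \<in> sets (seq_measure N)"
    and x0: "x0 \<in> space (seq_measure N)"
  shows "iid (seq_measure N) N (\<lambda>x. if good x then x else x0)"
    and "AE x in seq_measure N. (if good x then x else x0) = x"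
proof -
  have [measurable]: "(\<lambda>x. if good x then x else x0) \<in> measurable (seq_measure N) (seq_measure N)"
    using m x0 by (intro measurable_If) auto
  show ae: "AE x in seq_measure N. (if good x then x else x0) = x"
    using good by eventually_elim simp
  have "distr (seq_measure N) (seq_measure N) (\<lambda>x. if good x then x else x0) = distr (seq_measure N) (seq_measure N) (\<lambda>x. x)"
    by (rule distr_cong_AE) (use ae in auto)
  then show "iid (seq_measure N) N (\<lambda>x. if good x then x else x0)"
    by (simp add: iid_def distr_id2)
qed

lemma sets_Collect_all_less_mem:
  fixes n :: nat
  assumes "\<And>k. k < n \<Longrightarrow> f k \<in> borel_measurable M" "\<And>k. k < n \<Longrightarrow> A k \<in> sets borel"
  shows "{x \<in> space M. \<forall>k<n. f k x \<in> A k} \<in> sets M"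
proof -
  have "{x \<in> space M. \<forall>k<n. f k x \<in> A k} = space M \<inter> (\<Inter>k\<in>{..<n}. f k -` A k \<inter> space M)" if "n \<noteq> 0"
    using that by auto
  moreover have "(\<Inter>k\<in>{..<n}. f k -` A k \<inter> space M) \<in> sets M" if "n \<noteq> 0"
    using assms that by (intro sets.finite_INT measurable_sets[of _ _ borel]) auto
  ultimately show ?thesis by (cases "n = 0") auto
qed

text \<open>The conditional statement for given sampling times: positive gaps make them increasing,
  so independence and normality of Brownian increments apply. The normals are first replaced by
  their regular modification, which almost surely changes nothing.\<close>

lemma prob_sampled_increment:
  assumes x: "\<And>k. 0 < x k" and A: "\<And>k. k < n \<Longrightarrow> A k \<in> sets borel"
  shows "emeasure (seq_measure (normal_measure 1)) {z \<in> space (seq_measure (normal_measure 1)). \<forall>k<n. sampled_increment x z k \<in> A k}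
    = (\<Prod>k<n. emeasure (normal_measure 1) {y. sqrt (x k) * y \<in> A k})"
proof -
  let ?N = "normal_measure 1" and ?S = "seq_measure (normal_measure 1)"
  have N: "prob_space ?N" by (rule prob_space_normal_density) simp
  interpret S: prob_space ?S by (rule prob_space_seq_measure[OF N])
  have sets_S: "sets ?S = sets (seq_measure borel)" by (intro sets_PiM_cong) auto
  have space_S: "space ?S = UNIV" by (simp add: space_PiM)
  define Z where "Z z = (if regular_dyadic z then z else (\<lambda>_. 0))" for z
  have Z: "iid ?S ?N Z" and ae: "AE z in ?S. Z z = z"
    using iid_sanitize[OF N AE_regular_dyadic, of "\<lambda>_. 0"] sets_regular_dyadic
    by (simp_all add: Z_def[abs_def] space_S sets_S[symmetric] space_PiM)
  have reg: "regular_dyadic (Z z)" for z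
    by (simp add: Z_def regular_dyadic_0)
  have BM: "standard_brownian_motion ?S (\<lambda>t z. levy_path (Z z) t)"
    by (rule standard_brownian_motion_levy_path[OF S.prob_space_axioms Z reg])
  let ?I = "\<lambda>k z. sampled_increment x (Z z) k"
  have inc: "0 \<le> arrival_time x 0" "incseq (arrival_time x)"
    using x by (auto simp: arrival_time_def incseq_Suc_iff less_imp_le)
  have ind: "S.indep_vars (\<lambda>_. borel) ?I {..<n}"
    using BM inc unfolding standard_brownian_motion_def sampled_increment_def by blast
  have dist: "distr ?S borel (?I k) = normal_measure (sqrt (x k))" for k
  proof -
    have "0 \<le> arrival_time x k" using inc incseqD[of "arrival_time x" 0 k] by simp
    moreover have "arrival_time x k < arrival_time x (Suc k)" using x by (simp add: arrival_time_def)
    moreover have "\<forall>s t. 0 \<le> s \<and> s < t \<longrightarrow> distributed ?S lborel (\<lambda>z. levy_path (Z z) t - levy_path (Z z) s) (normal_density 0 (sqrt (t - s)))"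
      using BM by (simp add: standard_brownian_motion_def)
    ultimately have "distributed ?S lborel (?I k) (normal_density 0 (sqrt (arrival_time x (Suc k) - arrival_time x k)))"
      unfolding sampled_increment_def by blast
    then have "distr ?S lborel (?I k) = normal_measure (sqrt (x k))"
      by (simp add: distributed_def arrival_time_def)
    moreover have "distr ?S lborel (?I k) = distr ?S borel (?I k)" by (intro distr_cong) auto
    ultimately show ?thesis by simp
  qed
  have m: "?I k \<in> borel_measurable ?S" if "k < n" for k
    using ind that by (auto simp: S.indep_vars_def2)
  have "emeasure ?S {z \<in> space ?S. \<forall>k<n. sampled_increment x z k \<in> A k} = emeasure ?S {z \<in> space ?S. \<forall>k<n. ?I k z \<in> A k}"
  proof (rule emeasure_eq_AE)
    have "(\<lambda>z. (x, z)) \<in> measurable (seq_measure borel) (seq_measure borel \<Otimes>\<^sub>M seq_measure borel)"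
      by (rule measurable_Pair1') (simp add: space_PiM)
    from measurable_compose[OF this measurable_sampled_increment]
    have "(\<lambda>z. sampled_increment x z k) \<in> borel_measurable ?S" for k
      by (simp add: measurable_cong_sets[OF sets_S refl])
    then show "{z \<in> space ?S. \<forall>k<n. sampled_increment x z k \<in> A k} \<in> sets ?S"
      using A by (intro sets_Collect_all_less_mem)
    show "{z \<in> space ?S. \<forall>k<n. ?I k z \<in> A k} \<in> sets ?S"
      using A m by (intro sets_Collect_all_less_mem)
  qed (use ae in \<open>eventually_elim, simp\<close>)
  also have "{z \<in> space ?S. \<forall>k<n. ?I k z \<in> A k} = (if n = 0 then space ?S else (\<Inter>k\<in>{..<n}. ?I k -` A k \<inter> space ?S))"
    by auto
  also have "emeasure ?S \<dots> = (\<Prod>k<n. emeasure ?S (?I k -` A k \<inter> space ?S))"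
  proof (cases "n = 0")
    case False
    then have "measure ?S (\<Inter>k\<in>{..<n}. ?I k -` A k \<inter> space ?S) = (\<Prod>k<n. measure ?S (?I k -` A k \<inter> space ?S))"
      using A by (intro S.indep_varsD_finite[OF ind]) auto
    then show ?thesis using False by (simp add: S.emeasure_eq_measure prod_ennreal)
  qed (simp add: S.emeasure_space_1)
  also have "\<dots> = (\<Prod>k<n. emeasure ?N {y. sqrt (x k) * y \<in> A k})"
  proof (intro prod.cong refl)
    fix k assume "k \<in> {..<n}"
    then have k: "k < n" by simp
    have "emeasure ?S (?I k -` A k \<inter> space ?S) = emeasure (distr ?S borel (?I k)) (A k)"
      using m[OF k] A[OF k] by (simp add: emeasure_distr)
    also have "\<dots> = emeasure (distr ?N borel (\<lambda>y. sqrt (x k) * y)) (A k)"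
      unfolding dist using x by (subst distr_normal_scale) auto
    also have "\<dots> = emeasure ?N {y. sqrt (x k) * y \<in> A k}"
      using A[OF k] by (subst emeasure_distr) (auto simp: vimage_def)
    finally show "emeasure ?S (?I k -` A k \<inter> space ?S) = emeasure ?N {y. sqrt (x k) * y \<in> A k}" .
  qed
  finally show ?thesis .
qed

text \<open>By Fubini the sampling times are integrated last. The conditional probability is a
  product over \<open>k\<close> of functions of single gaps, so the integral factorizes into normal
  mixtures.\<close>

lemma iid_sampled_increment:
  assumes c: "0 < c" and M: "prob_space M"
    and X: "iid M (exponential_measure (c\<^sup>2 / 2)) X" and Z: "iid M (normal_measure 1) Z"
    and ind: "independent_pair M (seq_measure (exponential_measure (c\<^sup>2 / 2))) X (seq_measure (normal_measure 1)) Z"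
  shows "iid M (laplace_measure c) (\<lambda>\<omega> k. sampled_increment (X \<omega>) (Z \<omega>) k)"
proof (rule iidI[OF M prob_space_laplace[OF c]])
  let ?l = "c\<^sup>2 / 2"
  have l: "0 < ?l" using c by simp
  let ?E = "exponential_measure ?l" and ?N = "normal_measure 1"
  let ?SE = "seq_measure ?E" and ?SN = "seq_measure ?N"
  have E: "prob_space ?E" using l by (rule prob_space_exponential_density)
  have N: "prob_space ?N" by (rule prob_space_normal_density) simp
  interpret SE: prob_space ?SE by (rule prob_space_seq_measure[OF E])
  interpret SN: prob_space ?SN by (rule prob_space_seq_measure[OF N])
  interpret N: prob_space ?N by (rule N)
  have sets_SN: "sets ?SN = sets (seq_measure borel)" and sets_SE: "sets ?SE = sets (seq_measure borel)"
    by (auto intro!: sets_PiM_cong)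
  have sets_P: "sets (?SE \<Otimes>\<^sub>M ?SN) = sets (seq_measure borel \<Otimes>\<^sub>M seq_measure borel)"
    by (intro sets_pair_measure_cong sets_SN sets_SE)
  have mP: "(\<lambda>w. sampled_increment (fst w) (snd w) k) \<in> borel_measurable (?SE \<Otimes>\<^sub>M ?SN)" for k
    unfolding measurable_cong_sets[OF sets_P refl] by measurable
  have mXZ: "(\<lambda>\<omega>. (X \<omega>, Z \<omega>)) \<in> measurable M (?SE \<Otimes>\<^sub>M ?SN)"
    using iid_measurable[OF X] iid_measurable[OF Z] by simp
  show "(\<lambda>\<omega> k. sampled_increment (X \<omega>) (Z \<omega>) k) \<in> measurable M (seq_measure (laplace_measure c))"
    using measurable_compose[OF mXZ mP] by (intro measurable_PiM_single') auto
  have joint: "?SE \<Otimes>\<^sub>M ?SN = distr M (?SE \<Otimes>\<^sub>M ?SN) (\<lambda>\<omega>. (X \<omega>, Z \<omega>))"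
    using independent_pair_distr[OF M ind] X Z by (simp add: iid_def)
  fix n
  show "\<exists>m\<ge>n. \<forall>A. (\<forall>k<m. A k \<in> sets (laplace_measure c)) \<longrightarrow>
      emeasure M {\<omega> \<in> space M. \<forall>k<m. sampled_increment (X \<omega>) (Z \<omega>) k \<in> A k} = (\<Prod>k<m. emeasure (laplace_measure c) (A k))"
  proof (intro exI[of _ n] conjI allI impI le_refl)
    fix A assume "\<forall>k<n. A k \<in> sets (laplace_measure c)"
    then have A: "\<And>k. k < n \<Longrightarrow> A k \<in> sets borel" by simp
    let ?C = "{w \<in> space (?SE \<Otimes>\<^sub>M ?SN). \<forall>k<n. sampled_increment (fst w) (snd w) k \<in> A k}"
    have C: "?C \<in> sets (?SE \<Otimes>\<^sub>M ?SN)"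
      using A mP by (intro sets_Collect_all_less_mem)
    have "emeasure M {\<omega> \<in> space M. \<forall>k<n. sampled_increment (X \<omega>) (Z \<omega>) k \<in> A k} = emeasure M ((\<lambda>\<omega>. (X \<omega>, Z \<omega>)) -` ?C \<inter> space M)"
      using measurable_space[OF mXZ] by (intro arg_cong[where f="emeasure M"]) auto
    also have "\<dots> = emeasure (?SE \<Otimes>\<^sub>M ?SN) ?C"
      using emeasure_distr[OF mXZ C] by (simp only: joint[symmetric])
    also have "\<dots> = (\<integral>\<^sup>+ x. emeasure ?SN (Pair x -` ?C) \<partial>?SE)"
      by (rule SN.emeasure_pair_measure_alt[OF C])
    also have "\<dots> = (\<integral>\<^sup>+ x. (\<Prod>k<n. emeasure ?N {y. sqrt (x k) * y \<in> A k}) \<partial>?SE)"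
    proof (rule nn_integral_cong_AE)
      show "AE x in ?SE. emeasure ?SN (Pair x -` ?C) = (\<Prod>k<n. emeasure ?N {y. sqrt (x k) * y \<in> A k})"
        using AE_exponential_pos[OF l]
      proof eventually_elim
        case (elim x)
        have "Pair x -` ?C = {z \<in> space ?SN. \<forall>k<n. sampled_increment x z k \<in> A k}"
          by (auto simp: space_pair_measure space_PiM)
        then show ?case using prob_sampled_increment[of x n A] elim A by simp
      qed
    qed
    also have "\<dots> = (\<Prod>k<n. \<integral>\<^sup>+ s. emeasure ?N {y. sqrt s * y \<in> A k} \<partial>?E)"
    proof (rule nn_integral_seq_measure_prod[OF E])
      fix k assume k: "k < n"
      have [measurable]: "A k \<in> sets borel" by (rule A[OF k])
      have "{w \<in> space (borel \<Otimes>\<^sub>M ?N). sqrt (fst w) * snd w \<in> A k} \<in> sets (borel \<Otimes>\<^sub>M ?N)" by measurable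
      from N.measurable_emeasure_Pair[OF this]
      show "(\<lambda>s. emeasure ?N {y. sqrt s * y \<in> A k}) \<in> borel_measurable ?E"
        by (simp add: vimage_def space_pair_measure)
    qed
    also have "\<dots> = (\<Prod>k<n. emeasure (laplace_measure c) (A k))"
      using A by (intro prod.cong refl normal_mixture_laplace[OF c]) auto
    finally show "emeasure M {\<omega> \<in> space M. \<forall>k<n. sampled_increment (X \<omega>) (Z \<omega>) k \<in> A k} = (\<Prod>k<n. emeasure (laplace_measure c) (A k))" .
  qed
qed

text \<open>Even entries are durations of upward runs, odd entries of downward runs. Division by the
  speed \<open>c\<close> turns lengths into durations and the exponential rate \<open>c\<close> into
  \<open>c\<^sup>2\<close>.\<close>

definition zigzag_gap :: "real \<Rightarrow> (nat \<Rightarrow> real) \<Rightarrow> (nat \<Rightarrow> real) \<Rightarrow> nat \<Rightarrow> real" where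
  "zigzag_gap c l y k = interleave (\<lambda>k. (max (l k) 0 + y k, max (- l k) 0 + y k)) k / c"

text \<open>Here the construction from Brownian increments becomes a genuine Poisson clock: Laplace
  increments and additional exponentials split into independent exponential pairs, which are
  interleaved and rescaled.\<close>

theorem iid_zigzag_gap:
  assumes c: "0 < c" and M: "prob_space M"
    and X: "iid M (exponential_measure (c\<^sup>2 / 2)) X" and Z: "iid M (normal_measure 1) Z" and Y: "iid M (exponential_measure (2 * c)) Y"
    and ind: "independent_pair M (seq_measure (exponential_measure (c\<^sup>2 / 2))) X (seq_measure (normal_measure 1)) Z"
    and ind2: "independent_pair M (seq_measure borel \<Otimes>\<^sub>M seq_measure borel) (\<lambda>\<omega>. (X \<omega>, Z \<omega>)) (seq_measure (exponential_measure (2 * c))) Y"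
  shows "iid M (exponential_measure (c\<^sup>2)) (\<lambda>\<omega>. zigzag_gap c (sampled_increment (X \<omega>) (Z \<omega>)) (Y \<omega>))"
proof -
  let ?E = "exponential_measure c" and ?E2 = "exponential_measure (2 * c)" and ?L = "laplace_measure c"
  have E: "prob_space ?E" and E2: "prob_space ?E2" and L: "prob_space ?L"
    using c by (auto intro!: prob_space_exponential_density prob_space_laplace)
  interpret E: prob_space ?E by (rule E)
  interpret E2: prob_space ?E2 by (rule E2)
  interpret L: prob_space ?L by (rule L)
  interpret LE: pair_prob_space ?L ?E2 ..
  have sets_L: "sets (seq_measure ?L) = sets (seq_measure borel)"
    by (auto intro!: sets_PiM_cong)
  have "(\<lambda>w k. sampled_increment (fst w) (snd w) k) \<in> measurable (seq_measure borel \<Otimes>\<^sub>M seq_measure borel) (seq_measure borel)"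
    by (intro measurable_PiM_single' measurable_sampled_increment) auto
  then have mI: "(\<lambda>w. sampled_increment (fst w) (snd w)) \<in> measurable (seq_measure borel \<Otimes>\<^sub>M seq_measure borel) (seq_measure ?L)"
    by (simp add: measurable_cong_sets[OF refl sets_L])
  have "independent_pair M (seq_measure ?L) (\<lambda>\<omega>. sampled_increment (X \<omega>) (Z \<omega>)) (seq_measure ?E2) Y"
    using independent_pair_compose[OF ind2 mI measurable_ident] by simp
  from iid_zip[OF L E2 M iid_sampled_increment[OF c M X Z ind] Y this]
  have z: "iid M (?L \<Otimes>\<^sub>M ?E2) (\<lambda>\<omega> k. (sampled_increment (X \<omega>) (Z \<omega>) k, Y \<omega> k))" .
  let ?f = "\<lambda>z. (max (fst z) 0 + snd z, max (- fst z) 0 + snd z) :: real \<times> real"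
  have setsR: "sets (?L \<Otimes>\<^sub>M ?E2) = sets (borel \<Otimes>\<^sub>M borel)" and setsP: "sets (?E \<Otimes>\<^sub>M ?E) = sets (borel \<Otimes>\<^sub>M borel)"
    by (auto intro!: sets_pair_measure_cong)
  have f: "?f \<in> measurable (?L \<Otimes>\<^sub>M ?E2) (?E \<Otimes>\<^sub>M ?E)"
    unfolding measurable_cong_sets[OF setsR setsP] by measurable
  have I: "iid M ?E (\<lambda>\<omega>. interleave (\<lambda>k. ?f (sampled_increment (X \<omega>) (Z \<omega>) k, Y \<omega> k)))"
    by (intro iid_interleave E M iid_map[OF LE.prob_space_axioms z M f distr_laplace_split[OF c]])
  have d: "distr ?E (exponential_measure (c\<^sup>2)) (\<lambda>x. x / c) = exponential_measure (c\<^sup>2)"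
  proof -
    have "distributed ?E lborel (\<lambda>x. x) (exponential_density c)"
      using c by (simp add: distributed_def distr_id2)
    from E.erlang_distributed_mult_const[OF this, of "1 / c"] c
    have "distributed ?E lborel (\<lambda>x. x / c) (exponential_density (c\<^sup>2))"
      by (simp add: power2_eq_square)
    then have "distr ?E lborel (\<lambda>x. x / c) = exponential_measure (c\<^sup>2)"
      by (simp add: distributed_def)
    moreover have "distr ?E lborel (\<lambda>x. x / c) = distr ?E (exponential_measure (c\<^sup>2)) (\<lambda>x. x / c)"
      by (intro distr_cong) auto
    ultimately show ?thesis by simp
  qed
  have "(\<lambda>x. x / c) \<in> measurable ?E (exponential_measure (c\<^sup>2))" by simp
  from iid_map[OF E I M this d] show ?thesis by (simp add: zigzag_gap_def[abs_def])
qed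

section \<open>Integrals along jump paths\<close>

text \<open>Turns the least index into a threshold comparison, from which measurability and
  monotonicity of the count follow.\<close>

lemma count_arrivals_le_iff:
  assumes x: "proper_arrivals x"
  shows "count_arrivals x t \<le> n \<longleftrightarrow> t < arrival x (Suc n)"
proof
  have mono: "mono (arrival x)"
    using x strict_mono_arrival[of x] strict_mono_mono by (auto simp: proper_arrivals_def)
  obtain m where "t < arrival x m" using x by (auto simp: proper_arrivals_def)
  then have "t < arrival x (Suc m)" using monoD[OF mono, of m "Suc m"] by simp
  then have *: "t < arrival x (Suc (count_arrivals x t))"
    unfolding count_arrivals_def by (rule LeastI)
  show "t < arrival x (Suc n)" if "count_arrivals x t \<le> n"
    using * monoD[OF mono, of "Suc (count_arrivals x t)" "Suc n"] that by simp
next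
  assume "t < arrival x (Suc n)"
  then show "count_arrivals x t \<le> n"
    unfolding count_arrivals_def by (rule Least_le)
qed

lemma measurable_count_arrivals:
  assumes x: "\<And>\<omega>. \<omega> \<in> space M \<Longrightarrow> proper_arrivals (X \<omega>)"
    and arr [measurable]: "\<And>n. (\<lambda>\<omega>. arrival (X \<omega>) n) \<in> borel_measurable M"
    and s [measurable]: "s \<in> borel_measurable M"
  shows "(\<lambda>\<omega>. count_arrivals (X \<omega>) (s \<omega>)) \<in> measurable M (count_space UNIV)"
proof -
  have le: "{\<omega> \<in> space M. count_arrivals (X \<omega>) (s \<omega>) \<le> n} \<in> sets M" for n
  proof -
    have "{\<omega> \<in> space M. count_arrivals (X \<omega>) (s \<omega>) \<le> n} = {\<omega> \<in> space M. s \<omega> < arrival (X \<omega>) (Suc n)}"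
      using count_arrivals_le_iff[OF x] by auto
    also have "\<dots> \<in> sets M" by measurable
    finally show ?thesis .
  qed
  have "(\<lambda>\<omega>. count_arrivals (X \<omega>) (s \<omega>)) -` {n} \<inter> space M \<in> sets M" for n
  proof -
    have "(\<lambda>\<omega>. count_arrivals (X \<omega>) (s \<omega>)) -` {n} \<inter> space M = {\<omega> \<in> space M. count_arrivals (X \<omega>) (s \<omega>) \<le> n}
      - (\<Union>m\<in>{..<n}. {\<omega> \<in> space M. count_arrivals (X \<omega>) (s \<omega>) \<le> m})"
      by (auto simp: not_le) (metis le_neq_implies_less lessThan_iff less_irrefl)
    also have "\<dots> \<in> sets M" by (intro sets.Diff sets.finite_UN le) auto
    finally show ?thesis .
  qed
  then show ?thesis by (intro measurable_count_space_eq2_countable[THEN iffD2]) auto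
qed

text \<open>The time \<open>s\<close> may depend on the outcome. On a product with the time axis
  this yields joint measurability, and with a constant input it yields measurability in
  time.\<close>

lemma measurable_jump_path:
  fixes f :: "'s::countable \<Rightarrow> 'u \<Rightarrow> 's"
  assumes x: "\<And>\<omega>. \<omega> \<in> space M \<Longrightarrow> proper_arrivals (X \<omega>)"
    and arr: "\<And>n. (\<lambda>\<omega>. arrival (X \<omega>) n) \<in> borel_measurable M"
    and st: "\<And>n. (\<lambda>\<omega>. embedded_state f (I \<omega>) (X \<omega>) n) \<in> measurable M (count_space UNIV)"
    and s: "s \<in> borel_measurable M"
  shows "(\<lambda>\<omega>. jump_path f (I \<omega>) (X \<omega>) (s \<omega>)) \<in> measurable M (count_space UNIV)"
  unfolding jump_path_def
  by (rule measurable_compose_countable[OF st measurable_count_arrivals[OF x arr s]])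

lemma measurable_jump_path_time:
  fixes f :: "'s::countable \<Rightarrow> 'u \<Rightarrow> 's"
  assumes x: "proper_arrivals x"
  shows "jump_path f i x \<in> measurable borel (count_space UNIV)"
  by (rule measurable_jump_path[where X="\<lambda>_. x" and I="\<lambda>_. i" and s="\<lambda>s. s"]) (auto intro: x)

text \<open>The increments of \<open>h\<close> along the embedded chain, with the value before
  arrival \<open>0\<close> taken to be zero; partial sums then telescope to \<open>h\<close>
  itself.\<close>

definition jump_coeff :: "('s \<Rightarrow> real) \<Rightarrow> ('s \<Rightarrow> 'u \<Rightarrow> 's) \<Rightarrow> 's \<Rightarrow> (nat \<Rightarrow> real \<times> 'u) \<Rightarrow> nat \<Rightarrow> real" where
  "jump_coeff h f i x l = h (embedded_state f i x l) - (if l = 0 then 0 else h (embedded_state f i x (l - 1)))"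

text \<open>The Stieltjes integral of the step function \<open>h (jump_path f i x s)\<close> against a function \<open>b\<close>,
  obtained by summation by parts over the arrivals.\<close>

definition path_integral ::
    "('s \<Rightarrow> 'u \<Rightarrow> 's) \<Rightarrow> 's \<Rightarrow> (nat \<Rightarrow> real \<times> 'u) \<Rightarrow> ('s \<Rightarrow> real) \<Rightarrow> (real \<Rightarrow> real) \<Rightarrow> real \<Rightarrow> real" where
  "path_integral f i x h b t = (\<Sum>l\<le>count_arrivals x t. jump_coeff h f i x l * (b t - b (arrival x l)))"

lemma sum_jump_coeff: "(\<Sum>l\<le>m. jump_coeff h f i x l) = h (embedded_state f i x m)"
  by (induction m) (auto simp: jump_coeff_def simp del: embedded_state.simps(2))

lemma proper_arrivals_mono: "proper_arrivals x \<Longrightarrow> m \<le> n \<Longrightarrow> arrival x m \<le> arrival x n"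
  using strict_mono_arrival[of x] strict_mono_mono[of "arrival x"] monoD by (auto simp: proper_arrivals_def)

lemma proper_arrivals_nonneg: "proper_arrivals x \<Longrightarrow> 0 \<le> arrival x n"
  using proper_arrivals_mono[of x 0 n] by simp

lemma arrival_le_iff_count:
  assumes "proper_arrivals x" "0 \<le> t"
  shows "arrival x l \<le> t \<longleftrightarrow> l \<le> count_arrivals x t"
proof (cases l)
  case (Suc k)
  then show ?thesis using count_arrivals_le_iff[OF assms(1), of t k] by auto
qed (use assms in simp)

text \<open>The step function is a combination of Heaviside functions. Arrivals after
  \<open>s\<close> contribute zero, so one bound \<open>n\<close> serves all times up to a
  horizon.\<close>

lemma jump_path_eq_sum:
  assumes x: "proper_arrivals x" and s: "0 \<le> s" and n: "count_arrivals x s \<le> n"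
  shows "h (jump_path f i x s) = (\<Sum>l\<le>n. jump_coeff h f i x l * indicator {arrival x l..} s)"
proof -
  have "(\<Sum>l\<le>n. jump_coeff h f i x l * indicator {arrival x l..} s) = (\<Sum>l\<le>count_arrivals x s. jump_coeff h f i x l)"
    by (rule sum.mono_neutral_cong_right) (use n arrival_le_iff_count[OF x s] in \<open>auto simp: indicator_def\<close>)
  then show ?thesis by (simp add: sum_jump_coeff jump_path_def)
qed

lemma count_arrivals_mono: "proper_arrivals x \<Longrightarrow> s \<le> t \<Longrightarrow> count_arrivals x s \<le> count_arrivals x t"
  by (metis count_arrivals_le_iff le_less_trans order_refl)

text \<open>Capping the arrivals at \<open>t\<close> makes the surplus terms vanish. The number of
  terms can then be the same for all \<open>t\<close> of an interval, as bounds and continuity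
  require.\<close>

lemma path_integral_eq:
  assumes x: "proper_arrivals x" and t: "0 \<le> t" and n: "count_arrivals x t \<le> n"
  shows "path_integral f i x h b t = (\<Sum>l\<le>n. jump_coeff h f i x l * (b t - b (min t (arrival x l))))"
proof -
  have "(\<Sum>l\<le>n. jump_coeff h f i x l * (b t - b (min t (arrival x l)))) = (\<Sum>l\<le>count_arrivals x t. jump_coeff h f i x l * (b t - b (arrival x l)))"
  proof (rule sum.mono_neutral_cong_right)
    have "min t (arrival x l) = t" if "\<not> l \<le> count_arrivals x t" for l
      using that arrival_le_iff_count[OF x t, of l] by auto
    then show "\<forall>l\<in>{..n} - {..count_arrivals x t}. jump_coeff h f i x l * (b t - b (min t (arrival x l))) = 0"
      by auto
    have "min t (arrival x l) = arrival x l" if "l \<le> count_arrivals x t" for l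
      using that arrival_le_iff_count[OF x t, of l] by auto
    then show "\<And>l. l \<in> {..count_arrivals x t} \<Longrightarrow> jump_coeff h f i x l * (b t - b (min t (arrival x l))) = jump_coeff h f i x l * (b t - b (arrival x l))"
      by auto
  qed (use n in auto)
  then show ?thesis by (simp add: path_integral_def)
qed

text \<open>Finitely many jumps occur up to \<open>T\<close>, and each contributes two evaluations
  of the integrator. The constant depends on the path and on \<open>T\<close>, but neither on
  \<open>t\<close> nor on the integrators.\<close>

lemma path_integral_diff_bound:
  assumes x: "proper_arrivals x" and t: "0 \<le> t" "t \<le> T" and b: "\<And>s. 0 \<le> s \<Longrightarrow> s \<le> T \<Longrightarrow> \<bar>b s - b' s\<bar> \<le> e"
  shows "\<bar>path_integral f i x h b t - path_integral f i x h b' t\<bar> \<le> (\<Sum>l\<le>count_arrivals x T. \<bar>jump_coeff h f i x l\<bar>) * (2 * e)"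
proof -
  let ?n = "count_arrivals x T" and ?d = "jump_coeff h f i x"
  have n: "count_arrivals x t \<le> ?n" using x t by (intro count_arrivals_mono)
  have "path_integral f i x h b t - path_integral f i x h b' t
    = (\<Sum>l\<le>?n. ?d l * ((b t - b' t) - (b (min t (arrival x l)) - b' (min t (arrival x l)))))"
    unfolding path_integral_eq[OF x t(1) n] sum_subtractf[symmetric] by (intro sum.cong refl) (simp add: algebra_simps)
  also have "\<bar>\<dots>\<bar> \<le> (\<Sum>l\<le>?n. \<bar>?d l\<bar> * (2 * e))"
  proof (rule order_trans[OF sum_abs], rule sum_mono)
    fix l
    have "0 \<le> min t (arrival x l)" "min t (arrival x l) \<le> T" using t proper_arrivals_nonneg[OF x, of l] by auto
    then have "\<bar>(b t - b' t) - (b (min t (arrival x l)) - b' (min t (arrival x l)))\<bar> \<le> 2 * e"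
      using b[of t] b[of "min t (arrival x l)"] t by linarith
    then show "\<bar>?d l * ((b t - b' t) - (b (min t (arrival x l)) - b' (min t (arrival x l))))\<bar> \<le> \<bar>?d l\<bar> * (2 * e)"
      unfolding abs_mult by (rule mult_left_mono) simp
  qed
  finally show ?thesis by (simp add: sum_distrib_right)
qed

lemma continuous_on_atLeast0I:
  fixes g :: "real \<Rightarrow> real"
  assumes "\<And>K. continuous_on {0..K} g"
  shows "continuous_on {0..} g"
  unfolding continuous_on_iff
proof (intro ballI allI impI)
  fix t e :: real assume t: "t \<in> {0..}" and e: "0 < e"
  then obtain d where d: "d > 0" "\<And>s. s \<in> {0..t + 1} \<Longrightarrow> dist s t < d \<Longrightarrow> dist (g s) (g t) < e"
    using assms[of "t + 1"] unfolding continuous_on_iff by (metis atLeastAtMost_iff atLeast_iff le_add_same_cancel1 zero_le_one)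
  show "\<exists>d>0. \<forall>s\<in>{0..}. dist s t < d \<longrightarrow> dist (g s) (g t) < e"
    using d by (intro exI[of _ "min d 1"]) (auto simp: dist_real_def)
qed

text \<open>On \<open>[0, K]\<close> a fixed finite number of terms suffices, each continuous in
  \<open>t\<close>.\<close>

lemma continuous_on_path_integral:
  assumes x: "proper_arrivals x" and b: "continuous_on {0..} b"
  shows "continuous_on {0..} (path_integral f i x h b)"
proof (rule continuous_on_atLeast0I)
  fix K
  let ?n = "count_arrivals x K"
  have "continuous_on {0..K} (\<lambda>t. \<Sum>l\<le>?n. jump_coeff h f i x l * (b t - b (min t (arrival x l))))"
  proof (intro continuous_intros)
    show "continuous_on {0..K} b" using b by (rule continuous_on_subset) auto
    show "continuous_on {0..K} (\<lambda>t. b (min t (arrival x l)))" for l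
      by (rule continuous_on_compose2[OF b]) (auto intro!: continuous_intros proper_arrivals_nonneg[OF x])
  qed
  then show "continuous_on {0..K} (path_integral f i x h b)"
    by (rule continuous_on_eq) (auto intro!: path_integral_eq[OF x, symmetric] count_arrivals_mono[OF x])
qed

lemma set_integrable_bounded_Icc:
  fixes y :: "real \<Rightarrow> real"
  assumes [measurable]: "y \<in> borel_measurable borel" and b: "\<And>s. \<bar>y s\<bar> \<le> C"
  shows "set_integrable lborel {a..b} y"
  unfolding set_integrable_def
  by (rule integrableI_bounded_set_indicator[where B=C]) (use b in \<open>auto simp: emeasure_lborel_Icc_eq\<close>)

text \<open>For an absolutely continuous integrator the summation by parts is undone: each Heaviside
  term integrates to an increment of the primitive of \<open>y\<close>.\<close>

lemma set_integral_path_integral: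
  fixes h :: "'s::countable \<Rightarrow> real"
  assumes x: "proper_arrivals x" and t: "0 \<le> t"
    and y [measurable]: "y \<in> borel_measurable borel" and C: "\<And>s. \<bar>y s\<bar> \<le> C"
  shows "(LINT s:{0..t}|lborel. h (jump_path f i x s) * y s) = path_integral f i x h (\<lambda>r. LINT s:{0..r}|lborel. y s) t"
proof -
  let ?n = "count_arrivals x t" and ?d = "jump_coeff h f i x" and ?Y = "\<lambda>r. LINT s:{0..r}|lborel. y s"
  have yi: "set_integrable lborel {a..b} y" for a b using C by (intro set_integrable_bounded_Icc) auto
  have C0: "0 \<le> C" using C[of 0] by linarith
  have ii: "set_integrable lborel {0..t} (\<lambda>s. indicator {a..} s * y s)" for a
    by (rule set_integrable_bounded_Icc[where C=C]) (use C C0 in \<open>auto simp: indicator_def\<close>)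
  have part: "(LINT s:{0..t}|lborel. indicator {a..} s * y s) = ?Y t - ?Y a" if a: "0 \<le> a" "a \<le> t" for a
  proof -
    have "(LINT s:{0..t}|lborel. indicator {a..} s * y s) + ?Y a = (LINT s|lborel. indicator {0..t} s *\<^sub>R (indicator {a..} s * y s) + indicator {0..a} s *\<^sub>R y s)"
      unfolding set_lebesgue_integral_def using ii[of a] yi[of 0 a] unfolding set_integrable_def
      by (intro Bochner_Integration.integral_add[symmetric])
    also have "\<dots> = ?Y t"
      unfolding set_lebesgue_integral_def
    proof (rule integral_cong_AE)
      \<comment> \<open>The point \<open>a\<close> is counted twice on the left and has to be
        discarded.\<close>
      show "AE s in lborel. indicator {0..t} s *\<^sub>R (indicator {a..} s * y s) + indicator {0..a} s *\<^sub>R y s = indicator {0..t} s *\<^sub>R y s"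
        using AE_lborel_singleton[of a] by eventually_elim (use a in \<open>auto simp: indicator_def\<close>)
    qed auto
    finally show ?thesis by simp
  qed
  have "(LINT s:{0..t}|lborel. h (jump_path f i x s) * y s) = (LINT s:{0..t}|lborel. (\<Sum>l\<le>?n. ?d l * (indicator {arrival x l..} s * y s)))"
  proof (rule set_lebesgue_integral_cong)
    show "\<forall>s. s \<in> {0..t} \<longrightarrow> h (jump_path f i x s) * y s = (\<Sum>l\<le>?n. ?d l * (indicator {arrival x l..} s * y s))"
    proof (intro allI impI)
      fix s assume "s \<in> {0..t}"
      then have e: "h (jump_path f i x s) = (\<Sum>l\<le>?n. ?d l * indicator {arrival x l..} s)"
        by (intro jump_path_eq_sum[OF x] count_arrivals_mono[OF x]) auto
      show "h (jump_path f i x s) * y s = (\<Sum>l\<le>?n. ?d l * (indicator {arrival x l..} s * y s))"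
        unfolding e sum_distrib_right mult.assoc ..
    qed
  qed simp
  also have "\<dots> = (\<Sum>l\<le>?n. LINT s:{0..t}|lborel. ?d l * (indicator {arrival x l..} s * y s))"
    unfolding set_lebesgue_integral_def scaleR_sum_right
    by (rule Bochner_Integration.integral_sum) (use set_integrable_mult_right[OF ii] in \<open>simp add: set_integrable_def\<close>)
  also have "\<dots> = (\<Sum>l\<le>?n. ?d l * (?Y t - ?Y (arrival x l)))"
    using arrival_le_iff_count[OF x t] proper_arrivals_nonneg[OF x] by (intro sum.cong refl) (simp add: part)
  finally show ?thesis by (simp add: path_integral_def)
qed

section \<open>Riemann sums and the Ito integral of a step process\<close>

text \<open>The sum telescopes from the first grid point not below \<open>a\<close>, whose index is
  \<open>q m\<close>, up to \<open>t\<close>; that grid point is within one mesh width of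
  \<open>a\<close>.\<close>

lemma grid_sum_tendsto:
  fixes b :: "real \<Rightarrow> real"
  assumes b: "continuous_on {0..} b" and t: "0 < t" and a: "0 \<le> a" "a \<le> t"
  shows "(\<lambda>m. \<Sum>k<Suc m. indicator {a..} (real k * t / real (Suc m)) * (b (real (Suc k) * t / real (Suc m)) - b (real k * t / real (Suc m))))
    \<longlonglongrightarrow> b t - b a"
proof -
  define \<tau> where "\<tau> m k = real k * t / real (Suc m)" for m k :: nat
  define q where "q m = nat \<lceil>a * real (Suc m) / t\<rceil>" for m :: nat
  have q0: "0 \<le> a * real (Suc m) / t" for m using a t by simp
  have q: "a \<le> \<tau> m k \<longleftrightarrow> q m \<le> k" for m k
  proof -
    have "a \<le> \<tau> m k \<longleftrightarrow> a * real (Suc m) / t \<le> real k"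
      using t by (simp add: \<tau>_def field_simps del: of_nat_Suc)
    also have "\<dots> \<longleftrightarrow> q m \<le> k"
      unfolding q_def by (simp add: nat_le_iff ceiling_le_iff)
    finally show ?thesis .
  qed
  have qm: "q m \<le> Suc m" for m
  proof -
    have "a \<le> \<tau> m (Suc m)" using a by (simp add: \<tau>_def)
    then show ?thesis using q by blast
  qed
  have sum: "(\<Sum>k<Suc m. indicator {a..} (\<tau> m k) * (b (\<tau> m (Suc k)) - b (\<tau> m k))) = b t - b (\<tau> m (q m))" for m
  proof -
    have "(\<Sum>k<Suc m. indicator {a..} (\<tau> m k) * (b (\<tau> m (Suc k)) - b (\<tau> m k))) = (\<Sum>k\<in>{q m..<Suc m}. b (\<tau> m (Suc k)) - b (\<tau> m k))"
      by (rule sum.mono_neutral_cong_right) (auto simp: q indicator_def)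
    also have "\<dots> = b (\<tau> m (Suc m)) - b (\<tau> m (q m))"
      using qm[of m] by (rule sum_Suc_diff')
    also have "\<tau> m (Suc m) = t" by (simp add: \<tau>_def)
    finally show ?thesis .
  qed
  have "(\<lambda>m. \<tau> m (q m)) \<longlonglongrightarrow> a"
  proof (rule tendsto_sandwich)
    show "eventually (\<lambda>m. a \<le> \<tau> m (q m)) sequentially" by (simp add: q)
    have "\<tau> m (q m) \<le> a + t / real (Suc m)" for m
    proof -
      have "real (q m) \<le> a * real (Suc m) / t + 1"
        using q0[of m] unfolding q_def by linarith
      then have "real (q m) * (t / real (Suc m)) \<le> (a * real (Suc m) / t + 1) * (t / real (Suc m))"
        using t by (intro mult_right_mono) auto
      also have "\<dots> = a + t / real (Suc m)" using t by (simp add: field_simps del: of_nat_Suc)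
      finally show ?thesis by (simp add: \<tau>_def)
    qed
    then show "eventually (\<lambda>m. \<tau> m (q m) \<le> a + t / real (Suc m)) sequentially" by simp
    show "(\<lambda>m. a + t / real (Suc m)) \<longlonglongrightarrow> a" by real_asymp
  qed simp
  then have "(\<lambda>m. b (\<tau> m (q m))) \<longlonglongrightarrow> b a"
  proof (rule continuous_on_tendsto_compose[OF b])
    show "eventually (\<lambda>m. \<tau> m (q m) \<in> {0..}) sequentially" using t by (simp add: \<tau>_def)
  qed (use a in auto)
  then have "(\<lambda>m. b t - b (\<tau> m (q m))) \<longlonglongrightarrow> b t - b a" by (intro tendsto_intros)
  then show ?thesis unfolding sum[symmetric] by (simp add: \<tau>_def)
qed

text \<open>Expanding the step function into Heaviside terms and exchanging the sums leaves one
  telescoping grid sum per arrival. The \<open>min\<close> with \<open>t\<close> does not change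
  these grid points; it matches the form of \<open>simple_integral\<close>.\<close>

lemma Riemann_sum_path_integral:
  fixes h :: "'s \<Rightarrow> real"
  assumes x: "proper_arrivals x" and t: "0 \<le> t" and b: "continuous_on {0..} b"
  defines "\<tau> \<equiv> \<lambda>m k. real k * t / real (Suc m)"
  shows "(\<lambda>m. \<Sum>k<Suc m. h (jump_path f i x (\<tau> m k)) * (b (min (\<tau> m (Suc k)) t) - b (min (\<tau> m k) t))) \<longlonglongrightarrow> path_integral f i x h b t"
proof (cases "t = 0")
  case True
  have "count_arrivals x 0 = 0"
    using x by (intro count_arrivals_eq) (auto simp: arrival_Suc proper_arrivals_def)
  with True show ?thesis by (simp add: path_integral_def \<tau>_def)
next
  case False
  with t have t: "0 < t" by simp
  let ?n = "count_arrivals x t" and ?d = "jump_coeff h f i x"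
  have \<tau>t: "0 \<le> \<tau> m k" "k \<le> Suc m \<Longrightarrow> \<tau> m k \<le> t" for m k
  proof -
    show "0 \<le> \<tau> m k" using t by (simp add: \<tau>_def)
    assume "k \<le> Suc m"
    then have "real k * t / real (Suc m) \<le> real (Suc m) * t / real (Suc m)"
      using t by (intro divide_right_mono mult_right_mono) (auto simp del: of_nat_Suc)
    then show "\<tau> m k \<le> t" by (simp add: \<tau>_def)
  qed
  have "(\<Sum>k<Suc m. h (jump_path f i x (\<tau> m k)) * (b (min (\<tau> m (Suc k)) t) - b (min (\<tau> m k) t)))
    = (\<Sum>l\<le>?n. ?d l * (\<Sum>k<Suc m. indicator {arrival x l..} (\<tau> m k) * (b (\<tau> m (Suc k)) - b (\<tau> m k))))" for m
  proof -
    have "(\<Sum>k<Suc m. h (jump_path f i x (\<tau> m k)) * (b (min (\<tau> m (Suc k)) t) - b (min (\<tau> m k) t)))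
      = (\<Sum>k<Suc m. \<Sum>l\<le>?n. ?d l * (indicator {arrival x l..} (\<tau> m k) * (b (\<tau> m (Suc k)) - b (\<tau> m k))))"
    proof (rule sum.cong[OF refl])
      fix k assume "k \<in> {..<Suc m}"
      then have k: "\<tau> m k \<le> t" "\<tau> m (Suc k) \<le> t" by (auto intro!: \<tau>t)
      then show "h (jump_path f i x (\<tau> m k)) * (b (min (\<tau> m (Suc k)) t) - b (min (\<tau> m k) t))
         = (\<Sum>l\<le>?n. ?d l * (indicator {arrival x l..} (\<tau> m k) * (b (\<tau> m (Suc k)) - b (\<tau> m k))))"
        unfolding jump_path_eq_sum[OF x \<tau>t(1) count_arrivals_mono[OF x k(1)], of h f i] min_absorb1[OF k(1)] min_absorb1[OF k(2)]
          sum_distrib_right mult.assoc by (simp only:)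
    qed
    also have "\<dots> = (\<Sum>l\<le>?n. ?d l * (\<Sum>k<Suc m. indicator {arrival x l..} (\<tau> m k) * (b (\<tau> m (Suc k)) - b (\<tau> m k))))"
      by (subst sum.swap) (simp only: sum_distrib_left)
    finally show ?thesis .
  qed
  moreover have "(\<lambda>m. \<Sum>l\<le>?n. ?d l * (\<Sum>k<Suc m. indicator {arrival x l..} (\<tau> m k) * (b (\<tau> m (Suc k)) - b (\<tau> m k))))
     \<longlonglongrightarrow> (\<Sum>l\<le>?n. ?d l * (b t - b (arrival x l)))"
  proof (intro tendsto_sum tendsto_mult tendsto_const)
    fix l assume "l \<in> {..?n}"
    then show "(\<lambda>m. \<Sum>k<Suc m. indicator {arrival x l..} (\<tau> m k) * (b (\<tau> m (Suc k)) - b (\<tau> m k))) \<longlonglongrightarrow> b t - b (arrival x l)"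
      unfolding \<tau>_def using arrival_le_iff_count[OF x, of t l] t
      by (intro grid_sum_tendsto[OF b t]) (auto intro: proper_arrivals_nonneg[OF x])
  qed
  ultimately show ?thesis by (simp add: path_integral_def)
qed

lemma simple_process_grid:
  fixes \<xi> :: "nat \<Rightarrow> 'w \<Rightarrow> real"
  assumes \<tau>: "incseq \<tau>" and k: "k < n" and s: "\<tau> k < s" "s \<le> \<tau> (Suc k)"
  shows "simple_process n \<tau> \<xi> s \<omega> = \<xi> k \<omega>"
proof -
  have e: "indicator {\<tau> l<..\<tau> (Suc l)} s = (if l = k then 1 else 0 :: real)" for l
  proof (cases l k rule: linorder_cases)
    case less
    then have "\<tau> (Suc l) \<le> \<tau> k" using incseqD[OF \<tau>, of "Suc l" k] by simp
    then show ?thesis using less s by (auto simp: indicator_def)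
  next
    case greater
    then have "\<tau> (Suc k) \<le> \<tau> l" using incseqD[OF \<tau>, of "Suc k" l] by simp
    then show ?thesis using greater s by (auto simp: indicator_def)
  qed (use s in \<open>auto simp: indicator_def\<close>)
  show ?thesis unfolding simple_process_def e using k by (simp add: if_distrib cong: if_cong)
qed

text \<open>The approximating simple processes take the value at the left end of a cell, so
  constancy just before \<open>s\<close> is what matters; it can fail only at an arrival.\<close>

lemma jump_path_left_constant:
  assumes x: "proper_arrivals x" and s: "0 \<le> s" and ns: "\<And>l. s \<noteq> arrival x l"
  shows "\<exists>d>0. \<forall>r. 0 \<le> r \<and> s - d < r \<and> r \<le> s \<longrightarrow> jump_path f i x r = jump_path f i x s"
proof (intro exI[of _ "s - arrival x (count_arrivals x s)"] conjI allI impI)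
  note b = count_arrivals_bounds[OF x s]
  then show "0 < s - arrival x (count_arrivals x s)" using ns[of "count_arrivals x s"] by auto
  fix r assume "0 \<le> r \<and> s - (s - arrival x (count_arrivals x s)) < r \<and> r \<le> s"
  then have "count_arrivals x r = count_arrivals x s"
    using b by (intro count_arrivals_eq x) auto
  then show "jump_path f i x r = jump_path f i x s" by (simp add: jump_path_def)
qed

text \<open>Away from the countably many arrivals, the left grid point of the cell of
  \<open>s\<close> eventually carries the same state as \<open>s\<close>, and the error is zero.
  Boundedness of \<open>h\<close> gives dominated convergence.\<close>

lemma simple_process_L2_tendsto:
  fixes h :: "'s::countable \<Rightarrow> real"
  assumes x: "proper_arrivals x" and t: "0 \<le> t" and C: "\<And>j. \<bar>h j\<bar> \<le> C"
  defines "\<tau> \<equiv> \<lambda>m k. real k * t / real (Suc m)"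
  shows "(\<lambda>m. LINT s:{0..t}|lborel. (h (jump_path f i x s) - simple_process (Suc m) (\<tau> m) (\<lambda>k _. h (jump_path f i x (\<tau> m k))) s \<omega>)\<^sup>2) \<longlonglongrightarrow> 0"
proof -
  let ?H = "\<lambda>s. h (jump_path f i x s)" and ?S = "\<lambda>m s. simple_process (Suc m) (\<tau> m) (\<lambda>k _. h (jump_path f i x (\<tau> m k))) s \<omega>"
  have H [measurable]: "?H \<in> borel_measurable borel"
    by (rule measurable_compose[OF measurable_jump_path_time[OF x]]) simp
  have S [measurable]: "?S m \<in> borel_measurable borel" for m
    unfolding simple_process_def by measurable
  have inc: "incseq (\<tau> m)" for m
    using t by (auto simp: incseq_def \<tau>_def intro!: divide_right_mono mult_right_mono)
  have \<tau>0: "0 \<le> \<tau> m k" for m k using t by (simp add: \<tau>_def)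
  have cell: "\<exists>k<Suc m. \<tau> m k < s \<and> s \<le> \<tau> m (Suc k)" if s: "0 < s" "s \<le> t" for m s
  proof -
    have t: "0 < t" using s by simp
    \<comment> \<open>The cells are open on the left and closed on the right, hence the ceiling
      minus one.\<close>
    define k where "k = nat (\<lceil>s * real (Suc m) / t\<rceil> - 1)"
    have p: "0 < s * real (Suc m) / t" using s t by simp
    then have "1 \<le> \<lceil>s * real (Suc m) / t\<rceil>" by linarith
    then have k: "real k = of_int \<lceil>s * real (Suc m) / t\<rceil> - 1" by (simp add: k_def)
    have k1: "real k < s * real (Suc m) / t" and k2: "s * real (Suc m) / t \<le> real (Suc k)"
      unfolding of_nat_Suc k by linarith+
    have "s * real (Suc m) / t \<le> t * real (Suc m) / t" using s t by (intro divide_right_mono mult_right_mono) auto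
    then have "real k < real (Suc m)" using k1 t by simp
    then have "k < Suc m" by (simp only: of_nat_less_iff)
    moreover have "\<tau> m k < s" "s \<le> \<tau> m (Suc k)"
      using k1 k2 t by (simp_all add: \<tau>_def field_simps del: of_nat_Suc)
    ultimately show ?thesis by auto
  qed
  have "\<forall>l. AE s in lborel. s \<noteq> arrival x l"
    by (intro allI AE_lborel_singleton)
  then have "AE s in lborel. \<forall>l. s \<noteq> arrival x l"
    by (rule AE_all_countable[THEN iffD2])
  then have conv: "AE s in lborel. (\<lambda>m. indicator {0..t} s *\<^sub>R (?H s - ?S m s)\<^sup>2) \<longlonglongrightarrow> 0"
  proof eventually_elim
    case (elim s)
    show ?case
    proof (cases "s \<in> {0..t}")
      case True
      moreover have "s \<noteq> 0" using elim[rule_format, of 0] by simp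
      ultimately have s: "0 < s" "s \<le> t" by auto
      obtain d where d: "d > 0" "\<And>r. 0 \<le> r \<Longrightarrow> s - d < r \<Longrightarrow> r \<le> s \<Longrightarrow> jump_path f i x r = jump_path f i x s"
        using jump_path_left_constant[OF x, of s f i] elim[rule_format] s by auto
      have "(\<lambda>m. t / real (Suc m)) \<longlonglongrightarrow> 0" by real_asymp
      from order_tendstoD(2)[OF this d(1)]
      have "eventually (\<lambda>m. indicator {0..t} s *\<^sub>R (?H s - ?S m s)\<^sup>2 = 0) sequentially"
      proof eventually_elim
        case (elim m)
        obtain k where k: "k < Suc m" "\<tau> m k < s" "s \<le> \<tau> m (Suc k)" using cell[OF s] by blast
        have "\<tau> m (Suc k) = \<tau> m k + t / real (Suc m)" by (simp add: \<tau>_def distrib_right add_divide_distrib)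
        then have "s - d < \<tau> m k" using k elim by linarith
        then have "jump_path f i x (\<tau> m k) = jump_path f i x s" using d(2)[OF \<tau>0] k by auto
        then show ?case by (simp add: simple_process_grid[OF inc k])
      qed
      then show ?thesis by (rule tendsto_eventually)
    qed simp
  qed
  have bnd: "\<bar>?S m s\<bar> \<le> C" if s: "0 \<le> s" "s \<le> t" for m s
  proof (cases "s = 0")
    case True
    have "?S m s = 0" unfolding simple_process_def True using \<tau>0
      by (intro sum.neutral) (auto simp: indicator_def not_less)
    then show ?thesis using C[of undefined] by linarith
  next
    case False
    then obtain k where "k < Suc m" "\<tau> m k < s" "s \<le> \<tau> m (Suc k)" using cell[of s m] s by auto
    then show ?thesis using C by (simp add: simple_process_grid[OF inc])
  qed
  have "(\<lambda>m. LINT s|lborel. indicator {0..t} s *\<^sub>R (?H s - ?S m s)\<^sup>2) \<longlonglongrightarrow> (LINT s|(lborel :: real measure). (0::real))"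
  proof (rule integral_dominated_convergence[where w="\<lambda>s. indicator {0..t} s *\<^sub>R (2 * C)\<^sup>2"])
    show "integrable lborel (\<lambda>s. indicator {0..t} s *\<^sub>R (2 * C)\<^sup>2)"
      using set_integrable_bounded_Icc[of "\<lambda>_. (2 * C)\<^sup>2" "(2 * C)\<^sup>2" 0 t] unfolding set_integrable_def by simp
    show "AE s in lborel. norm (indicator {0..t} s *\<^sub>R (?H s - ?S m s)\<^sup>2) \<le> indicator {0..t} s *\<^sub>R (2 * C)\<^sup>2" for m
    proof (intro AE_I2)
      fix s
      have "(?H s - ?S m s)\<^sup>2 \<le> (2 * C)\<^sup>2" if "s \<in> {0..t}"
        using bnd[of s m] C[of "jump_path f i x s"] that by (intro abs_le_square_iff[THEN iffD1]) auto
      then show "norm (indicator {0..t} s *\<^sub>R (?H s - ?S m s)\<^sup>2) \<le> indicator {0..t} s *\<^sub>R (2 * C)\<^sup>2"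
        by (auto simp: indicator_def)
    qed
  qed (use conv in auto)
  then show ?thesis by (simp add: set_lebesgue_integral_def)
qed

lemma converges_in_probability_pointwise:
  assumes M: "prob_space M" and X [measurable]: "\<And>m. X m \<in> borel_measurable M" and Y [measurable]: "Y \<in> borel_measurable M"
    and lim: "\<And>\<omega>. \<omega> \<in> space M \<Longrightarrow> (\<lambda>m. X m \<omega>) \<longlonglongrightarrow> Y \<omega>"
  shows "converges_in_probability M X Y"
  unfolding converges_in_probability_def
proof (intro allI impI)
  interpret prob_space M by fact
  fix \<epsilon> :: real assume \<epsilon>: "0 < \<epsilon>"
  let ?A = "\<lambda>m. {\<omega> \<in> space M. \<epsilon> < \<bar>X m \<omega> - Y \<omega>\<bar>}"
  have "(\<lambda>m. expectation (indicator (?A m) :: _ \<Rightarrow> real)) \<longlonglongrightarrow> expectation (\<lambda>_. 0)"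
  proof (rule integral_dominated_convergence[where w="\<lambda>_. 1"])
    show "AE \<omega> in M. (\<lambda>m. indicator (?A m) \<omega> :: real) \<longlonglongrightarrow> 0"
    proof (intro AE_I2)
      fix \<omega> assume "\<omega> \<in> space M"
      from tendstoD[OF lim[OF this] \<epsilon>]
      have "eventually (\<lambda>m. indicator (?A m) \<omega> = (0::real)) sequentially"
        by eventually_elim (auto simp: indicator_def dist_real_def)
      then show "(\<lambda>m. indicator (?A m) \<omega> :: real) \<longlonglongrightarrow> 0" by (rule tendsto_eventually)
    qed
  qed (auto simp: indicator_def)
  then show "(\<lambda>m. prob (?A m)) \<longlonglongrightarrow> 0" by simp
qed

text \<open>The integrand is sampled at left grid points, which keeps the simple processes adapted
  and bounded. Both required limits hold for every outcome, hence in probability.\<close>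

theorem has_ito_integral_path_integral:
  fixes h :: "'s::finite \<Rightarrow> real" and f :: "'s \<Rightarrow> 'u \<Rightarrow> 's"
  assumes B: "standard_brownian_motion M B"
    and x: "\<And>\<omega>. \<omega> \<in> space M \<Longrightarrow> proper_arrivals (X \<omega>)"
    and arr: "\<And>n. (\<lambda>\<omega>. arrival (X \<omega>) n) \<in> borel_measurable M"
    and st: "\<And>n. (\<lambda>\<omega>. embedded_state f (I \<omega>) (X \<omega>) n) \<in> measurable M (count_space UNIV)"
    and t: "0 \<le> t"
  defines "J \<equiv> \<lambda>s \<omega>. jump_path f (I \<omega>) (X \<omega>) s"
  shows "has_ito_integral M (joint_filtration M B J) B (\<lambda>s \<omega>. h (J s \<omega>)) t
    (\<lambda>\<omega>. path_integral f (I \<omega>) (X \<omega>) h (\<lambda>s. B s \<omega>) t)"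
proof -
  have M: "prob_space M" and Bm: "\<And>s. 0 \<le> s \<Longrightarrow> B s \<in> borel_measurable M"
    and Bc: "\<And>\<omega>. \<omega> \<in> space M \<Longrightarrow> continuous_on {0..} (\<lambda>t. B t \<omega>)"
    using B by (auto simp: standard_brownian_motion_def)
  interpret prob_space M by fact
  define C where "C = (\<Sum>j\<in>UNIV. \<bar>h j\<bar>)"
  have C: "\<bar>h j\<bar> \<le> C" for j unfolding C_def by (rule member_le_sum) auto
  define \<tau> where "\<tau> m k = real k * t / real (Suc m)" for m k :: nat
  define \<xi> where "\<xi> m k \<omega> = h (J (\<tau> m k) \<omega>)" for m k \<omega>
  have \<tau>0: "0 \<le> \<tau> m k" for m k using t by (simp add: \<tau>_def)
  have Jm: "J s \<in> measurable M (count_space UNIV)" for s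
    unfolding J_def by (rule measurable_jump_path[OF x arr st]) auto
  have Jjoint: "(\<lambda>w. J (fst w) (snd w)) \<in> measurable (N \<Otimes>\<^sub>M M) (count_space UNIV)" if N: "(\<lambda>s. s) \<in> measurable N borel" for N :: "real measure"
    unfolding J_def
    by (rule measurable_jump_path)
      (auto simp: space_pair_measure intro!: x measurable_compose[OF measurable_snd arr] measurable_compose[OF measurable_snd st] measurable_compose[OF measurable_fst N])
  have hJ: "(\<lambda>\<omega>. h (J s \<omega>)) \<in> borel_measurable (joint_filtration M B J r)" if "0 \<le> s" "s \<le> r" for s r
  proof (rule measurableI)
    fix A :: "real set" assume "A \<in> sets borel"
    have "(\<lambda>\<omega>. h (J s \<omega>)) -` A \<inter> space M = J s -` (h -` A) \<inter> space M" by auto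
    let ?G = "{B s -` A \<inter> space M |s A. 0 \<le> s \<and> s \<le> r \<and> A \<in> sets borel} \<union> {J s -` A \<inter> space M |s A. 0 \<le> s \<and> s \<le> r}"
    have G: "?G \<subseteq> Pow (space M)" by auto
    have "J s -` (h -` A) \<inter> space M \<in> ?G" using that by blast
    with \<open>(\<lambda>\<omega>. h (J s \<omega>)) -` A \<inter> space M = _\<close>
    show "(\<lambda>\<omega>. h (J s \<omega>)) -` A \<inter> space (joint_filtration M B J r) \<in> sets (joint_filtration M B J r)"
      unfolding joint_filtration_def sets_measure_of[OF G] space_measure_of[OF G] by (auto intro: sigma_sets.Basic)
  qed simp
  have pi_lim: "(\<lambda>m. simple_integral B (Suc m) (\<tau> m) (\<xi> m) t \<omega>) \<longlonglongrightarrow> path_integral f (I \<omega>) (X \<omega>) h (\<lambda>s. B s \<omega>) t"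
    if "\<omega> \<in> space M" for \<omega>
    using Riemann_sum_path_integral[OF x[OF that] t Bc[OF that], of h f "I \<omega>"]
    by (simp add: simple_integral_def \<xi>_def J_def \<tau>_def)
  have si_m: "(\<lambda>\<omega>. simple_integral B (Suc m) (\<tau> m) (\<xi> m) t \<omega>) \<in> borel_measurable M" for m
  proof -
    have [measurable]: "\<xi> m k \<in> borel_measurable M" for k
      unfolding \<xi>_def[abs_def] by (rule measurable_compose[OF Jm]) simp
    have [measurable]: "B (min (\<tau> m k) t) \<in> borel_measurable M" for k
      using \<tau>0 t by (intro Bm) simp
    show ?thesis unfolding simple_integral_def by measurable
  qed
  have pi_m: "(\<lambda>\<omega>. path_integral f (I \<omega>) (X \<omega>) h (\<lambda>s. B s \<omega>) t) \<in> borel_measurable M"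
    by (rule borel_measurable_LIMSEQ_real[OF pi_lim si_m])
  show ?thesis
    unfolding has_ito_integral_def
  proof (intro conjI ballI)
    have "(\<lambda>w. h (J (fst w) (snd w))) \<in> borel_measurable (restrict_space borel {0..t} \<Otimes>\<^sub>M M)"
      by (rule measurable_compose[OF Jjoint]) (auto intro: measurable_restrict_space1)
    then show "(\<lambda>(s, \<omega>). h (J s \<omega>)) \<in> borel_measurable (restrict_space borel {0..t} \<Otimes>\<^sub>M M)"
      by (simp add: split_beta')
    show "(\<lambda>\<omega>. h (J s \<omega>)) \<in> borel_measurable (joint_filtration M B J s)" if "s \<in> {0..t}" for s
      using that by (intro hJ) auto
    show "AE \<omega> in M. set_integrable lborel {0..t} (\<lambda>s. (h (J s \<omega>))\<^sup>2)"
    proof (intro AE_I2 set_integrable_bounded_Icc)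
      fix \<omega> assume \<omega>: "\<omega> \<in> space M"
      have "(\<lambda>s. h (J s \<omega>)) \<in> borel_measurable borel"
        unfolding J_def by (rule measurable_compose[OF measurable_jump_path_time[OF x[OF \<omega>]]]) simp
      then show "(\<lambda>s. (h (J s \<omega>))\<^sup>2) \<in> borel_measurable borel" by measurable
      show "\<bar>(h (J s \<omega>))\<^sup>2\<bar> \<le> C\<^sup>2" for s
        using C[of "J s \<omega>"] by (simp add: abs_le_square_iff[symmetric])
    qed
    show "\<exists>n \<tau> \<xi>. (\<forall>m. simple_integrand M (joint_filtration M B J) (n m) (\<tau> m) (\<xi> m)) \<and>
        converges_in_probability M (\<lambda>m \<omega>. LINT s:{0..t}|lborel. (h (J s \<omega>) - simple_process (n m) (\<tau> m) (\<xi> m) s \<omega>)\<^sup>2) (\<lambda>\<omega>. 0) \<and>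
        converges_in_probability M (\<lambda>m. simple_integral B (n m) (\<tau> m) (\<xi> m) t) (\<lambda>\<omega>. path_integral f (I \<omega>) (X \<omega>) h (\<lambda>s. B s \<omega>) t)"
    proof (intro exI[of _ Suc] exI[of _ \<tau>] exI[of _ \<xi>] conjI allI)
      show "simple_integrand M (joint_filtration M B J) (Suc m) (\<tau> m) (\<xi> m)" for m
        unfolding simple_integrand_def
      proof (intro conjI allI impI)
        show "incseq (\<tau> m)"
          using t by (auto simp: incseq_def \<tau>_def intro!: divide_right_mono mult_right_mono)
        show "\<xi> m k \<in> borel_measurable (joint_filtration M B J (\<tau> m k))" for k
          unfolding \<xi>_def[abs_def] using \<tau>0 by (intro hJ) auto
        show "\<exists>C. \<forall>k<Suc m. \<forall>\<omega>\<in>space M. \<bar>\<xi> m k \<omega>\<bar> \<le> C"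
          using C by (auto simp: \<xi>_def)
      qed (rule \<tau>0)
      show "converges_in_probability M (\<lambda>m. simple_integral B (Suc m) (\<tau> m) (\<xi> m) t) (\<lambda>\<omega>. path_integral f (I \<omega>) (X \<omega>) h (\<lambda>s. B s \<omega>) t)"
        by (rule converges_in_probability_pointwise[OF M si_m pi_m pi_lim])
      show "converges_in_probability M (\<lambda>m \<omega>. LINT s:{0..t}|lborel. (h (J s \<omega>) - simple_process (Suc m) (\<tau> m) (\<xi> m) s \<omega>)\<^sup>2) (\<lambda>\<omega>. 0)"
      proof (rule converges_in_probability_pointwise[OF M])
        fix m
        have [measurable]: "(\<lambda>w. h (J (fst w) (snd w))) \<in> borel_measurable (lborel \<Otimes>\<^sub>M M)"
          by (rule measurable_compose[OF Jjoint]) auto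
        have swap: "(\<lambda>w. (snd w, fst w)) \<in> measurable (M \<Otimes>\<^sub>M lborel) (lborel \<Otimes>\<^sub>M M)" by measurable
        have [measurable]: "(\<lambda>w. h (J (snd w) (fst w))) \<in> borel_measurable (M \<Otimes>\<^sub>M lborel)"
          using measurable_compose[OF swap, of "\<lambda>w. h (J (fst w) (snd w))" borel] by simp
        have [measurable]: "\<xi> m k \<in> borel_measurable M" for k
          unfolding \<xi>_def[abs_def] by (rule measurable_compose[OF Jm]) simp
        show "(\<lambda>\<omega>. LINT s:{0..t}|lborel. (h (J s \<omega>) - simple_process (Suc m) (\<tau> m) (\<xi> m) s \<omega>)\<^sup>2) \<in> borel_measurable M"
          unfolding set_lebesgue_integral_def simple_process_def
          by (rule lborel.borel_measurable_lebesgue_integral) (unfold split_beta', measurable)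
      next
        fix \<omega> assume \<omega>: "\<omega> \<in> space M"
        show "(\<lambda>m. LINT s:{0..t}|lborel. (h (J s \<omega>) - simple_process (Suc m) (\<tau> m) (\<xi> m) s \<omega>)\<^sup>2) \<longlonglongrightarrow> 0"
          using simple_process_L2_tendsto[OF x[OF \<omega>] t, of h C f "I \<omega>" \<omega>] C
          by (simp add: simple_process_def \<xi>_def J_def \<tau>_def)
      qed simp
    qed
  qed (rule pi_m)
qed

section \<open>The telegraph approximation of Brownian motion\<close>

fun flip :: "sign \<Rightarrow> unit \<Rightarrow> sign" where
  "flip Plus u = Minus"
| "flip Minus u = Plus"

fun sign_value :: "sign \<Rightarrow> real" where
  "sign_value Plus = 1"
| "sign_value Minus = - 1"

abbreviation unmarked :: "(nat \<Rightarrow> real) \<Rightarrow> nat \<Rightarrow> real \<times> unit" where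
  "unmarked g k \<equiv> (g k, ())"

definition telegraph :: "real \<Rightarrow> (nat \<Rightarrow> real) \<Rightarrow> real \<Rightarrow> real" where
  "telegraph c g t = (LINT s:{0..t}|lborel. c * sign_value (jump_path flip Plus (unmarked g) s))"

definition flip_intensity :: "real \<Rightarrow> real ^ sign ^ sign" where
  "flip_intensity l = (\<chi> i j. if i = j then - l else l)"

text \<open>Every arrival flips the sign, so the embedded chain is deterministic and the marks carry
  no information.\<close>

lemma uniformized_chain_flip:
  assumes "0 < l"
  shows "uniformized_chain l (return (count_space UNIV) ()) flip (\<chi> i j. if i = j then 0 else 1) (flip_intensity l)"
proof (rule uniformized_chain.intro)
  let ?U = "return (count_space UNIV) () :: unit measure"
  show "prob_space ?U" by (rule prob_space_return) simp
  show "flip i \<in> measurable ?U (count_space UNIV)" for i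
    unfolding measurable_cong_sets[OF sets_return refl] by simp
  show "(\<chi> i j. if i = j then 0 else 1) $ i $ j = measure ?U {u \<in> space ?U. flip i u = j}" for i j :: sign
  proof -
    have "{u \<in> space ?U. flip i u = j} = (if i = j then {} else UNIV)"
      by (cases i; cases j) auto
    then show ?thesis by (simp add: measure_return)
  qed
  show "flip_intensity l $ i $ j = l * ((\<chi> i j. if i = j then 0 else 1) $ i $ j - (if i = j then 1 else 0))" for i j :: sign
    by (simp add: flip_intensity_def)
qed (rule assms)

lemma iid_unmarked:
  assumes M: "prob_space M" and l: "0 < l" and G: "iid M (exponential_measure l) G"
  shows "iid M (exponential_measure l \<Otimes>\<^sub>M return (count_space UNIV) ()) (\<lambda>\<omega>. unmarked (G \<omega>))"
proof (rule iid_map[OF prob_space_exponential_density[OF l] G M])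
  let ?E = "exponential_measure l" and ?U = "return (count_space UNIV) () :: unit measure"
  interpret E: prob_space ?E using l by (rule prob_space_exponential_density)
  interpret U: prob_space ?U by (rule prob_space_return) simp
  show m: "(\<lambda>x. (x, ())) \<in> measurable ?E (?E \<Otimes>\<^sub>M ?U)"
    by (rule measurable_Pair) auto
  show "distr ?E (?E \<Otimes>\<^sub>M ?U) (\<lambda>x. (x, ())) = ?E \<Otimes>\<^sub>M ?U"
  proof (rule pair_measure_eqI[symmetric])
    fix A and B :: "unit set" assume A: "A \<in> sets ?E" and B: "B \<in> sets ?U"
    have "B = {} \<or> B = {()}" by auto
    then show "emeasure ?E A * emeasure ?U B = emeasure (distr ?E (?E \<Otimes>\<^sub>M ?U) (\<lambda>x. (x, ()))) (A \<times> B)"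
    proof
      assume B: "B = {()}"
      have "(\<lambda>x. (x, ())) -` (A \<times> B) \<inter> space ?E = A" using sets.sets_into_space[OF A] B by auto
      then show ?thesis using A B by (subst emeasure_distr[OF m]) auto
    qed simp
  qed (unfold_locales, simp)
qed

lemma arrival_unmarked: "arrival (unmarked g) n = arrival_time g n"
  by (simp add: arrival_def arrival_time_def)

lemma embedded_state_flip: "embedded_state flip Plus (unmarked g) k = (if even k then Plus else Minus)"
  by (induction k) auto

text \<open>Moving the end point by one gap adds the gap length to every term, and the coefficients
  telescope to the value of \<open>h\<close> at the current state.\<close>

lemma path_integral_arrival_Suc:
  assumes x: "proper_arrivals x"
  shows "path_integral f i x h (\<lambda>r. r) (arrival x (Suc m)) = path_integral f i x h (\<lambda>r. r) (arrival x m) + fst (x m) * h (embedded_state f i x m)"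
proof -
  have count: "count_arrivals x (arrival x k) = k" for k
    using x by (intro count_arrivals_eq) (auto simp: arrival_Suc proper_arrivals_def)
  have "path_integral f i x h (\<lambda>r. r) (arrival x (Suc m)) = (\<Sum>l\<le>m. jump_coeff h f i x l * (arrival x m - arrival x l) + fst (x m) * jump_coeff h f i x l)"
    unfolding path_integral_def count by (simp add: arrival_Suc algebra_simps)
  also have "\<dots> = path_integral f i x h (\<lambda>r. r) (arrival x m) + fst (x m) * h (embedded_state f i x m)"
    unfolding sum.distrib path_integral_def count sum_distrib_left[symmetric] sum_jump_coeff ..
  finally show ?thesis .
qed

lemma measurable_sign_value_path [measurable]:
  assumes "proper_arrivals x"
  shows "(\<lambda>s. c * sign_value (jump_path flip i x s)) \<in> borel_measurable borel"
  by (rule measurable_compose[OF measurable_jump_path_time[OF assms]]) simp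

lemma abs_sign_value: "\<bar>sign_value e\<bar> = 1"
  by (cases e) auto

text \<open>Signs alternate starting from \<open>Plus\<close>, so a cycle adds its up duration and
  subtracts its down duration. Cycle ends are singled out because there the position meets the
  Brownian path.\<close>

lemma telegraph_arrival:
  assumes g: "proper_arrivals (unmarked g)"
  shows "telegraph c g (arrival_time g (2 * k)) = (\<Sum>j<k. c * (g (2 * j) - g (Suc (2 * j))))"
proof -
  let ?x = "unmarked g"
  have eq: "telegraph c g t = c * path_integral flip Plus ?x sign_value (\<lambda>r. r) t" if t: "0 \<le> t" for t
  proof -
    have "telegraph c g t = (LINT s:{0..t}|lborel. sign_value (jump_path flip Plus ?x s) * c)"
      by (simp add: telegraph_def mult.commute)
    also have "\<dots> = path_integral flip Plus ?x sign_value (\<lambda>r. LINT s:{0..r}|lborel. c) t"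
      by (rule set_integral_path_integral[OF g t, of _ "\<bar>c\<bar>"]) auto
    also have "\<dots> = path_integral flip Plus ?x sign_value (\<lambda>r. c * r) t"
      unfolding path_integral_def using t proper_arrivals_nonneg[OF g]
      by (intro sum.cong refl) (simp add: set_lebesgue_integral_def mult.commute)
    also have "\<dots> = c * path_integral flip Plus ?x sign_value (\<lambda>r. r) t"
      by (simp add: path_integral_def sum_distrib_left algebra_simps)
    finally show ?thesis .
  qed
  have "path_integral flip Plus ?x sign_value (\<lambda>r. r) (arrival ?x (2 * k)) = (\<Sum>j<k. g (2 * j) - g (Suc (2 * j)))"
  proof (induction k)
    case 0
    have "count_arrivals ?x 0 = 0"
      using g by (intro count_arrivals_eq) (auto simp: arrival_Suc proper_arrivals_def)
    then show ?case by (simp add: path_integral_def)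
  next
    case (Suc k)
    have "path_integral flip Plus ?x sign_value (\<lambda>r. r) (arrival ?x (2 * Suc k)) = path_integral flip Plus ?x sign_value (\<lambda>r. r) (arrival ?x (2 * k)) + g (2 * k) - g (Suc (2 * k))"
      using path_integral_arrival_Suc[OF g, of flip Plus sign_value "2 * k"] path_integral_arrival_Suc[OF g, of flip Plus sign_value "Suc (2 * k)"]
      by (simp add: embedded_state_flip del: embedded_state.simps)
    with Suc show ?case by simp
  qed
  then show ?thesis
    using eq[of "arrival ?x (2 * k)"] proper_arrivals_nonneg[OF g] by (simp add: arrival_unmarked sum_distrib_left)
qed

lemma telegraph_Lipschitz:
  assumes g: "proper_arrivals (unmarked g)" and c: "0 \<le> c" and st: "0 \<le> s" "s \<le> t"
  shows "\<bar>telegraph c g t - telegraph c g s\<bar> \<le> c * (t - s)"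
proof -
  let ?y = "\<lambda>s. c * sign_value (jump_path flip Plus (unmarked g) s)"
  have b: "\<bar>?y r\<bar> \<le> c" for r using c by (simp add: abs_mult abs_sign_value)
  have "set_integrable lborel {0..r} ?y" for r
    by (rule set_integrable_bounded_Icc[OF measurable_sign_value_path[OF g] b])
  then have i: "integrable lborel (\<lambda>r. indicator {0..q} r *\<^sub>R ?y r)" for q by (simp add: set_integrable_def)
  have "\<bar>telegraph c g t - telegraph c g s\<bar> = \<bar>LINT r|lborel. indicator {0..t} r *\<^sub>R ?y r - indicator {0..s} r *\<^sub>R ?y r\<bar>"
    unfolding telegraph_def set_lebesgue_integral_def by (subst Bochner_Integration.integral_diff[OF i i]) simp
  also have "\<dots> \<le> (LINT r|lborel. \<bar>indicator {0..t} r *\<^sub>R ?y r - indicator {0..s} r *\<^sub>R ?y r\<bar>)"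
    by (rule integral_abs_bound)
  also have "\<dots> \<le> (LINT r|lborel. indicator {s..t} r *\<^sub>R c)"
  proof (rule integral_mono)
    show "integrable lborel (\<lambda>r. \<bar>indicator {0..t} r *\<^sub>R ?y r - indicator {0..s} r *\<^sub>R ?y r\<bar>)"
      by (intro integrable_abs Bochner_Integration.integrable_diff i)
    show "integrable lborel (\<lambda>r. indicator {s..t} r *\<^sub>R c)"
      using set_integrable_bounded_Icc[of "\<lambda>_. c" c s t] c by (simp add: set_integrable_def)
    fix r
    show "\<bar>indicator {0..t} r *\<^sub>R ?y r - indicator {0..s} r *\<^sub>R ?y r\<bar> \<le> indicator {s..t} r *\<^sub>R c"
      using st c b[of r] by (auto simp: indicator_def)
  qed
  also have "\<dots> = c * (t - s)" using st by simp
  finally show ?thesis .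
qed

section \<open>Comparison of two random clocks\<close>

text \<open>Both clocks are controlled at finitely many rational times; monotonicity in the index
  squeezes every other index between two neighbouring ones.\<close>

lemma time_change:
  fixes u v :: "nat \<Rightarrow> nat \<Rightarrow> real" and L :: "nat \<Rightarrow> real" and K :: nat
  assumes u: "\<And>n. mono (u n)" and v: "\<And>n. mono (v n)"
    and gu: "\<And>a b::nat. 0 < b \<Longrightarrow> (\<lambda>n. u n (nat \<lfloor>real a / real b * L n\<rfloor>)) \<longlonglongrightarrow> real a / real b"
    and gv: "\<And>a b::nat. 0 < b \<Longrightarrow> (\<lambda>n. v n (nat \<lfloor>real a / real b * L n\<rfloor>)) \<longlonglongrightarrow> real a / real b"
    and \<delta>: "0 < \<delta>"
  shows "eventually (\<lambda>n. \<forall>k t. u n k \<le> t \<and> t \<le> u n (Suc k) \<and> t \<le> real K \<longrightarrow>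
     \<bar>v n k - t\<bar> \<le> \<delta> \<and> k < nat \<lfloor>(real K + 1) * L n\<rfloor>) sequentially"
proof -
  \<comment> \<open>The final error is below \<open>1 / real N + 2 * \<eta>\<close>, hence below
    \<open>3 * \<eta>\<close>. The bound \<open>1 / 2\<close> guarantees that the clock
    \<open>u\<close> has passed \<open>K\<close> at the last grid index, which stands for time
    \<open>K + 1\<close>.\<close>
  define \<eta> where "\<eta> = min (\<delta> / 3) (1 / 2)"
  have \<eta>: "0 < \<eta>" "\<eta> \<le> \<delta> / 3" "\<eta> \<le> 1 / 2" using \<delta> by (auto simp: \<eta>_def)
  obtain N where N: "0 < N" "1 / real N < \<eta>" using \<eta>(1) by (metis nat_approx_posE zero_less_Suc)
  define J where "J = (K + 1) * N"
  define \<kappa> where "\<kappa> n j = nat \<lfloor>real j / real N * L n\<rfloor>" for n j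
  have "eventually (\<lambda>n. \<forall>j\<in>{..J}. dist (u n (\<kappa> n j)) (real j / real N) < \<eta> \<and> dist (v n (\<kappa> n j)) (real j / real N) < \<eta>) sequentially"
    unfolding \<kappa>_def by (intro eventually_ball_finite ballI eventually_conj tendstoD[OF gu[OF N(1)] \<eta>(1)] tendstoD[OF gv[OF N(1)] \<eta>(1)]) simp
  then show ?thesis
  proof eventually_elim
    case (elim n)
    have gu: "real j / real N - \<eta> < u n (\<kappa> n j)" "u n (\<kappa> n j) < real j / real N + \<eta>"
      and gv: "real j / real N - \<eta> < v n (\<kappa> n j)" "v n (\<kappa> n j) < real j / real N + \<eta>" if "j \<le> J" for j
      using bspec[OF elim, of j] that by (auto simp: dist_real_def abs_less_iff)
    have JN: "real J / real N = real K + 1" using N by (simp add: J_def field_simps)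
    show ?case
    proof (intro allI impI, elim conjE)
      fix k t assume t: "u n k \<le> t" "t \<le> u n (Suc k)" "t \<le> real K"
      have kJ: "k < \<kappa> n J"
      proof (rule ccontr)
        assume "\<not> k < \<kappa> n J"
        then have "u n (\<kappa> n J) \<le> u n k" using monoD[OF u] by simp
        then show False using gu(1)[of J] t \<eta> JN by simp
      qed
      \<comment> \<open>The least grid index beyond \<open>k\<close> and its predecessor bracket
        \<open>k\<close>.\<close>
      define m where "m = (LEAST j. k < \<kappa> n j)"
      have m: "k < \<kappa> n m" unfolding m_def using kJ by (rule LeastI)
      have mJ: "m \<le> J" unfolding m_def using kJ by (rule Least_le)
      have "m \<noteq> 0" using m by (intro notI) (simp add: \<kappa>_def)
      then obtain j where j: "m = Suc j" by (cases m) auto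
      have "\<not> k < \<kappa> n j" using not_less_Least[of j "\<lambda>j. k < \<kappa> n j"] j by (simp add: m_def)
      then have jk: "\<kappa> n j \<le> k" by simp
      have r: "real m / real N = real j / real N + 1 / real N" by (simp add: j add_divide_distrib)
      have "real j / real N - \<eta> < t" using gu(1)[of j] monoD[OF u jk, of n] t mJ j by simp
      moreover have "t < real m / real N + \<eta>" using gu(2)[of m] monoD[OF u, of "Suc k" "\<kappa> n m" n] m t mJ by simp
      moreover have "real j / real N - \<eta> < v n k" using gv(1)[of j] monoD[OF v jk, of n] mJ j by simp
      moreover have "v n k < real m / real N + \<eta>" using gv(2)[of m] monoD[OF v, of k "\<kappa> n m" n] m mJ by simp
      ultimately have "\<bar>v n k - t\<bar> \<le> \<delta>" using r N \<eta> by linarith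
      then show "\<bar>v n k - t\<bar> \<le> \<delta> \<and> k < nat \<lfloor>(real K + 1) * L n\<rfloor>"
        using kJ by (simp add: \<kappa>_def JN)
    qed
  qed
qed

text \<open>At cycle ends \<open>X\<close> equals \<open>B\<close> read on the other clock. Inside a
  cycle \<open>X\<close> moves by at most speed times cycle length, which is small, and uniform
  continuity of \<open>B\<close> absorbs the difference of the clocks.\<close>

lemma zigzag_limit:
  fixes u v X :: "nat \<Rightarrow> _" and L c :: "nat \<Rightarrow> real" and K :: nat and B :: "real \<Rightarrow> real"
  assumes u: "\<And>n. mono (u n)" and v: "\<And>n. mono (v n)" and u0: "\<And>n. u n 0 = (0::real)" and v0: "\<And>n. v n 0 = (0::real)"
    and unb: "\<And>n t. \<exists>k::nat. t < u n k"
    and gu: "\<And>a b::nat. 0 < b \<Longrightarrow> (\<lambda>n. u n (nat \<lfloor>real a / real b * L n\<rfloor>)) \<longlonglongrightarrow> real a / real b"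
    and gv: "\<And>a b::nat. 0 < b \<Longrightarrow> (\<lambda>n. v n (nat \<lfloor>real a / real b * L n\<rfloor>)) \<longlonglongrightarrow> real a / real b"
    and B: "continuous_on {0..} B" and c: "\<And>n. 0 \<le> c n"
    and lip: "\<And>n s t. 0 \<le> s \<Longrightarrow> s \<le> t \<Longrightarrow> \<bar>X n t - X n s\<bar> \<le> c n * (t - s)"
    and XB: "\<And>n k. X n (u n k) = B (v n k)"
    and small: "\<And>\<delta>. 0 < \<delta> \<Longrightarrow> eventually (\<lambda>n. \<forall>k<nat \<lfloor>(real K + 1) * L n\<rfloor>. c n * (u n (Suc k) - u n k) \<le> \<delta>) sequentially"
    and e: "0 < e"
  shows "eventually (\<lambda>n. \<forall>t\<in>{0..real K}. \<bar>X n t - B t\<bar> \<le> e) sequentially"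
proof -
  have "uniformly_continuous_on {0..real K + 1} B"
    by (intro compact_uniformly_continuous continuous_on_subset[OF B]) auto
  then obtain d where d: "0 < d" "\<And>s t. s \<in> {0..real K + 1} \<Longrightarrow> t \<in> {0..real K + 1} \<Longrightarrow> dist s t < d \<Longrightarrow> dist (B s) (B t) < e / 2"
    using e unfolding uniformly_continuous_on_def by (metis half_gt_zero)
  \<comment> \<open>The bound \<open>1\<close> keeps \<open>v n k\<close> in
    \<open>[0, K + 1]\<close>, where uniform continuity was taken; half of \<open>d\<close> makes
    the distance strictly smaller than \<open>d\<close>.\<close>
  define \<delta> where "\<delta> = min (d / 2) 1"
  have \<delta>: "0 < \<delta>" "\<delta> < d" "\<delta> \<le> 1" using d by (auto simp: \<delta>_def)
  have e2: "0 < e / 2" using e by simp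
  have "eventually (\<lambda>n. \<forall>k t. u n k \<le> t \<and> t \<le> u n (Suc k) \<and> t \<le> real K \<longrightarrow>
     \<bar>v n k - t\<bar> \<le> \<delta> \<and> k < nat \<lfloor>(real K + 1) * L n\<rfloor>) sequentially"
    by (rule time_change[OF u v gu gv \<delta>(1)])
  from this small[OF e2]
  show ?thesis
  proof eventually_elim
    case (elim n)
    show ?case
    proof
      fix t assume t: "t \<in> {0..real K}"
      define m where "m = (LEAST k. t < u n k)"
      obtain k0 where "t < u n k0" using unb by blast
      then have m: "t < u n m" unfolding m_def by (rule LeastI)
      have "m \<noteq> 0" using m t u0[of n] by (intro notI) simp
      then obtain k where k: "m = Suc k" by (cases m) auto
      have "\<not> t < u n k" using not_less_Least[of k "\<lambda>k. t < u n k"] k by (simp add: m_def)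
      then have uk: "u n k \<le> t" "t \<le> u n (Suc k)" using m k by auto
      have vk: "\<bar>v n k - t\<bar> \<le> \<delta>" and kL: "k < nat \<lfloor>(real K + 1) * L n\<rfloor>" using elim(1) uk t by auto
      have uk0: "0 \<le> u n k" and vk0: "0 \<le> v n k" using monoD[OF u, of 0 k n] monoD[OF v, of 0 k n] u0[of n] v0[of n] by auto
      have "\<bar>X n t - X n (u n k)\<bar> \<le> c n * (t - u n k)" by (rule lip[OF uk0 uk(1)])
      also have "\<dots> \<le> c n * (u n (Suc k) - u n k)" using uk c[of n] by (intro mult_left_mono) auto
      also have "\<dots> \<le> e / 2" using elim(2) kL by auto
      finally have 1: "\<bar>X n t - B (v n k)\<bar> \<le> e / 2" by (simp add: XB)
      have "dist (B (v n k)) (B t) < e / 2"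
        using vk vk0 \<delta> t by (intro d(2)) (auto simp: dist_real_def)
      then show "\<bar>X n t - B t\<bar> \<le> e" using 1 unfolding dist_real_def by linarith
    qed
  qed
qed

lemma floor_ratio_tendsto:
  assumes L: "filterlim L at_top sequentially" and x: "0 \<le> x"
  shows "(\<lambda>n. real (nat \<lfloor>x * L n\<rfloor>) / L n) \<longlonglongrightarrow> x"
proof (rule tendsto_sandwich)
  have "eventually (\<lambda>n. 0 < L n) sequentially" using L by (rule filterlim_at_top_dense[THEN iffD1, rule_format])
  then have b: "eventually (\<lambda>n. x - 1 / L n \<le> real (nat \<lfloor>x * L n\<rfloor>) / L n \<and> real (nat \<lfloor>x * L n\<rfloor>) / L n \<le> x) sequentially"
  proof eventually_elim
    case (elim n)
    have q: "x * L n - 1 \<le> real (nat \<lfloor>x * L n\<rfloor>)" "real (nat \<lfloor>x * L n\<rfloor>) \<le> x * L n"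
      using elim x by (auto simp: of_nat_nat)
    have "(x * L n - 1) / L n \<le> real (nat \<lfloor>x * L n\<rfloor>) / L n" "real (nat \<lfloor>x * L n\<rfloor>) / L n \<le> x * L n / L n"
      using divide_right_mono[OF q(1), of "L n"] divide_right_mono[OF q(2), of "L n"] elim by (simp_all only: less_imp_le)
    moreover have "(x * L n - 1) / L n = x - 1 / L n" "x * L n / L n = x"
      using elim by (simp_all add: diff_divide_distrib)
    ultimately show ?case by (intro conjI) (simp_all only:)
  qed
  then show "eventually (\<lambda>n. x - 1 / L n \<le> real (nat \<lfloor>x * L n\<rfloor>) / L n) sequentially"
    "eventually (\<lambda>n. real (nat \<lfloor>x * L n\<rfloor>) / L n \<le> x) sequentially"
    by (auto elim: eventually_mono)
  have "(\<lambda>n. 1 / L n) \<longlonglongrightarrow> 0" using tendsto_inverse_0_at_top[OF L] by (simp add: inverse_eq_divide)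
  from tendsto_diff[OF tendsto_const this, of x] show "(\<lambda>n. x - 1 / L n) \<longlonglongrightarrow> x" by simp
qed simp

section \<open>Almost sure estimates for sums and maxima of exponential variables\<close>

lemma iid_exponential_distributed:
  assumes M: "prob_space M" and l: "0 < l" and G: "iid M (exponential_measure l) G"
  shows "distributed M lborel (\<lambda>\<omega>. G \<omega> k) (exponential_density l)"
    and "prob_space.indep_vars M (\<lambda>_. borel) (\<lambda>k \<omega>. G \<omega> k) (UNIV :: nat set)"
proof -
  interpret prob_space M by fact
  have E: "prob_space (exponential_measure l)" using l by (rule prob_space_exponential_density)
  have m: "(\<lambda>\<omega>. G \<omega> k) \<in> borel_measurable M" for k using iid_coord_measurable[OF G] by simp
  have "distr M lborel (\<lambda>\<omega>. G \<omega> k) = distr M (exponential_measure l) (\<lambda>\<omega>. G \<omega> k)"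
    by (intro distr_cong) auto
  then show "distributed M lborel (\<lambda>\<omega>. G \<omega> k) (exponential_density l)"
    using iid_distr_coord[OF G E] m l by (simp add: distributed_def)
  show "indep_vars (\<lambda>_. borel) (\<lambda>k \<omega>. G \<omega> k) UNIV"
    using iid_indep_vars[OF M E G] unfolding indep_vars_def2 by simp
qed

text \<open>The gap sequences change with \<open>n\<close>, so this is a law of large numbers for a
  triangular array: the Erlang variance is at most \<open>C / l n\<close>, and summability of
  \<open>1 / l n\<close> feeds Chebyshev and Borel-Cantelli.\<close>

lemma AE_arrival_time_tendsto:
  fixes G :: "nat \<Rightarrow> 'w \<Rightarrow> nat \<Rightarrow> real"
  assumes M: "prob_space M" and l: "\<And>n. 0 < l n" and G: "\<And>n. iid M (exponential_measure (l n)) (G n)"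
    and sl: "summable (\<lambda>n. 1 / l n)" and q: "(\<lambda>n. real (q n) / l n) \<longlonglongrightarrow> x" and qC: "\<And>n. real (q n) / l n \<le> C"
  shows "AE \<omega> in M. (\<lambda>n. arrival_time (G n \<omega>) (q n)) \<longlonglongrightarrow> x"
proof -
  interpret prob_space M by fact
  let ?A = "\<lambda>n \<omega>. arrival_time (G n \<omega>) (q n)"
  have [measurable]: "(\<lambda>\<omega>. G n \<omega> k) \<in> borel_measurable M" for n k using iid_coord_measurable[OF G] by simp
  have A [measurable]: "?A n \<in> borel_measurable M" for n unfolding arrival_time_def by measurable
  have cheb: "prob {\<omega> \<in> space M. \<delta> \<le> \<bar>?A n \<omega> - real (q n) / l n\<bar>} \<le> C / \<delta>\<^sup>2 * (1 / l n)" if \<delta>: "0 < \<delta>" for n \<delta>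
  \<comment> \<open>The Erlang index is \<open>q n - 1\<close>, so the empty sum is treated on its
    own.\<close>
  proof (cases "q n = 0")
    case True
    have "0 \<le> C" using qC[of n] True by simp
    then show ?thesis using \<delta> l[of n] True by (simp add: arrival_time_def)
  next
    case False
    then have "distributed M lborel (\<lambda>\<omega>. \<Sum>k\<in>{..<q n}. G n \<omega> k) (erlang_density (card {..<q n} - 1) (l n))"
      using iid_exponential_distributed[OF M l G, of n] l
      by (intro exponential_distributed_sum indep_vars_subset[OF iid_exponential_distributed(2)[OF M l G]]) auto
    then have D: "distributed M lborel (?A n) (erlang_density (q n - 1) (l n))"
      by (simp add: arrival_time_def)
    have E: "expectation (?A n) = real (q n) / l n"
      using erlang_ith_moment[OF l D, of 1] False by (simp add: fact_reduce)
    have V: "variance (?A n) = real (q n) / (l n)\<^sup>2"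
      using erlang_distributed_variance[OF l D] False by simp
    have "prob {\<omega> \<in> space M. \<delta> \<le> \<bar>?A n \<omega> - expectation (?A n)\<bar>} \<le> variance (?A n) / \<delta>\<^sup>2"
      by (rule Chebyshev_inequality[OF A erlang_ith_moment_integrable[OF l D] \<delta>])
    also have "\<dots> = real (q n) / l n * (1 / \<delta>\<^sup>2 * (1 / l n))"
      unfolding V by (simp add: power2_eq_square)
    also have "\<dots> \<le> C * (1 / \<delta>\<^sup>2 * (1 / l n))"
      using qC[of n] l[of n] by (intro mult_right_mono) auto
    finally show ?thesis by (simp add: E)
  qed
  have "AE \<omega> in M. eventually (\<lambda>n. \<bar>?A n \<omega> - real (q n) / l n\<bar> < 1 / real (Suc N)) sequentially" for N
  proof -
    have "AE \<omega> in M. eventually (\<lambda>n. \<omega> \<in> space M - {\<omega> \<in> space M. 1 / real (Suc N) \<le> \<bar>?A n \<omega> - real (q n) / l n\<bar>}) sequentially"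
    proof (rule borel_cantelli_AE1)
      show "summable (\<lambda>n. prob {\<omega> \<in> space M. 1 / real (Suc N) \<le> \<bar>?A n \<omega> - real (q n) / l n\<bar>})"
      proof (rule summable_comparison_test')
        show "summable (\<lambda>n. C / (1 / real (Suc N))\<^sup>2 * (1 / l n))" by (intro summable_mult sl)
        show "norm (prob {\<omega> \<in> space M. 1 / real (Suc N) \<le> \<bar>?A n \<omega> - real (q n) / l n\<bar>}) \<le> C / (1 / real (Suc N))\<^sup>2 * (1 / l n)" for n
          using cheb[of "1 / real (Suc N)" n] by simp
      qed
    qed (auto simp: emeasure_eq_measure)
    then show ?thesis by eventually_elim (auto elim!: eventually_mono)
  qed
  then have "AE \<omega> in M. \<forall>N. eventually (\<lambda>n. \<bar>?A n \<omega> - real (q n) / l n\<bar> < 1 / real (Suc N)) sequentially"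
    by (simp only: AE_all_countable) simp
  then show ?thesis
  proof eventually_elim
    case (elim \<omega>)
    have "(\<lambda>n. ?A n \<omega> - real (q n) / l n) \<longlonglongrightarrow> 0"
    proof (rule tendstoI)
      fix e :: real assume "0 < e"
      then obtain N where "1 / real (Suc N) < e" by (rule nat_approx_posE)
      then show "eventually (\<lambda>n. dist (?A n \<omega> - real (q n) / l n) 0 < e) sequentially"
        using elim[rule_format, of N] by (auto elim!: eventually_mono simp: dist_real_def)
    qed
    from tendsto_add[OF this q] show ?case by simp
  qed
qed

text \<open>A gap of rate \<open>4 ^ n\<close> exceeds \<open>d / 2 ^ n\<close> with probability
  \<open>exp (- (d * 2 ^ n))\<close>, which outweighs the number \<open>K * 4 ^ n\<close> of gaps.
  Multiplied by the speed \<open>2 ^ n\<close>, this says that no single run carries the particle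
  far.\<close>

lemma AE_exponential_small:
  fixes G :: "nat \<Rightarrow> 'w \<Rightarrow> nat \<Rightarrow> real"
  assumes M: "prob_space M" and G: "\<And>n. iid M (exponential_measure (4 ^ n)) (G n)"
  shows "AE \<omega> in M. \<forall>K N. eventually (\<lambda>n. \<forall>j<K * 4 ^ n. 2 ^ n * G n \<omega> j \<le> 1 / real (Suc N)) sequentially"
proof -
  interpret prob_space M by fact
  have [measurable]: "(\<lambda>\<omega>. G n \<omega> k) \<in> borel_measurable M" for n k using iid_coord_measurable[OF G] by simp
  have "AE \<omega> in M. eventually (\<lambda>n. \<omega> \<in> space M - (\<Union>j<K * 4 ^ n. {\<omega> \<in> space M. 1 / real (Suc N) / 2 ^ n < G n \<omega> j})) sequentially" for K N :: nat
  proof (rule borel_cantelli_AE1)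
    let ?d = "1 / real (Suc N)"
    have p: "prob {\<omega> \<in> space M. ?d / 2 ^ n < G n \<omega> j} = exp (- (?d * 2 ^ n))" for n j
    proof -
      have "(2::real) ^ n * 2 ^ n = 4 ^ n" by (simp add: power_mult_distrib[symmetric])
      moreover have "?d / 2 ^ n * (2 ^ n * 2 ^ n) = ?d * 2 ^ n" by simp
      ultimately have "?d / 2 ^ n * 4 ^ n = ?d * 2 ^ n" by simp
      then show ?thesis
        using exponential_distributedD_gt[OF iid_exponential_distributed(1)[OF M _ G, of n j], of "?d / 2 ^ n"] by simp
    qed
    show "summable (\<lambda>n. prob (\<Union>j<K * 4 ^ n. {\<omega> \<in> space M. ?d / 2 ^ n < G n \<omega> j}))"
    proof (rule summable_comparison_test')
      have d: "0 < ?d" by simp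
      have "(\<lambda>n. real K * 4 ^ n * exp (- (?d * 2 ^ n))) \<in> O(\<lambda>n. (1 / 2) ^ n)"
        using d by real_asymp
      then show "summable (\<lambda>n. real K * 4 ^ n * exp (- (?d * 2 ^ n)))"
        by (rule summable_comparison_test_bigo[rotated]) (simp add: summable_geometric)
      fix n :: nat assume "n \<ge> 0"
      have "prob (\<Union>j<K * 4 ^ n. {\<omega> \<in> space M. ?d / 2 ^ n < G n \<omega> j}) \<le> (\<Sum>j<K * 4 ^ n. prob {\<omega> \<in> space M. ?d / 2 ^ n < G n \<omega> j})"
        by (rule measure_UNION_le) auto
      also have "\<dots> = real K * 4 ^ n * exp (- (?d * 2 ^ n))" unfolding p by simp
      finally show "norm (prob (\<Union>j<K * 4 ^ n. {\<omega> \<in> space M. ?d / 2 ^ n < G n \<omega> j})) \<le> real K * 4 ^ n * exp (- (?d * 2 ^ n))" by simp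
    qed
  qed (auto simp: emeasure_eq_measure)
  then have "AE \<omega> in M. \<forall>K N. eventually (\<lambda>n. \<omega> \<in> space M - (\<Union>j<K * 4 ^ n. {\<omega> \<in> space M. 1 / real (Suc N) / 2 ^ n < G n \<omega> j})) sequentially"
    by (intro AE_all_countable[THEN iffD2] allI)
  then show ?thesis
  proof eventually_elim
    case (elim \<omega>)
    show ?case
    proof (intro allI)
      fix K N
      have "eventually (\<lambda>n. \<omega> \<in> space M - (\<Union>j<K * 4 ^ n. {\<omega> \<in> space M. 1 / real (Suc N) / 2 ^ n < G n \<omega> j})) sequentially"
        using elim by blast
      then show "eventually (\<lambda>n. \<forall>j<K * 4 ^ n. 2 ^ n * G n \<omega> j \<le> 1 / real (Suc N)) sequentially"
      proof eventually_elim
        case (elim n)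
        then have "G n \<omega> j \<le> 1 / real (Suc N) / 2 ^ n" if "j < K * 4 ^ n" for j
          using that by (auto simp: not_less)
        then show ?case by (simp add: field_simps del: of_nat_Suc)
      qed
    qed
  qed
qed

text \<open>Attaching trivial marks makes the gaps an input of the flip chain, so non-explosion
  transfers.\<close>

lemma AE_proper_unmarked:
  assumes l: "0 < l"
  shows "AE g in seq_measure (exponential_measure l). proper_arrivals (unmarked g)"
proof -
  interpret uniformized_chain l "return (count_space UNIV) ()" flip "\<chi> i j. if i = j then 0 else 1" "flip_intensity l"
    by (rule uniformized_chain_flip[OF l])
  have E: "prob_space (exponential_measure l)" using l by (rule prob_space_exponential_density)
  have iid: "iid (seq_measure (exponential_measure l)) N unmarked"
    by (rule iid_unmarked[OF prob_space_seq_measure[OF E] l iid_seq_measure])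
  have d: "distr (seq_measure (exponential_measure l)) S unmarked = S"
    using iid unfolding iid_def by (rule conjunct2)
  have "AE x in distr (seq_measure (exponential_measure l)) S unmarked. proper_arrivals x"
    unfolding d by (rule AE_proper_arrivals)
  from AE_distrD[OF iid_measurable[OF iid] this] show ?thesis .
qed

text \<open>Cycle ends of the telegraph process form the clock \<open>u\<close>, sampling times of
  Brownian motion the clock \<open>v\<close>; after the same rescaling of the index both tend to the
  identity. One almost sure event serves all \<open>K\<close> and \<open>e\<close>.\<close>

theorem telegraph_tendsto_levy_path:
  fixes X Y :: "nat \<Rightarrow> 'w \<Rightarrow> nat \<Rightarrow> real" and Z :: "'w \<Rightarrow> nat \<Rightarrow> real"
  defines "G \<equiv> \<lambda>n \<omega>. zigzag_gap (2 ^ n) (sampled_increment (X n \<omega>) (Z \<omega>)) (Y n \<omega>)"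
  assumes M: "prob_space M"
    and X: "\<And>n. iid M (exponential_measure ((2 ^ n)\<^sup>2 / 2)) (X n)" and G: "\<And>n. iid M (exponential_measure ((2 ^ n)\<^sup>2)) (G n)"
    and reg: "\<And>\<omega>. \<omega> \<in> space M \<Longrightarrow> regular_dyadic (Z \<omega>)"
  shows "AE \<omega> in M. \<forall>K::nat. \<forall>e>0. eventually (\<lambda>n. \<forall>t\<in>{0..real K}. \<bar>telegraph (2 ^ n) (G n \<omega>) t - levy_path (Z \<omega>) t\<bar> \<le> e) sequentially"
proof -
  interpret prob_space M by fact
  \<comment> \<open>The number of cycles per unit of time on either clock: samples arrive at rate
    \<open>4 ^ n / 2\<close>, and a cycle consists of two gaps of rate \<open>4 ^ n\<close>.\<close>
  define L where "L n = (4 ^ n / 2 :: real)" for n :: nat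
  have sq: "((2::real) ^ n)\<^sup>2 = 4 ^ n" for n by (simp add: power2_eq_square power_mult_distrib[symmetric])
  have Lt: "filterlim L at_top sequentially" unfolding L_def by real_asymp
  have L0: "0 < L n" for n by (simp add: L_def)
  have G4: "iid M (exponential_measure (4 ^ n)) (G n)" and XL: "iid M (exponential_measure (L n)) (X n)" for n
    using G[of n] X[of n] by (simp_all add: sq L_def)
  have sumL: "summable (\<lambda>n. 1 / L n)" and sum4: "summable (\<lambda>n. 1 / (4 ^ n :: real))"
    unfolding L_def using summable_geometric[of "1 / 4 :: real"] summable_mult[OF summable_geometric[of "1 / 4 :: real"], of 2]
    by (simp_all add: power_one_over divide_simps)
  have fl: "real (nat \<lfloor>x * L n\<rfloor>) / L n \<le> x" if "0 \<le> x" for x n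
  proof -
    have "real (nat \<lfloor>x * L n\<rfloor>) \<le> x * L n" using that L0[of n] by simp
    then show ?thesis using L0[of n] by (simp add: field_simps)
  qed
  have gX: "AE \<omega> in M. (\<lambda>n. arrival_time (X n \<omega>) (nat \<lfloor>real a / real b * L n\<rfloor>)) \<longlonglongrightarrow> real a / real b" for a b :: nat
    by (rule AE_arrival_time_tendsto[OF M L0 XL sumL floor_ratio_tendsto[OF Lt] fl]) auto
  have gG: "AE \<omega> in M. (\<lambda>n. arrival_time (G n \<omega>) (2 * nat \<lfloor>real a / real b * L n\<rfloor>)) \<longlonglongrightarrow> real a / real b" for a b :: nat
  proof (rule AE_arrival_time_tendsto[OF M _ G4 sum4])
    have e: "real (2 * m) / 4 ^ n = real m / L n" for m n by (simp add: L_def)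
    show "(\<lambda>n. real (2 * nat \<lfloor>real a / real b * L n\<rfloor>) / 4 ^ n) \<longlonglongrightarrow> real a / real b"
      unfolding e by (rule floor_ratio_tendsto[OF Lt]) simp
    show "real (2 * nat \<lfloor>real a / real b * L n\<rfloor>) / 4 ^ n \<le> real a / real b" for n
      unfolding e by (rule fl) simp
  qed simp
  have E4: "AE \<omega> in M. proper_arrivals (unmarked (G n \<omega>))" for n
  proof -
    have d: "distr M (seq_measure (exponential_measure (4 ^ n))) (G n) = seq_measure (exponential_measure (4 ^ n))"
      using G4[of n] unfolding iid_def by (rule conjunct2)
    have "AE g in distr M (seq_measure (exponential_measure (4 ^ n))) (G n). proper_arrivals (unmarked g)"
      unfolding d by (rule AE_proper_unmarked) simp
    from AE_distrD[OF iid_measurable[OF G4] this] show ?thesis .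
  qed
  have Xpos: "AE \<omega> in M. \<forall>k. 0 < X n \<omega> k" for n
  proof -
    have d: "distr M (seq_measure (exponential_measure (L n))) (X n) = seq_measure (exponential_measure (L n))"
      using XL[of n] unfolding iid_def by (rule conjunct2)
    have "AE g in distr M (seq_measure (exponential_measure (L n))) (X n). \<forall>k. 0 < g k"
      unfolding d by (rule AE_exponential_pos[OF L0])
    from AE_distrD[OF iid_measurable[OF XL] this] show ?thesis .
  qed
  have a1: "AE \<omega> in M. \<forall>a b. (\<lambda>n. arrival_time (X n \<omega>) (nat \<lfloor>real a / real b * L n\<rfloor>)) \<longlonglongrightarrow> real a / real b"
    by (intro AE_all_countable[THEN iffD2] allI gX)
  have a2: "AE \<omega> in M. \<forall>a b. (\<lambda>n. arrival_time (G n \<omega>) (2 * nat \<lfloor>real a / real b * L n\<rfloor>)) \<longlonglongrightarrow> real a / real b"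
    by (intro AE_all_countable[THEN iffD2] allI gG)
  have a3: "AE \<omega> in M. \<forall>n. proper_arrivals (unmarked (G n \<omega>))"
    by (intro AE_all_countable[THEN iffD2] allI E4)
  have a4: "AE \<omega> in M. \<forall>n k. 0 < X n \<omega> k"
    by (rule AE_all_countable[THEN iffD2]) (intro allI Xpos)
  from a1 a2 a3 a4 AE_exponential_small[OF M G4] AE_space
  show ?thesis
  proof eventually_elim
    case (elim \<omega>)
    define u where "u n k = arrival_time (G n \<omega>) (2 * k)" for n k
    define v where "v n k = arrival_time (X n \<omega>) k" for n k
    have pr: "proper_arrivals (unmarked (G n \<omega>))" for n using elim(3) by simp
    have Gpos: "0 < G n \<omega> k" for n k using pr[of n] by (auto simp: proper_arrivals_def)
    have mG: "mono (arrival_time (G n \<omega>))" for n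
      unfolding mono_iff_le_Suc arrival_time_def using Gpos by (simp add: less_imp_le)
    show ?case
    proof (intro allI impI)
      fix K :: nat and e :: real assume e: "0 < e"
      show "eventually (\<lambda>n. \<forall>t\<in>{0..real K}. \<bar>telegraph (2 ^ n) (G n \<omega>) t - levy_path (Z \<omega>) t\<bar> \<le> e) sequentially"
      proof (rule zigzag_limit[where u=u and v=v and L=L and c="\<lambda>n. 2 ^ n"])
        show "mono (u n)" for n
          using mG[of n] by (auto simp: u_def mono_def)
        show "mono (v n)" for n
          unfolding v_def mono_iff_le_Suc arrival_time_def using elim(4) by (simp add: less_imp_le)
        show "u n 0 = 0" "v n 0 = 0" for n by (auto simp: u_def v_def arrival_time_def)
        show "\<exists>k. t < u n k" for n t
        proof -
          obtain k where "t < arrival_time (G n \<omega>) k"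
            using pr[of n] by (auto simp: proper_arrivals_def arrival_unmarked)
          also have "\<dots> \<le> u n k" unfolding u_def by (rule monoD[OF mG]) simp
          finally show ?thesis ..
        qed
        show "(\<lambda>n. u n (nat \<lfloor>real a / real b * L n\<rfloor>)) \<longlonglongrightarrow> real a / real b"
          "(\<lambda>n. v n (nat \<lfloor>real a / real b * L n\<rfloor>)) \<longlonglongrightarrow> real a / real b" for a b :: nat
          using elim(1,2) by (auto simp: u_def v_def)
        show "continuous_on {0..} (levy_path (Z \<omega>))"
          using elim(6) by (intro continuous_on_levy_path reg)
        show "\<bar>telegraph (2 ^ n) (G n \<omega>) t - telegraph (2 ^ n) (G n \<omega>) s\<bar> \<le> 2 ^ n * (t - s)" if "0 \<le> s" "s \<le> t" for n s t
          by (rule telegraph_Lipschitz[OF pr _ that]) simp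
        show "telegraph (2 ^ n) (G n \<omega>) (u n k) = levy_path (Z \<omega>) (v n k)" for n k
        proof -
          \<comment> \<open>The additional exponential variable cancels, and
            \<open>max l 0 - max (- l) 0 = l\<close>.\<close>
          have "2 ^ n * (G n \<omega> (2 * j) - G n \<omega> (Suc (2 * j))) = sampled_increment (X n \<omega>) (Z \<omega>) j" for j
            by (simp add: G_def zigzag_gap_def interleave_def max_def field_simps)
          then have "telegraph (2 ^ n) (G n \<omega>) (u n k) = (\<Sum>j<k. sampled_increment (X n \<omega>) (Z \<omega>) j)"
            by (simp add: u_def telegraph_arrival[OF pr])
          also have "\<dots> = levy_path (Z \<omega>) (v n k) - levy_path (Z \<omega>) (v n 0)"
            unfolding sampled_increment_def v_def by (rule sum_lessThan_telescope)
          finally show ?thesis by (simp add: v_def arrival_time_def levy_path_0)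
        qed
        fix \<delta> :: real assume "0 < \<delta>"
        then have "0 < \<delta> / 2" by simp
        then obtain N where N: "1 / real (Suc N) < \<delta> / 2" by (rule nat_approx_posE)
        have "eventually (\<lambda>n. \<forall>j<(K + 1) * 4 ^ n. 2 ^ n * G n \<omega> j \<le> 1 / real (Suc N)) sequentially"
          using elim(5) by blast
        then show "eventually (\<lambda>n. \<forall>k<nat \<lfloor>(real K + 1) * L n\<rfloor>. 2 ^ n * (u n (Suc k) - u n k) \<le> \<delta>) sequentially"
        proof eventually_elim
          case (elim n)
          show ?case
          proof (intro allI impI)
            fix k assume "k < nat \<lfloor>(real K + 1) * L n\<rfloor>"
            \<comment> \<open>Cycle \<open>k\<close> consists of the gaps \<open>2 * k\<close> and
              \<open>2 * k + 1\<close>, and both indices have to stay below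
              \<open>(K + 1) * 4 ^ n\<close>.\<close>
            then have "real k + 1 \<le> (real K + 1) * L n" by linarith
            then have "real (2 * k + 2) \<le> real ((K + 1) * 4 ^ n)" by (simp add: L_def algebra_simps)
            then have "2 * k + 2 \<le> (K + 1) * 4 ^ n" by (simp only: of_nat_le_iff)
            then have "2 ^ n * G n \<omega> (2 * k) \<le> 1 / real (Suc N)" "2 ^ n * G n \<omega> (Suc (2 * k)) \<le> 1 / real (Suc N)"
              using elim by auto
            moreover have "u n (Suc k) - u n k = G n \<omega> (2 * k) + G n \<omega> (Suc (2 * k))"
              by (simp add: u_def arrival_time_def)
            ultimately show "2 ^ n * (u n (Suc k) - u n k) \<le> \<delta>"
              using N by (simp add: distrib_left)
          qed
        qed
      qed (use e in auto)
    qed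
  qed
qed

section \<open>Assembly on a product space\<close>

text \<open>Cantor pairing splits one sequence of reals into countably many, so that a product
  measure over \<open>nat\<close> can carry all ingredients.\<close>

definition component :: "nat \<Rightarrow> (nat \<Rightarrow> real) \<Rightarrow> nat \<Rightarrow> real" where
  "component a \<omega> k = \<omega> (prod_encode (a, k))"

definition blocks :: "nat set \<Rightarrow> nat set" where
  "blocks A = {i. fst (prod_decode i) \<in> A}"

abbreviation block_measure :: "(nat \<Rightarrow> real measure) \<Rightarrow> nat set \<Rightarrow> (nat \<Rightarrow> real) measure" where
  "block_measure D A \<equiv> Pi\<^sub>M (blocks A) (\<lambda>i. D (fst (prod_decode i)))"

lemma blocks_UNIV: "blocks UNIV = UNIV"
  by (simp add: blocks_def)

lemma component_restrict [simp]: "a \<in> A \<Longrightarrow> component a (restrict \<omega> (blocks A)) = component a \<omega>"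
  by (auto simp: component_def blocks_def)

lemma measurable_component_coord:
  assumes "\<And>a. sets (D a) = sets borel" "a \<in> A"
  shows "(\<lambda>\<omega>. component a \<omega> k) \<in> borel_measurable (block_measure D A)"
proof -
  have "(\<lambda>\<omega>. \<omega> (prod_encode (a, k))) \<in> measurable (block_measure D A) (D (fst (prod_decode (prod_encode (a, k)))))"
    using assms(2) by (intro measurable_component_singleton) (simp add: blocks_def)
  then show ?thesis
    using assms(1)[of a] by (simp add: component_def measurable_cong_sets[OF refl assms(1)])
qed

lemma measurable_component:
  assumes "\<And>a. sets (D a) = sets borel" "a \<in> A"
  shows "component a \<in> measurable (block_measure D A) (seq_measure borel)"
  by (rule measurable_PiM_single') (auto intro: measurable_component_coord[OF assms])

lemma iid_component:
  assumes D: "\<And>a. prob_space (D a)"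
  shows "iid (block_measure D UNIV) (D a) (component a)"
proof -
  let ?D = "\<lambda>i. D (fst (prod_decode i))"
  have "distr (Pi\<^sub>M UNIV ?D) (Pi\<^sub>M UNIV (\<lambda>k. ?D (prod_encode (a, k)))) (\<lambda>\<omega>. \<lambda>k\<in>UNIV. \<omega> (prod_encode (a, k))) = Pi\<^sub>M UNIV (\<lambda>k. ?D (prod_encode (a, k)))"
    by (rule distr_PiM_reindex) (auto simp: D inj_on_def)
  then have d: "distr (Pi\<^sub>M UNIV ?D) (seq_measure (D a)) (component a) = seq_measure (D a)"
    by (simp add: component_def[abs_def] restrict_UNIV)
  have "(\<lambda>\<omega>. \<omega> (prod_encode (a, k))) \<in> measurable (Pi\<^sub>M UNIV ?D) (?D (prod_encode (a, k)))" for k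
    by (rule measurable_component_singleton) simp
  then have "component a \<in> measurable (Pi\<^sub>M UNIV ?D) (seq_measure (D a))"
    unfolding component_def[abs_def] by (intro measurable_PiM_single') (auto dest: measurable_space)
  with d show ?thesis by (simp add: iid_def blocks_UNIV)
qed

lemma independent_pair_blocks:
  assumes D: "\<And>a. prob_space (D a)" and AB: "A \<inter> B = {}"
    and g: "g \<in> measurable (block_measure D A) G" and h: "h \<in> measurable (block_measure D B) H"
    and gr: "\<And>\<omega>. g (restrict \<omega> (blocks A)) = g \<omega>" and hr: "\<And>\<omega>. h (restrict \<omega> (blocks B)) = h \<omega>"
  shows "independent_pair (block_measure D UNIV) G g H h"
proof -
  have "blocks A \<inter> blocks B = {}" using AB by (auto simp: blocks_def)
  from independent_pair_coordinates[OF D this g h]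
  show ?thesis by (simp add: gr hr blocks_UNIV)
qed

section \<open>Pairs of independent jump processes\<close>

lemma limitin_discrete_topology_UNIV:
  "limitin (discrete_topology UNIV) g l F \<longleftrightarrow> eventually (\<lambda>x. g x = l) F"
proof
  assume "limitin (discrete_topology UNIV) g l F"
  then have "\<forall>U. openin (discrete_topology UNIV) U \<and> l \<in> U \<longrightarrow> eventually (\<lambda>x. g x \<in> U) F"
    by (simp add: limitin_def)
  from this[rule_format, of "{l}"] show "eventually (\<lambda>x. g x = l) F" by simp
next
  assume e: "eventually (\<lambda>x. g x = l) F"
  have "eventually (\<lambda>x. g x \<in> U) F" if "l \<in> U" for U
    using e by eventually_elim (simp add: that)
  then show "limitin (discrete_topology UNIV) g l F" by (simp add: limitin_def)
qed

lemma markov_jump_process_right_continuous: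
  assumes "markov_jump_process M p Q J" "0 \<le> t" "\<omega> \<in> space M"
  shows "limitin (discrete_topology UNIV) (\<lambda>s. J s \<omega>) (J t \<omega>) (at_right t)"
proof -
  have "\<forall>\<omega>\<in>space M. \<forall>t\<ge>0. limitin (discrete_topology UNIV) (\<lambda>s. J s \<omega>) (J t \<omega>) (at_right t)"
    using assms(1) unfolding markov_jump_process_def by (elim conjE)
  then show ?thesis using assms(2,3) by (elim ballE allE impE) auto
qed

lemma markov_jump_process_transition:
  assumes "markov_jump_process M p Q J" "0 \<le> t 0 \<and> incseq t"
  shows "measure M {\<omega> \<in> space M. \<forall>k\<le>Suc n. J (t k) \<omega> = i k} =
    measure M {\<omega> \<in> space M. \<forall>k\<le>n. J (t k) \<omega> = i k} * transition_matrix Q (t (Suc n) - t n) $ i n $ i (Suc n)"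
proof -
  have "\<forall>n (t :: nat \<Rightarrow> real) i. 0 \<le> t 0 \<and> incseq t \<longrightarrow> measure M {\<omega> \<in> space M. \<forall>k\<le>Suc n. J (t k) \<omega> = i k} =
    measure M {\<omega> \<in> space M. \<forall>k\<le>n. J (t k) \<omega> = i k} * transition_matrix Q (t (Suc n) - t n) $ i n $ i (Suc n)"
    using assms(1) unfolding markov_jump_process_def by (elim conjE)
  from this[rule_format, OF assms(2)] show ?thesis .
qed

text \<open>Finite-dimensional distributions factor over the two independent paths, and the
  exponential of a Kronecker sum is the product of the exponentials, so the two Markov properties
  multiply.\<close>

lemma markov_jump_process_pair:
  fixes J1 :: "real \<Rightarrow> 'w \<Rightarrow> 'a::finite" and J2 :: "real \<Rightarrow> 'w \<Rightarrow> 'b::finite"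
  assumes 1: "markov_jump_process M p A J1" and 2: "markov_jump_process M q B J2"
    and ind: "independent_pair M (Pi\<^sub>M {0..} (\<lambda>_. count_space UNIV)) (\<lambda>\<omega>. \<lambda>t\<in>{0..}. J1 t \<omega>)
      (Pi\<^sub>M {0..} (\<lambda>_. count_space UNIV)) (\<lambda>\<omega>. \<lambda>t\<in>{0..}. J2 t \<omega>)"
  shows "markov_jump_process M (pair_pmf p q) (kronecker_sum A B) (\<lambda>t \<omega>. (J1 t \<omega>, J2 t \<omega>))"
proof -
  have fdd: "measure M {\<omega> \<in> space M. \<forall>k\<le>n. (J1 (t k) \<omega>, J2 (t k) \<omega>) = i k}
     = measure M {\<omega> \<in> space M. \<forall>k\<le>n. J1 (t k) \<omega> = fst (i k)} * measure M {\<omega> \<in> space M. \<forall>k\<le>n. J2 (t k) \<omega> = snd (i k)}"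
    if t: "\<And>k. 0 \<le> t k" for n and t :: "nat \<Rightarrow> real" and i
  proof -
    have sets: "{x \<in> space (Pi\<^sub>M {0..} (\<lambda>_. count_space UNIV)). \<forall>k\<in>{..n}. x (t k) = j k} \<in> sets (Pi\<^sub>M {0..} (\<lambda>_. count_space UNIV))"
      for j :: "nat \<Rightarrow> 'c::finite"
    proof -
      have [measurable]: "(\<lambda>x. x (t k)) \<in> measurable (Pi\<^sub>M {0..} (\<lambda>_. count_space UNIV)) (count_space UNIV)" for k
        using t by (intro measurable_component_singleton) auto
      show ?thesis by measurable
    qed
    have ext: "(\<lambda>t\<in>{0..}. y t) \<in> {x \<in> space (Pi\<^sub>M {0..} (\<lambda>_. count_space UNIV)). \<forall>k\<in>{..n}. x (t k) = j k} \<longleftrightarrow> (\<forall>k\<le>n. y (t k) = j k)"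
      for y :: "real \<Rightarrow> 'c" and j
      using t by (auto simp: space_PiM)
    have "measure M {\<omega> \<in> space M. (\<forall>k\<le>n. J1 (t k) \<omega> = fst (i k)) \<and> (\<forall>k\<le>n. J2 (t k) \<omega> = snd (i k))}
      = measure M {\<omega> \<in> space M. \<forall>k\<le>n. J1 (t k) \<omega> = fst (i k)} * measure M {\<omega> \<in> space M. \<forall>k\<le>n. J2 (t k) \<omega> = snd (i k)}"
      using independent_pairD[OF ind sets[of "\<lambda>k. fst (i k)"] sets[of "\<lambda>k. snd (i k)"]]
      unfolding ext .
    moreover have "(\<forall>k\<le>n. (J1 (t k) \<omega>, J2 (t k) \<omega>) = i k) \<longleftrightarrow> (\<forall>k\<le>n. J1 (t k) \<omega> = fst (i k)) \<and> (\<forall>k\<le>n. J2 (t k) \<omega> = snd (i k))" for \<omega>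
      by (auto simp: prod_eq_iff)
    ultimately show ?thesis by simp
  qed
  show ?thesis
    unfolding markov_jump_process_def
  proof (intro conjI allI impI ballI)
    show "prob_space M" using 1 by (simp add: markov_jump_process_def)
    show "intensity_matrix (kronecker_sum A B)"
      using 1 2 by (intro intensity_matrix_kronecker_sum) (simp_all add: markov_jump_process_def)
    fix t :: real assume t: "0 \<le> t"
    have "(\<lambda>\<omega>. (J1 t \<omega>, J2 t \<omega>)) \<in> measurable M (count_space UNIV \<Otimes>\<^sub>M count_space UNIV)"
      using 1 2 t by (intro measurable_Pair) (simp_all add: markov_jump_process_def)
    then show "(\<lambda>\<omega>. (J1 t \<omega>, J2 t \<omega>)) \<in> measurable M (count_space UNIV)"
      by (simp add: pair_measure_countable)
    fix \<omega> assume \<omega>: "\<omega> \<in> space M"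
    have "limitin (discrete_topology UNIV) (\<lambda>s. J1 s \<omega>) (J1 t \<omega>) (at_right t)"
      using t \<omega> by (rule markov_jump_process_right_continuous[OF 1])
    then have "eventually (\<lambda>s. J1 s \<omega> = J1 t \<omega>) (at_right t)"
      by (simp only: limitin_discrete_topology_UNIV)
    moreover have "limitin (discrete_topology UNIV) (\<lambda>s. J2 s \<omega>) (J2 t \<omega>) (at_right t)"
      using t \<omega> by (rule markov_jump_process_right_continuous[OF 2])
    then have "eventually (\<lambda>s. J2 s \<omega> = J2 t \<omega>) (at_right t)"
      by (simp only: limitin_discrete_topology_UNIV)
    ultimately have "eventually (\<lambda>s. (J1 s \<omega>, J2 s \<omega>) = (J1 t \<omega>, J2 t \<omega>)) (at_right t)"
      by eventually_elim simp
    then show "limitin (discrete_topology UNIV) (\<lambda>s. (J1 s \<omega>, J2 s \<omega>)) (J1 t \<omega>, J2 t \<omega>) (at_right t)"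
      by (simp only: limitin_discrete_topology_UNIV)
  next
    fix i :: "'a \<times> 'b"
    have "measure M {\<omega> \<in> space M. J1 0 \<omega> = fst i} = pmf p (fst i)" "measure M {\<omega> \<in> space M. J2 0 \<omega> = snd i} = pmf q (snd i)"
      using 1 2 by (simp_all add: markov_jump_process_def)
    then show "measure M {\<omega> \<in> space M. (J1 0 \<omega>, J2 0 \<omega>) = i} = pmf (pair_pmf p q) i"
      using fdd[of "\<lambda>_. 0" 0 "\<lambda>_. i"] by (cases i) (simp add: pmf_pair)
  next
    fix n and t :: "nat \<Rightarrow> real" and i :: "nat \<Rightarrow> 'a \<times> 'b" assume t: "0 \<le> t 0 \<and> incseq t"
    then have t0: "0 \<le> t k" for k using incseqD[of t 0 k] by simp
    have "measure M {\<omega> \<in> space M. \<forall>k\<le>Suc n. J1 (t k) \<omega> = fst (i k)} =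
        measure M {\<omega> \<in> space M. \<forall>k\<le>n. J1 (t k) \<omega> = fst (i k)} * transition_matrix A (t (Suc n) - t n) $ fst (i n) $ fst (i (Suc n))"
      by (rule markov_jump_process_transition[OF 1 t])
    moreover have "measure M {\<omega> \<in> space M. \<forall>k\<le>Suc n. J2 (t k) \<omega> = snd (i k)} =
        measure M {\<omega> \<in> space M. \<forall>k\<le>n. J2 (t k) \<omega> = snd (i k)} * transition_matrix B (t (Suc n) - t n) $ snd (i n) $ snd (i (Suc n))"
      by (rule markov_jump_process_transition[OF 2 t])
    moreover have "transition_matrix (kronecker_sum A B) (t (Suc n) - t n) $ i n $ i (Suc n)
      = transition_matrix A (t (Suc n) - t n) $ fst (i n) $ fst (i (Suc n)) * transition_matrix B (t (Suc n) - t n) $ snd (i n) $ snd (i (Suc n))"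
      using transition_matrix_kronecker_sum[of A B _ "fst (i n)" "snd (i n)" "fst (i (Suc n))" "snd (i (Suc n))"] by simp
    ultimately show "measure M {\<omega> \<in> space M. \<forall>k\<le>Suc n. (J1 (t k) \<omega>, J2 (t k) \<omega>) = i k} =
        measure M {\<omega> \<in> space M. \<forall>k\<le>n. (J1 (t k) \<omega>, J2 (t k) \<omega>) = i k} * transition_matrix (kronecker_sum A B) (t (Suc n) - t n) $ i n $ i (Suc n)"
      unfolding fdd[OF t0] by simp
  qed
qed

lemma (in uniformized_chain) sets_proper_arrivals: "{x \<in> space S. proper_arrivals x} \<in> sets S"
proof -
  \<comment> \<open>Integer thresholds suffice, which makes the quantifier countable.\<close>
  have eq: "(\<forall>t. \<exists>n. t < arrival x n) \<longleftrightarrow> (\<forall>m::nat. \<exists>n. real m < arrival x n)" for x :: "nat \<Rightarrow> real \<times> 'u"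
    by (meson less_trans reals_Archimedean2)
  show ?thesis unfolding proper_arrivals_def eq by measurable
qed

section \<open>The common probability space\<close>

locale mmbm_space = chain: uniformized_chain \<Lambda> U f P Q
  for \<Lambda> and U :: "real measure" and f :: "'s::finite \<Rightarrow> real \<Rightarrow> 's" and P Q +
  fixes p :: "'s pmf"
  assumes sets_U: "sets U = sets borel"
begin

text \<open>Block \<open>0\<close> feeds the Brownian motion, blocks \<open>1\<close>, \<open>2\<close> and \<open>3\<close> feed the gaps, the marks and the
  initial state of the phase process, and blocks \<open>4 + 2 n\<close> and \<open>5 + 2 n\<close> feed the sampling times and the
  extra exponential variables of the \<open>n\<close>-th telegraph process.\<close>

definition law :: "nat \<Rightarrow> real measure" where
  "law a = (if a = 0 then normal_measure 1 else if a = 1 then exponential_measure \<Lambda> else if a = 2 then U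
     else if a = 3 then distr (measure_pmf p) borel (\<lambda>i. real (to_nat i))
     else if even a then exponential_measure ((2 ^ ((a - 4) div 2))\<^sup>2 / 2)
     else exponential_measure (2 * 2 ^ ((a - 4) div 2)))"

lemma sets_law: "sets (law a) = sets borel"
  by (simp add: law_def sets_U)

lemma prob_space_law: "prob_space (law a)"
  unfolding law_def using chain.rate_pos chain.prob_space_marks
  by (auto intro!: prob_space_normal_density prob_space_exponential_density prob_space.prob_space_distr prob_space_measure_pmf)

abbreviation "M \<equiv> block_measure law UNIV"

sublocale M: prob_space M
  by (rule prob_space_PiM) (rule prob_space_law)

lemma iid_law: "iid M (law a) (component a)"
  by (rule iid_component[of law, OF prob_space_law])

definition normals :: "(nat \<Rightarrow> real) \<Rightarrow> nat \<Rightarrow> real" where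
  "normals \<omega> = (if regular_dyadic (component 0 \<omega>) then component 0 \<omega> else (\<lambda>_. 0))"

text \<open>Off the event of proper arrivals all gaps are reset to \<open>1\<close>, which is a
  proper input; the mark \<open>0\<close> is arbitrary.\<close>

definition proper_marks :: "(nat \<Rightarrow> real \<times> real) \<Rightarrow> nat \<Rightarrow> real \<times> real" where
  "proper_marks x = (if proper_arrivals x then x else (\<lambda>_. (1, 0)))"

definition marks :: "(nat \<Rightarrow> real) \<Rightarrow> nat \<Rightarrow> real \<times> real" where
  "marks \<omega> = proper_marks (\<lambda>k. (component 1 \<omega> k, component 2 \<omega> k))"

definition initial :: "(nat \<Rightarrow> real) \<Rightarrow> 's" where
  "initial \<omega> = from_nat (nat \<lfloor>component 3 \<omega> 0\<rfloor>)"

definition gaps :: "nat \<Rightarrow> (nat \<Rightarrow> real) \<Rightarrow> nat \<Rightarrow> real" where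
  "gaps n \<omega> = zigzag_gap (2 ^ n) (sampled_increment (component (4 + 2 * n) \<omega>) (normals \<omega>)) (component (5 + 2 * n) \<omega>)"

definition proper_gaps :: "(nat \<Rightarrow> real) \<Rightarrow> nat \<Rightarrow> real" where
  "proper_gaps g = (if proper_arrivals (unmarked g) then g else (\<lambda>_. 1))"

definition J :: "real \<Rightarrow> (nat \<Rightarrow> real) \<Rightarrow> 's" where
  "J t \<omega> = jump_path f (initial \<omega>) (marks \<omega>) t"

definition B :: "real \<Rightarrow> (nat \<Rightarrow> real) \<Rightarrow> real" where
  "B t \<omega> = levy_path (normals \<omega>) t"

definition \<epsilon> :: "nat \<Rightarrow> real \<Rightarrow> (nat \<Rightarrow> real) \<Rightarrow> sign" where
  "\<epsilon> n t \<omega> = jump_path flip Plus (unmarked (proper_gaps (gaps n \<omega>))) t"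

lemma regular_normals: "regular_dyadic (normals \<omega>)"
  by (simp add: normals_def regular_dyadic_0)

lemma proper_arrivals_unit: "proper_arrivals (\<lambda>_. (1, u))"
  unfolding proper_arrivals_def arrival_def by (auto intro: reals_Archimedean2)

lemma proper_arrivals_marks: "proper_arrivals (marks \<omega>)"
  by (simp add: marks_def proper_marks_def proper_arrivals_unit)

lemma proper_arrivals_gaps: "proper_arrivals (unmarked (proper_gaps g))"
  by (simp add: proper_gaps_def proper_arrivals_unit)

lemma measurable_normals: "0 \<in> A \<Longrightarrow> normals \<in> measurable (block_measure law A) (seq_measure borel)"
proof -
  assume "0 \<in> A"
  note c = measurable_component[OF sets_law this]
  have san: "(\<lambda>z. if regular_dyadic z then z else (\<lambda>_. 0)) \<in> measurable (seq_measure borel) (seq_measure borel)"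
    using sets_regular_dyadic by (intro measurable_If) (auto simp: space_PiM)
  show ?thesis
    using measurable_compose[OF c san] by (simp add: normals_def[abs_def])
qed

lemma iid_normals: "iid M (normal_measure 1) normals"
proof -
  have N: "prob_space (normal_measure 1)" by (rule prob_space_normal_density) simp
  have sets_eq: "sets (seq_measure (normal_measure 1)) = sets (seq_measure borel)" by (intro sets_PiM_cong) auto
  have "iid (seq_measure (normal_measure 1)) (normal_measure 1) (\<lambda>z. if regular_dyadic z then z else (\<lambda>_. 0))"
  proof (rule iid_sanitize(1)[OF N AE_regular_dyadic])
    show "{z \<in> space (seq_measure (normal_measure 1)). regular_dyadic z} \<in> sets (seq_measure (normal_measure 1))"
      using sets_regular_dyadic by (simp add: sets_eq space_PiM)
  qed (simp add: space_PiM)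
  from iid_compose[OF _ this, of M "component 0"]
  show ?thesis
    using iid_law[of 0] by (simp add: normals_def[abs_def] law_def)
qed

lemma brownian_motion: "standard_brownian_motion M B"
  using standard_brownian_motion_levy_path[OF M.prob_space_axioms iid_normals regular_normals]
  by (simp add: B_def[abs_def])

lemma space_U: "space U = UNIV"
  using sets_eq_imp_space_eq[OF sets_U] by simp

lemma measurable_proper_marks: "proper_marks \<in> measurable chain.S chain.S"
  unfolding proper_marks_def using chain.sets_proper_arrivals
  by (intro measurable_If) (auto simp: space_PiM space_pair_measure space_U)

lemma measurable_marks: "{1, 2} \<subseteq> A \<Longrightarrow> marks \<in> measurable (block_measure law A) chain.S"
proof -
  assume "{1, 2} \<subseteq> A"
  then have A: "1 \<in> A" "2 \<in> A" by auto
  have "(\<lambda>\<omega>. component 2 \<omega> k) \<in> measurable (block_measure law A) U" for k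
    using measurable_component_coord[OF sets_law A(2), of k] by (simp add: measurable_cong_sets[OF refl sets_U])
  moreover have "(\<lambda>\<omega>. component 1 \<omega> k) \<in> measurable (block_measure law A) chain.E" for k
    using measurable_component_coord[OF sets_law A(1), of k] by simp
  ultimately have c: "(\<lambda>\<omega>. (component 1 \<omega> k, component 2 \<omega> k)) \<in> measurable (block_measure law A) chain.N" for k
    by (rule measurable_Pair[rotated])
  have "(\<lambda>\<omega> k. (component 1 \<omega> k, component 2 \<omega> k)) \<in> measurable (block_measure law A) chain.S"
    by (rule measurable_PiM_single'[OF c]) (simp add: space_pair_measure space_U)
  from measurable_compose[OF this measurable_proper_marks] show ?thesis
    by (simp add: marks_def[abs_def])
qed

lemma measurable_initial: "3 \<in> A \<Longrightarrow> initial \<in> measurable (block_measure law A) (count_space UNIV)"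
proof -
  assume "3 \<in> A"
  note [measurable] = measurable_component_coord[OF sets_law this]
  have "(\<lambda>\<omega>. nat \<lfloor>component 3 \<omega> 0\<rfloor>) \<in> measurable (block_measure law A) (count_space UNIV)" by measurable
  from measurable_compose[OF this, of from_nat "count_space UNIV"] show ?thesis
    by (simp add: initial_def[abs_def])
qed

lemma measurable_arrival_marks: "{1, 2} \<subseteq> A \<Longrightarrow> (\<lambda>\<omega>. arrival (marks \<omega>) n) \<in> borel_measurable (block_measure law A)"
  by (rule measurable_compose[OF measurable_marks chain.measurable_arrival])

lemma measurable_embedded_marks:
  "{1, 2, 3} \<subseteq> A \<Longrightarrow> (\<lambda>\<omega>. embedded_state f (initial \<omega>) (marks \<omega>) n) \<in> measurable (block_measure law A) (count_space UNIV)"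
proof -
  assume A: "{1, 2, 3} \<subseteq> A"
  show ?thesis
  proof (rule measurable_compose_countable[where f="\<lambda>i \<omega>. embedded_state f i (marks \<omega>) n"])
    show "(\<lambda>\<omega>. embedded_state f i (marks \<omega>) n) \<in> measurable (block_measure law A) (count_space UNIV)" for i
      using A by (intro measurable_compose[OF measurable_marks chain.measurable_embedded_state]) auto
    show "initial \<in> measurable (block_measure law A) (count_space UNIV)"
      using A by (intro measurable_initial) auto
  qed
qed

lemma measurable_J: "{1, 2, 3} \<subseteq> A \<Longrightarrow> J t \<in> measurable (block_measure law A) (count_space UNIV)"
  unfolding J_def[abs_def]
  by (rule measurable_jump_path) (auto intro!: proper_arrivals_marks measurable_arrival_marks measurable_embedded_marks)

lemma measurable_J_joint: "(\<lambda>w. J (snd w) (fst w)) \<in> measurable (M \<Otimes>\<^sub>M lborel) (count_space UNIV)"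
  unfolding J_def[abs_def]
  by (rule measurable_jump_path)
    (auto intro!: proper_arrivals_marks measurable_compose[OF measurable_fst measurable_arrival_marks]
      measurable_compose[OF measurable_fst measurable_embedded_marks])

lemma iid_marks: "iid M chain.N marks"
proof -
  have E: "prob_space (exponential_measure \<Lambda>)" by (rule chain.E.prob_space_axioms)
  have 1: "iid M (exponential_measure \<Lambda>) (component 1)" and 2: "iid M U (component 2)"
    using iid_law[of 1] iid_law[of 2] by (simp_all add: law_def)
  have s1: "sets (seq_measure (exponential_measure \<Lambda>)) = sets (seq_measure borel)" and s2: "sets (seq_measure U) = sets (seq_measure borel)"
    by (intro sets_PiM_cong; simp add: sets_U)+
  have "independent_pair M (seq_measure (exponential_measure \<Lambda>)) (component 1) (seq_measure U) (component 2)"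
    by (rule independent_pair_blocks[where D=law, OF prob_space_law, of "{1}" "{2}"])
      (auto simp: measurable_cong_sets[OF refl s1] measurable_cong_sets[OF refl s2] intro!: measurable_component sets_law)
  note z = iid_zip[OF E chain.prob_space_marks M.prob_space_axioms 1 2 this]
  have "iid chain.S chain.N (\<lambda>x. if proper_arrivals x then x else (\<lambda>_. (1, 0)))"
    by (rule iid_sanitize(1)[OF chain.EU.prob_space_axioms chain.AE_proper_arrivals chain.sets_proper_arrivals])
      (simp add: space_PiM space_pair_measure space_U)
  from iid_compose[OF z this] show ?thesis
    unfolding marks_def[abs_def] proper_marks_def .
qed

lemma measure_initial: "measure M {\<omega> \<in> space M. initial \<omega> = i} = pmf p i"
proof -
  have 3: "iid M (law 3) (component 3)" by (rule iid_law)
  let ?g = "\<lambda>u::real. from_nat (nat \<lfloor>u\<rfloor>) :: 's"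
  have "(\<lambda>u::real. nat \<lfloor>u\<rfloor>) \<in> measurable borel (count_space UNIV)" by measurable
  from measurable_compose[OF this, of from_nat "count_space UNIV"]
  have g: "?g \<in> measurable borel (count_space UNIV)" by simp
  have s: "?g -` {i} \<in> sets borel" using measurable_sets[OF g, of "{i}"] by simp
  have c: "(\<lambda>\<omega>. component 3 \<omega> 0) \<in> measurable M (law 3)" by (rule iid_coord_measurable[OF 3])
  have "measure M {\<omega> \<in> space M. initial \<omega> = i} = measure (distr M (law 3) (\<lambda>\<omega>. component 3 \<omega> 0)) (?g -` {i})"
    using c s by (subst measure_distr) (auto simp: initial_def sets_law vimage_def Int_def conj_commute)
  also have "distr M (law 3) (\<lambda>\<omega>. component 3 \<omega> 0) = law 3"
    by (rule iid_distr_coord[OF 3 prob_space_law])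
  also have "measure (law 3) (?g -` {i}) = measure (distr (measure_pmf p) borel (\<lambda>i. real (to_nat i))) (?g -` {i})"
    by (simp add: law_def)
  also have "\<dots> = measure (measure_pmf p) {i}"
    using s by (subst measure_distr) (auto intro!: arg_cong[where f="measure (measure_pmf p)"])
  finally show ?thesis by (simp add: measure_pmf_single)
qed

lemma markov_jump_process_J: "markov_jump_process M p Q J"
proof -
  have "independent_pair M (count_space UNIV) initial chain.S marks"
  proof (rule independent_pair_blocks[where D=law, OF prob_space_law, of "{3}" "{1, 2}"])
    show "initial \<in> measurable (block_measure law {3}) (count_space UNIV)" by (rule measurable_initial) simp
    show "marks \<in> measurable (block_measure law {1, 2}) chain.S" by (rule measurable_marks) simp
  qed (simp_all add: initial_def marks_def)
  from chain.markov_jump_process_jump_path[OF M.prob_space_axioms iid_marks proper_arrivals_marks _ measure_initial this]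
  show ?thesis using measurable_initial[of UNIV] by (simp add: J_def[abs_def])
qed

lemma measurable_J_path:
  "{1, 2, 3} \<subseteq> A \<Longrightarrow> (\<lambda>\<omega>. \<lambda>t\<in>{0..}. J t \<omega>) \<in> measurable (block_measure law A) (Pi\<^sub>M {0..} (\<lambda>_. count_space UNIV))"
  by (intro measurable_restrict measurable_J)

lemma J_restrict: "{1, 2, 3} \<subseteq> A \<Longrightarrow> J t (restrict \<omega> (blocks A)) = J t \<omega>"
  by (simp add: J_def initial_def marks_def)

text \<open>\<open>B\<close> reads block \<open>0\<close> and \<open>J\<close> reads blocks
  \<open>1\<close>, \<open>2\<close>, \<open>3\<close>. The rest of the argument rewrites the
  generated sigma-algebras as families of preimages.\<close>

lemma independent_processes_B_J: "independent_processes M B J"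
proof -
  have B: "(\<lambda>\<omega>. \<lambda>t\<in>{0..}. B t \<omega>) \<in> measurable (block_measure law {0}) (Pi\<^sub>M {0..} (\<lambda>_. borel))"
    unfolding B_def by (intro measurable_restrict measurable_compose[OF measurable_normals measurable_levy_path]) simp
  have ind: "independent_pair M (Pi\<^sub>M {0..} (\<lambda>_. borel)) (\<lambda>\<omega>. \<lambda>t\<in>{0..}. B t \<omega>) (Pi\<^sub>M {0..} (\<lambda>_. count_space UNIV)) (\<lambda>\<omega>. \<lambda>t\<in>{0..}. J t \<omega>)"
    by (rule independent_pair_blocks[where D=law, OF prob_space_law _ B measurable_J_path[of "{1, 2, 3}"]])
      (simp_all add: B_def normals_def J_restrict)
  note m = independent_pair_measurable[OF ind]
  have sB: "sets (vimage_algebra (space M) (\<lambda>\<omega>. \<lambda>t\<in>{0..}. B t \<omega>) (Pi\<^sub>M {0..} (\<lambda>_. borel)))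
      = {(\<lambda>\<omega>. \<lambda>t\<in>{0..}. B t \<omega>) -` A \<inter> space M | A. A \<in> sets (Pi\<^sub>M {0..} (\<lambda>_. borel))}"
    by (rule sets_vimage_algebra2) (use measurable_space[OF m(1)] in auto)
  have sJ: "sets (vimage_algebra (space M) (\<lambda>\<omega>. \<lambda>t\<in>{0..}. J t \<omega>) (Pi\<^sub>M {0..} (\<lambda>_. count_space UNIV)))
      = {(\<lambda>\<omega>. \<lambda>t\<in>{0..}. J t \<omega>) -` A \<inter> space M | A. A \<in> sets (Pi\<^sub>M {0..} (\<lambda>_. count_space UNIV))}"
    by (rule sets_vimage_algebra2) (use measurable_space[OF m(2)] in auto)
  show ?thesis
    unfolding independent_processes_def
  proof (rule M.indep_setI)
    fix a b
    assume "a \<in> sets (vimage_algebra (space M) (\<lambda>\<omega>. \<lambda>t\<in>{0..}. B t \<omega>) (Pi\<^sub>M {0..} (\<lambda>_. borel)))"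
      and "b \<in> sets (vimage_algebra (space M) (\<lambda>\<omega>. \<lambda>t\<in>{0..}. J t \<omega>) (Pi\<^sub>M {0..} (\<lambda>_. count_space UNIV)))"
    then obtain A1 A2 where A: "A1 \<in> sets (Pi\<^sub>M {0..} (\<lambda>_. borel))" "A2 \<in> sets (Pi\<^sub>M {0..} (\<lambda>_. count_space UNIV))"
      and ab: "a = (\<lambda>\<omega>. \<lambda>t\<in>{0..}. B t \<omega>) -` A1 \<inter> space M" "b = (\<lambda>\<omega>. \<lambda>t\<in>{0..}. J t \<omega>) -` A2 \<inter> space M"
      unfolding sB sJ by blast
    have eqs: "a \<inter> b = {\<omega> \<in> space M. (\<lambda>t\<in>{0..}. B t \<omega>) \<in> A1 \<and> (\<lambda>t\<in>{0..}. J t \<omega>) \<in> A2}"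
      "a = {\<omega> \<in> space M. (\<lambda>t\<in>{0..}. B t \<omega>) \<in> A1}" "b = {\<omega> \<in> space M. (\<lambda>t\<in>{0..}. J t \<omega>) \<in> A2}"
      unfolding ab by auto
    show "M.prob (a \<inter> b) = M.prob a * M.prob b"
      using independent_pairD[OF ind A] unfolding eqs(1) by (simp only: eqs(2,3)[symmetric])
  next
    show "sets (vimage_algebra (space M) (\<lambda>\<omega>. \<lambda>t\<in>{0..}. B t \<omega>) (Pi\<^sub>M {0..} (\<lambda>_. borel))) \<subseteq> M.events"
      unfolding sB using measurable_sets[OF m(1)] by blast
    show "sets (vimage_algebra (space M) (\<lambda>\<omega>. \<lambda>t\<in>{0..}. J t \<omega>) (Pi\<^sub>M {0..} (\<lambda>_. count_space UNIV))) \<subseteq> M.events"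
      unfolding sJ using measurable_sets[OF m(2)] by blast
  qed
qed

lemma has_ito_integral:
  "0 \<le> t \<Longrightarrow> has_ito_integral M (joint_filtration M B J) B (\<lambda>s \<omega>. h (J s \<omega>)) t
    (\<lambda>\<omega>. path_integral f (initial \<omega>) (marks \<omega>) h (\<lambda>s. B s \<omega>) t)"
  unfolding J_def[abs_def]
  by (rule has_ito_integral_path_integral[OF brownian_motion proper_arrivals_marks])
    (auto intro!: measurable_arrival_marks measurable_embedded_marks)

lemma measurable_h_J_time: "(\<lambda>s. h (J s \<omega>)) \<in> borel_measurable borel" for h :: "'s \<Rightarrow> real"
  unfolding J_def by (rule measurable_compose[OF measurable_jump_path_time[OF proper_arrivals_marks]]) simp

lemma measurable_h_\<epsilon>_time: "(\<lambda>s. h (\<epsilon> n s \<omega>)) \<in> borel_measurable borel" for h :: "sign \<Rightarrow> real"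
  unfolding \<epsilon>_def by (rule measurable_compose[OF measurable_jump_path_time[OF proper_arrivals_gaps]]) simp

definition R :: "('s \<Rightarrow> real) \<Rightarrow> ('s \<Rightarrow> real) \<Rightarrow> real \<Rightarrow> (nat \<Rightarrow> real) \<Rightarrow> real" where
  "R \<mu> \<sigma> t \<omega> = (LINT s:{0..t}|lborel. \<mu> (J s \<omega>)) + path_integral f (initial \<omega>) (marks \<omega>) \<sigma> (\<lambda>s. B s \<omega>) t"

text \<open>The process \<open>I\<close> is the path functional itself, which is continuous in
  \<open>t\<close> for every outcome and a version of the Ito integral at each time.\<close>

theorem markov_modulated_brownian_motion_R:
  assumes \<sigma>: "\<And>i. 0 < \<sigma> i"
  shows "markov_modulated_brownian_motion M p Q \<mu> \<sigma> (R \<mu> \<sigma>) J"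
  unfolding markov_modulated_brownian_motion_def
proof (intro conjI allI impI)
  show "R \<mu> \<sigma> t \<in> borel_measurable M" if t: "0 \<le> t" for t
  proof -
    have [measurable]: "(\<lambda>w. \<mu> (J (snd w) (fst w))) \<in> borel_measurable (M \<Otimes>\<^sub>M lborel)"
      by (rule measurable_compose[OF measurable_J_joint]) simp
    have "(\<lambda>\<omega>. LINT s:{0..t}|lborel. \<mu> (J s \<omega>)) \<in> borel_measurable M"
      unfolding set_lebesgue_integral_def
      by (rule lborel.borel_measurable_lebesgue_integral) (unfold split_beta', measurable)
    moreover have "(\<lambda>\<omega>. path_integral f (initial \<omega>) (marks \<omega>) \<sigma> (\<lambda>s. B s \<omega>) t) \<in> borel_measurable M"
      using has_ito_integral[OF t, of \<sigma>] by (simp add: has_ito_integral_def)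
    ultimately show ?thesis unfolding R_def[abs_def] by simp
  qed
  show "\<exists>B I. standard_brownian_motion M B \<and> independent_processes M B J \<and>
     (\<forall>t\<ge>0. has_ito_integral M (joint_filtration M B J) B (\<lambda>s \<omega>. \<sigma> (J s \<omega>)) t (I t)) \<and>
     (\<forall>\<omega>\<in>space M. continuous_on {0..} (\<lambda>t. I t \<omega>)) \<and>
     (\<forall>\<omega>\<in>space M. \<forall>t\<ge>0. R \<mu> \<sigma> t \<omega> = (LINT s:{0..t}|lborel. \<mu> (J s \<omega>)) + I t \<omega>)"
  proof (rule exI[of _ B], rule exI[of _ "\<lambda>t \<omega>. path_integral f (initial \<omega>) (marks \<omega>) \<sigma> (\<lambda>s. B s \<omega>) t"], intro conjI ballI allI impI)
    show "continuous_on {0..} (path_integral f (initial \<omega>) (marks \<omega>) \<sigma> (\<lambda>s. B s \<omega>))" for \<omega>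
      unfolding B_def
      by (intro continuous_on_path_integral proper_arrivals_marks continuous_on_levy_path regular_normals)
  qed (simp_all add: brownian_motion independent_processes_B_J has_ito_integral R_def)
qed (auto simp: \<sigma> markov_jump_process_J)

lemma law_4: "law (4 + 2 * n) = exponential_measure ((2 ^ n)\<^sup>2 / 2)" and law_5: "law (5 + 2 * n) = exponential_measure (2 * 2 ^ n)"
  by (simp_all add: law_def)

lemma measurable_gaps: "{0, 4 + 2 * n, 5 + 2 * n} \<subseteq> A \<Longrightarrow> gaps n \<in> measurable (block_measure law A) (seq_measure borel)"
proof -
  assume "{0, 4 + 2 * n, 5 + 2 * n} \<subseteq> A"
  then have A: "0 \<in> A" "4 + 2 * n \<in> A" "5 + 2 * n \<in> A" by auto
  have "(\<lambda>\<omega>. (component (4 + 2 * n) \<omega>, normals \<omega>)) \<in> measurable (block_measure law A) (seq_measure borel \<Otimes>\<^sub>M seq_measure borel)"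
    by (intro measurable_Pair measurable_component[OF sets_law A(2)] measurable_normals A)
  from measurable_compose[OF this measurable_sampled_increment]
  have [measurable]: "(\<lambda>\<omega>. sampled_increment (component (4 + 2 * n) \<omega>) (normals \<omega>) k) \<in> borel_measurable (block_measure law A)" for k
    by simp
  have [measurable]: "(\<lambda>\<omega>. component (5 + 2 * n) \<omega> k) \<in> borel_measurable (block_measure law A)" for k
    by (rule measurable_component_coord[OF sets_law A(3)])
  have "(\<lambda>\<omega>. gaps n \<omega> k) \<in> borel_measurable (block_measure law A)" for k
    unfolding gaps_def zigzag_gap_def interleave_def by (cases "even k") simp_all
  then show ?thesis by (rule measurable_PiM_single') simp
qed

lemma iid_gaps: "iid M (exponential_measure ((2 ^ n)\<^sup>2)) (gaps n)"
  unfolding gaps_def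
proof (rule iid_zigzag_gap[OF _ M.prob_space_axioms _ iid_normals])
  let ?X = "component (4 + 2 * n)" and ?Y = "component (5 + 2 * n)"
  show "iid M (exponential_measure ((2 ^ n)\<^sup>2 / 2)) ?X" "iid M (exponential_measure (2 * 2 ^ n)) ?Y"
    using iid_law[of "4 + 2 * n"] iid_law[of "5 + 2 * n"]
    unfolding law_4 law_5 .
  have s: "sets (seq_measure (density lborel g)) = sets (seq_measure borel)" for g :: "real \<Rightarrow> ennreal"
    by (intro sets_PiM_cong) auto
  show "independent_pair M (seq_measure (exponential_measure ((2 ^ n)\<^sup>2 / 2))) ?X (seq_measure (normal_measure 1)) normals"
  proof (rule independent_pair_blocks[where D=law, OF prob_space_law, of "{4 + 2 * n}" "{0}"])
    show "?X \<in> measurable (block_measure law {4 + 2 * n}) (seq_measure (exponential_measure ((2 ^ n)\<^sup>2 / 2)))"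
      unfolding measurable_cong_sets[OF refl s] by (rule measurable_component[OF sets_law]) simp
    show "normals \<in> measurable (block_measure law {0}) (seq_measure (normal_measure 1))"
      unfolding measurable_cong_sets[OF refl s] by (rule measurable_normals) simp
  qed (simp_all add: normals_def)
  show "independent_pair M (seq_measure borel \<Otimes>\<^sub>M seq_measure borel) (\<lambda>\<omega>. (?X \<omega>, normals \<omega>)) (seq_measure (exponential_measure (2 * 2 ^ n))) ?Y"
  proof (rule independent_pair_blocks[where D=law, OF prob_space_law, of "{0, 4 + 2 * n}" "{5 + 2 * n}"])
    show "(\<lambda>\<omega>. (?X \<omega>, normals \<omega>)) \<in> measurable (block_measure law {0, 4 + 2 * n}) (seq_measure borel \<Otimes>\<^sub>M seq_measure borel)"
      by (intro measurable_Pair measurable_component[OF sets_law] measurable_normals) auto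
    show "?Y \<in> measurable (block_measure law {5 + 2 * n}) (seq_measure (exponential_measure (2 * 2 ^ n)))"
      unfolding measurable_cong_sets[OF refl s] by (rule measurable_component[OF sets_law]) simp
  qed (auto simp: normals_def)
qed simp

lemma sets_proper_unmarked: "{g \<in> space (seq_measure borel). proper_arrivals (unmarked g)} \<in> sets (seq_measure borel)"
proof -
  have eq: "(\<forall>t. \<exists>n. t < a n) \<longleftrightarrow> (\<forall>m::nat. \<exists>n. real m < a n)" for a :: "nat \<Rightarrow> real"
    by (meson less_trans reals_Archimedean2)
  show ?thesis unfolding proper_arrivals_def arrival_unmarked arrival_time_def fst_conv eq by measurable
qed

lemma measurable_proper_gaps: "proper_gaps \<in> measurable (seq_measure borel) (seq_measure borel)"
  unfolding proper_gaps_def using sets_proper_unmarked by (intro measurable_If) (auto simp: space_PiM)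

lemma
  shows iid_proper_gaps: "iid M (exponential_measure ((2 ^ n)\<^sup>2)) (\<lambda>\<omega>. proper_gaps (gaps n \<omega>))"
    and AE_proper_gaps: "AE \<omega> in M. proper_gaps (gaps n \<omega>) = gaps n \<omega>"
proof -
  let ?E = "exponential_measure ((2 ^ n)\<^sup>2)"
  have E: "prob_space ?E" by (rule prob_space_exponential_density) simp
  have s: "sets (seq_measure ?E) = sets (seq_measure borel)" by (intro sets_PiM_cong) auto
  have ae: "AE g in seq_measure ?E. proper_arrivals (unmarked g)" by (rule AE_proper_unmarked) simp
  have m: "{g \<in> space (seq_measure ?E). proper_arrivals (unmarked g)} \<in> sets (seq_measure ?E)"
    using sets_proper_unmarked by (simp add: s space_PiM)
  have sp: "(\<lambda>_. 1) \<in> space (seq_measure ?E)" by (simp add: space_PiM)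
  show "iid M ?E (\<lambda>\<omega>. proper_gaps (gaps n \<omega>))"
    using iid_compose[OF iid_gaps iid_sanitize(1)[OF E ae m sp]] by (simp add: proper_gaps_def)
  have d: "distr M (seq_measure ?E) (gaps n) = seq_measure ?E"
    using iid_gaps[of n] unfolding iid_def by (rule conjunct2)
  have "AE g in distr M (seq_measure ?E) (gaps n). proper_gaps g = g"
    unfolding d proper_gaps_def by (rule iid_sanitize(2)[OF E ae m sp])
  from AE_distrD[OF iid_measurable[OF iid_gaps] this]
  show "AE \<omega> in M. proper_gaps (gaps n \<omega>) = gaps n \<omega>" .
qed

lemma measurable_embedded_flip: "(\<lambda>\<omega>. embedded_state flip Plus (unmarked (g \<omega>)) k) \<in> measurable N (count_space UNIV)"
  by (simp add: embedded_state_flip)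

lemma measurable_arrival_gaps:
  assumes "{0, 4 + 2 * n, 5 + 2 * n} \<subseteq> A"
  shows "(\<lambda>\<omega>. arrival (unmarked (proper_gaps (gaps n \<omega>))) k) \<in> borel_measurable (block_measure law A)"
proof -
  have "(\<lambda>g. arrival (unmarked g) k) \<in> borel_measurable (seq_measure borel)" unfolding arrival_def by simp
  from measurable_compose[OF measurable_compose[OF measurable_gaps[OF assms] measurable_proper_gaps] this] show ?thesis .
qed

lemma measurable_\<epsilon>: "{0, 4 + 2 * n, 5 + 2 * n} \<subseteq> A \<Longrightarrow> \<epsilon> n t \<in> measurable (block_measure law A) (count_space UNIV)"
  unfolding \<epsilon>_def[abs_def]
  by (rule measurable_jump_path[where 's=sign]) (auto intro!: proper_arrivals_gaps measurable_arrival_gaps measurable_embedded_flip)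

lemma measurable_\<epsilon>_joint: "(\<lambda>w. \<epsilon> n (snd w) (fst w)) \<in> measurable (M \<Otimes>\<^sub>M lborel) (count_space UNIV)"
  unfolding \<epsilon>_def[abs_def]
  by (rule measurable_jump_path)
    (auto intro!: proper_arrivals_gaps measurable_compose[OF measurable_fst measurable_arrival_gaps] measurable_embedded_flip)

text \<open>The start is always \<open>Plus\<close>, so its independence of the gaps is trivial; the
  flip rate is that of the zigzag gaps.\<close>

lemma markov_jump_process_\<epsilon>: "markov_jump_process M (return_pmf Plus) (flip_intensity ((2 ^ n)\<^sup>2)) (\<epsilon> n)"
proof -
  have l: "0 < ((2::real) ^ n)\<^sup>2" by simp
  interpret F: uniformized_chain "(2 ^ n)\<^sup>2" "return (count_space UNIV) ()" flip "\<chi> i j. if i = j then 0 else 1" "flip_intensity ((2 ^ n)\<^sup>2)"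
    by (rule uniformized_chain_flip[OF l])
  have iid: "iid M F.N (\<lambda>\<omega>. unmarked (proper_gaps (gaps n \<omega>)))"
    by (rule iid_unmarked[OF M.prob_space_axioms l iid_proper_gaps])
  have "independent_pair M (count_space UNIV) (\<lambda>_. Plus) F.S (\<lambda>\<omega>. unmarked (proper_gaps (gaps n \<omega>)))"
    unfolding independent_pair_def
  proof (intro conjI ballI)
    show "(\<lambda>\<omega>. unmarked (proper_gaps (gaps n \<omega>))) \<in> measurable M F.S" by (rule iid_measurable[OF iid])
    fix a b
    show "M.prob {\<omega> \<in> space M. Plus \<in> a \<and> unmarked (proper_gaps (gaps n \<omega>)) \<in> b}
      = M.prob {\<omega> \<in> space M. Plus \<in> a} * M.prob {\<omega> \<in> space M. unmarked (proper_gaps (gaps n \<omega>)) \<in> b}"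
      by (cases "Plus \<in> a") (auto simp: M.prob_space)
  qed simp
  from F.markov_jump_process_jump_path[OF M.prob_space_axioms iid proper_arrivals_gaps _ _ this, of "return_pmf Plus"]
  show ?thesis by (simp add: \<epsilon>_def[abs_def] M.prob_space indicator_def)
qed

text \<open>The direction is built from \<open>B\<close> and two private blocks and never reads the
  blocks of the phase process. It is independent of \<open>J\<close> in spite of its dependence on
  \<open>B\<close>.\<close>

lemma independent_paths_\<epsilon>_J:
  "independent_pair M (Pi\<^sub>M {0..} (\<lambda>_. count_space UNIV)) (\<lambda>\<omega>. \<lambda>t\<in>{0..}. \<epsilon> n t \<omega>)
    (Pi\<^sub>M {0..} (\<lambda>_. count_space UNIV)) (\<lambda>\<omega>. \<lambda>t\<in>{0..}. J t \<omega>)"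
proof (rule independent_pair_blocks[where D=law, OF prob_space_law, of "{0, 4 + 2 * n, 5 + 2 * n}" "{1, 2, 3}"])
  show "(\<lambda>\<omega>. \<lambda>t\<in>{0..}. \<epsilon> n t \<omega>) \<in> measurable (block_measure law {0, 4 + 2 * n, 5 + 2 * n}) (Pi\<^sub>M {0..} (\<lambda>_. count_space UNIV))"
    by (intro measurable_restrict measurable_\<epsilon>) simp
  show "(\<lambda>\<omega>. \<lambda>t\<in>{0..}. J t \<omega>) \<in> measurable (block_measure law {1, 2, 3}) (Pi\<^sub>M {0..} (\<lambda>_. count_space UNIV))"
    by (rule measurable_J_path) simp
qed (auto simp: \<epsilon>_def gaps_def normals_def J_restrict)

section \<open>The fluid processes and their convergence\<close>

definition Jn :: "nat \<Rightarrow> real \<Rightarrow> (nat \<Rightarrow> real) \<Rightarrow> sign \<times> 's" where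
  "Jn n t \<omega> = (\<epsilon> n t \<omega>, J t \<omega>)"

definition rate :: "('s \<Rightarrow> real) \<Rightarrow> ('s \<Rightarrow> real) \<Rightarrow> nat \<Rightarrow> sign \<times> 's \<Rightarrow> real" where
  "rate \<mu> \<sigma> n = (\<lambda>(e, i). \<mu> i + \<sigma> i * (2 ^ n * sign_value e))"

definition Rn :: "('s \<Rightarrow> real) \<Rightarrow> ('s \<Rightarrow> real) \<Rightarrow> nat \<Rightarrow> real \<Rightarrow> (nat \<Rightarrow> real) \<Rightarrow> real" where
  "Rn \<mu> \<sigma> n t \<omega> = (LINT s:{0..t}|lborel. rate \<mu> \<sigma> n (Jn n s \<omega>))"

theorem stochastic_fluid_process_Rn: "stochastic_fluid_process M (Rn \<mu> \<sigma> n) (Jn n)"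
  unfolding stochastic_fluid_process_def
proof (intro exI conjI allI impI ballI)
  show "markov_jump_process M (pair_pmf (return_pmf Plus) p) (kronecker_sum (flip_intensity ((2 ^ n)\<^sup>2)) Q) (Jn n)"
    unfolding Jn_def[abs_def]
    by (rule markov_jump_process_pair[OF markov_jump_process_\<epsilon> markov_jump_process_J independent_paths_\<epsilon>_J])
  show "Rn \<mu> \<sigma> n t \<omega> = (LINT s:{0..t}|lborel. rate \<mu> \<sigma> n (Jn n s \<omega>))" for t \<omega>
    by (simp add: Rn_def)
  show "Rn \<mu> \<sigma> n t \<in> borel_measurable M" for t
  proof -
    have m: "(\<lambda>w. h (J (snd w) (fst w))) \<in> borel_measurable (M \<Otimes>\<^sub>M lborel)" for h :: "'s \<Rightarrow> real"
      by (rule measurable_compose[OF measurable_J_joint]) simp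
    have m': "(\<lambda>w. sign_value (\<epsilon> n (snd w) (fst w))) \<in> borel_measurable (M \<Otimes>\<^sub>M lborel)"
      by (rule measurable_compose[OF measurable_\<epsilon>_joint]) simp
    note [measurable] = m m'
    show ?thesis
      unfolding Rn_def[abs_def] set_lebesgue_integral_def rate_def Jn_def prod.case
      by (rule lborel.borel_measurable_lebesgue_integral) (unfold split_beta', measurable)
  qed
qed

text \<open>The noise part of the level is the path functional of \<open>R\<close> with the
  telegraph path in place of \<open>B\<close>. The drift part is that of \<open>R\<close> and
  cancels in the difference.\<close>

lemma Rn_eq:
  assumes t: "0 \<le> t"
  shows "Rn \<mu> \<sigma> n t \<omega> = (LINT s:{0..t}|lborel. \<mu> (J s \<omega>)) + path_integral f (initial \<omega>) (marks \<omega>) \<sigma> (telegraph (2 ^ n) (proper_gaps (gaps n \<omega>))) t"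
proof -
  let ?y = "\<lambda>s. 2 ^ n * sign_value (\<epsilon> n s \<omega>)"
  have y: "?y \<in> borel_measurable borel" and yb: "\<bar>?y s\<bar> \<le> 2 ^ n" for s
    using measurable_h_\<epsilon>_time[of sign_value n \<omega>] by (auto simp: abs_mult abs_sign_value)
  have bd: "\<bar>h j\<bar> \<le> (\<Sum>j\<in>UNIV. \<bar>h j\<bar>)" for h :: "'s \<Rightarrow> real" and j by (rule member_le_sum) auto
  have i1: "set_integrable lborel {0..t} (\<lambda>s. \<mu> (J s \<omega>))"
    by (rule set_integrable_bounded_Icc[OF measurable_h_J_time bd])
  have i2: "set_integrable lborel {0..t} (\<lambda>s. \<sigma> (J s \<omega>) * ?y s)"
  proof (rule set_integrable_bounded_Icc)
    show "(\<lambda>s. \<sigma> (J s \<omega>) * ?y s) \<in> borel_measurable borel"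
      by (intro borel_measurable_times measurable_h_J_time y)
    show "\<bar>\<sigma> (J s \<omega>) * ?y s\<bar> \<le> (\<Sum>j\<in>UNIV. \<bar>\<sigma> j\<bar>) * 2 ^ n" for s
      unfolding abs_mult[of "\<sigma> (J s \<omega>)"] by (intro mult_mono bd yb sum_nonneg) auto
  qed
  have "Rn \<mu> \<sigma> n t \<omega> = (LINT s:{0..t}|lborel. \<mu> (J s \<omega>) + \<sigma> (J s \<omega>) * ?y s)"
    by (simp add: Rn_def rate_def Jn_def)
  also have "\<dots> = (LINT s:{0..t}|lborel. \<mu> (J s \<omega>)) + (LINT s:{0..t}|lborel. \<sigma> (J s \<omega>) * ?y s)"
    by (rule set_integral_add(2)[OF i1 i2])
  also have "(LINT s:{0..t}|lborel. \<sigma> (J s \<omega>) * ?y s) = path_integral f (initial \<omega>) (marks \<omega>) \<sigma> (\<lambda>r. LINT s:{0..r}|lborel. ?y s) t"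
    unfolding J_def by (rule set_integral_path_integral[OF proper_arrivals_marks t y yb])
  also have "(\<lambda>r. LINT s:{0..r}|lborel. ?y s) = telegraph (2 ^ n) (proper_gaps (gaps n \<omega>))"
    by (simp add: fun_eq_iff telegraph_def \<epsilon>_def)
  finally show ?thesis .
qed

text \<open>Almost surely the telegraph paths converge uniformly on \<open>[0, K]\<close> with
  \<open>K \<ge> T\<close>, and the path functional is Lipschitz for the supremum norm with the
  constant \<open>2 * C\<close>, which depends on the outcome but not on \<open>n\<close>.\<close>

theorem Rn_tendsto_R:
  assumes T: "0 \<le> T"
  shows "AE \<omega> in M. (\<lambda>n. SUP s\<in>{0..T}. \<bar>R \<mu> \<sigma> s \<omega> - Rn \<mu> \<sigma> n s \<omega>\<bar>) \<longlonglongrightarrow> 0"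
proof -
  have X: "iid M (exponential_measure ((2 ^ n)\<^sup>2 / 2)) (component (4 + 2 * n))" for n
    using iid_law[of "4 + 2 * n"] unfolding law_4 .
  have "AE \<omega> in M. \<forall>K::nat. \<forall>e>0. eventually (\<lambda>n. \<forall>t\<in>{0..real K}. \<bar>telegraph (2 ^ n) (gaps n \<omega>) t - levy_path (normals \<omega>) t\<bar> \<le> e) sequentially"
    using telegraph_tendsto_levy_path[OF M.prob_space_axioms X iid_gaps[unfolded gaps_def] regular_normals]
    by (simp add: gaps_def)
  moreover have "AE \<omega> in M. \<forall>n. proper_gaps (gaps n \<omega>) = gaps n \<omega>"
    by (intro AE_all_countable[THEN iffD2] allI AE_proper_gaps)
  ultimately show ?thesis
  proof eventually_elim
    case (elim \<omega>)
    define C where "C = (\<Sum>l\<le>count_arrivals (marks \<omega>) T. \<bar>jump_coeff \<sigma> f (initial \<omega>) (marks \<omega>) l\<bar>)"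
    have C: "0 \<le> C" unfolding C_def by (intro sum_nonneg) simp
    obtain K :: nat where K: "T \<le> real K" using real_arch_simple by blast
    show ?case
    proof (rule tendstoI)
      fix e :: real assume e: "0 < e"
      \<comment> \<open>The summand \<open>1\<close> avoids division by zero when
        \<open>C = 0\<close>; with this \<open>d\<close> the error is at most
        \<open>e / 2\<close>.\<close>
      define d where "d = e / (4 * (C + 1))"
      have d: "0 < d" using e C by (simp add: d_def)
      have "C * (2 * d) \<le> (C + 1) * (2 * d)" using d by (intro mult_right_mono) auto
      also have "\<dots> = e / 2" using C by (simp add: d_def field_simps)
      finally have Cd: "C * (2 * d) < e" using e by simp
      from elim(1)[rule_format, OF d, of K]
      show "eventually (\<lambda>n. dist (SUP s\<in>{0..T}. \<bar>R \<mu> \<sigma> s \<omega> - Rn \<mu> \<sigma> n s \<omega>\<bar>) 0 < e) sequentially"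
      proof eventually_elim
        case (elim n)
        have b: "\<bar>R \<mu> \<sigma> s \<omega> - Rn \<mu> \<sigma> n s \<omega>\<bar> \<le> C * (2 * d)" if s: "s \<in> {0..T}" for s
        proof -
          have "R \<mu> \<sigma> s \<omega> - Rn \<mu> \<sigma> n s \<omega> = path_integral f (initial \<omega>) (marks \<omega>) \<sigma> (\<lambda>s. B s \<omega>) s
             - path_integral f (initial \<omega>) (marks \<omega>) \<sigma> (telegraph (2 ^ n) (gaps n \<omega>)) s"
            using s Rn_eq[of s \<mu> \<sigma> n \<omega>] \<open>\<forall>n. proper_gaps (gaps n \<omega>) = gaps n \<omega>\<close> by (simp add: R_def)
          also have "\<bar>\<dots>\<bar> \<le> C * (2 * d)"
            unfolding C_def
          proof (rule path_integral_diff_bound[OF proper_arrivals_marks])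
            fix r assume "0 \<le> r" "r \<le> T"
            then show "\<bar>B r \<omega> - telegraph (2 ^ n) (gaps n \<omega>) r\<bar> \<le> d"
              using bspec[OF elim, of r] K by (simp add: B_def abs_minus_commute)
          qed (use s in auto)
          finally show ?thesis .
        qed
        have "(SUP s\<in>{0..T}. \<bar>R \<mu> \<sigma> s \<omega> - Rn \<mu> \<sigma> n s \<omega>\<bar>) \<le> C * (2 * d)"
          using T b by (intro cSUP_least) auto
        \<comment> \<open>Nonnegativity of the supremum is read off from its member at time
          \<open>0\<close>, using that the set is bounded above.\<close>
        moreover have "0 \<le> (SUP s\<in>{0..T}. \<bar>R \<mu> \<sigma> s \<omega> - Rn \<mu> \<sigma> n s \<omega>\<bar>)"
        proof -
          have "\<bar>R \<mu> \<sigma> 0 \<omega> - Rn \<mu> \<sigma> n 0 \<omega>\<bar> \<le> (SUP s\<in>{0..T}. \<bar>R \<mu> \<sigma> s \<omega> - Rn \<mu> \<sigma> n s \<omega>\<bar>)"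
            using T b by (intro cSUP_upper bdd_aboveI2[where M="C * (2 * d)"]) auto
          then show ?thesis by linarith
        qed
        ultimately show ?case using Cd by simp
      qed
    qed
  qed
qed

end

theorem theorem1p1:
  fixes p :: "'s::finite pmf"
    and Q :: "real ^ 's ^ 's"
    and \<mu> \<sigma> :: "'s \<Rightarrow> real"
  assumes "intensity_matrix Q"
    and "\<And>i. 0 < \<sigma> i"
  shows "\<exists>(M :: (nat \<Rightarrow> real) measure)
      (R :: real \<Rightarrow> (nat \<Rightarrow> real) \<Rightarrow> real)
      (J :: real \<Rightarrow> (nat \<Rightarrow> real) \<Rightarrow> 's)
      (Rn :: nat \<Rightarrow> real \<Rightarrow> (nat \<Rightarrow> real) \<Rightarrow> real)
      (Jn :: nat \<Rightarrow> real \<Rightarrow> (nat \<Rightarrow> real) \<Rightarrow> sign \<times> 's).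
    prob_space M \<and>
    markov_modulated_brownian_motion M p Q \<mu> \<sigma> R J \<and>
    (\<forall>n. stochastic_fluid_process M (Rn n) (Jn n)) \<and>
    (\<forall>T\<ge>0.
      (AE \<omega> in M. (\<lambda>n. SUP s\<in>{0..T}. \<bar>R s \<omega> - Rn n s \<omega>\<bar>) \<longlonglongrightarrow> 0) \<and>
      (AE \<omega> in M. limitin (discrete_topology UNIV) (\<lambda>n. snd (Jn n T \<omega>)) (J T \<omega>) sequentially))"
proof -
  obtain \<Lambda> and U :: "real measure" and f P where "uniformized_chain \<Lambda> U f P Q" and U: "sets U = sets borel"
    by (rule exists_uniformized_chain[OF assms(1)]) blast
  then interpret mmbm_space \<Lambda> U f P Q p
    by (simp add: mmbm_space_def mmbm_space_axioms_def)
  show ?thesis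
  proof (intro exI[of _ M] exI[of _ "R \<mu> \<sigma>"] exI[of _ J] exI[of _ "Rn \<mu> \<sigma>"] exI[of _ Jn] conjI allI impI)
    show "prob_space M" by (rule M.prob_space_axioms)
    show "markov_modulated_brownian_motion M p Q \<mu> \<sigma> (R \<mu> \<sigma>) J"
      by (rule markov_modulated_brownian_motion_R[OF assms(2)])
    show "stochastic_fluid_process M (Rn \<mu> \<sigma> n) (Jn n)" for n
      by (rule stochastic_fluid_process_Rn)
    fix T :: real assume "0 \<le> T"
    then show "AE \<omega> in M. (\<lambda>n. SUP s\<in>{0..T}. \<bar>R \<mu> \<sigma> s \<omega> - Rn \<mu> \<sigma> n s \<omega>\<bar>) \<longlonglongrightarrow> 0"
      by (rule Rn_tendsto_R)
    \<comment> \<open>The phase component of \<open>Jn n\<close> is \<open>J\<close> for every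
      \<open>n\<close>, so the sequence is constant.\<close>
    show "AE \<omega> in M. limitin (discrete_topology UNIV) (\<lambda>n. snd (Jn n T \<omega>)) (J T \<omega>) sequentially"
      by (simp add: Jn_def limitin_def)
  qed
qed

end
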